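(* Let $G$ be a finitely presented group and let $G'\leq N\leq G$. The $N$-fibre product $H_{-\mathrm{id}}$ in $G\times G$ is finitely presented if and only if $N$ is finitely generated.
   Context: $G'$ denotes the commutator subgroup of $G$. Since $G'\leq N$, the quotient $G/N$ is abelian and $-\mathrm{id}:G/N\to G/N$, $gN\mapsto g^{-1}N$, is an automorphism. $H_{-\mathrm{id}}=\{(g_1,g_2)\in G\times G\mid g_1^{-1}N=g_2N\}$. *)

theory Defs
  imports "HOL-Algebra.Generated_Groups"
begin

section \<open>Free groups\<close>

text \<open>A letter \<open>(x, True)\<close> stands for the generator \<open>x\<close>, and \<open>(x, False)\<close> for its formal inverse.\<close>

type_synonym 'x word = "('x \<times> bool) list"

definition words :: "'x set \<Rightarrow> 'x word set" where
  "words X = lists (X \<times> UNIV)"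

inductive_set free_rel :: "'x set \<Rightarrow> ('x word \<times> 'x word) set" for X where
  refl: "w \<in> words X \<Longrightarrow> (w, w) \<in> free_rel X"
| cancel: "\<lbrakk>u \<in> words X; v \<in> words X; x \<in> X\<rbrakk>
    \<Longrightarrow> (u @ [(x, b), (x, \<not> b)] @ v, u @ v) \<in> free_rel X"
| sym: "(u, v) \<in> free_rel X \<Longrightarrow> (v, u) \<in> free_rel X"
| trans: "\<lbrakk>(u, v) \<in> free_rel X; (v, w) \<in> free_rel X\<rbrakk> \<Longrightarrow> (u, w) \<in> free_rel X"

definition free_group :: "'x set \<Rightarrow> 'x word set monoid" where
  "free_group X = \<lparr>carrier = words X // free_rel X,
     mult = (\<lambda>A B. \<Union>u\<in>A. \<Union>v\<in>B. free_rel X `` {u @ v}),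
     one = free_rel X `` {[]}\<rparr>"

lemma words_simps [simp]:
  "[] \<in> words X"
  "(x, b) # w \<in> words X \<longleftrightarrow> x \<in> X \<and> w \<in> words X"
  "u @ v \<in> words X \<longleftrightarrow> u \<in> words X \<and> v \<in> words X"
  by (auto simp: words_def)

lemma free_rel_in_words: "(u, v) \<in> free_rel X \<Longrightarrow> u \<in> words X \<and> v \<in> words X"
  by (induction rule: free_rel.induct) auto

lemma equiv_free_rel: "equiv (words X) (free_rel X)"
  by (rule equivI)
    (auto intro!: refl_onI symI transI intro: free_rel.intros dest: free_rel_in_words)

lemma free_rel_append_left:
  "(u, v) \<in> free_rel X \<Longrightarrow> w \<in> words X \<Longrightarrow> (w @ u, w @ v) \<in> free_rel X"
proof (induction rule: free_rel.induct)
  case (cancel u v x b)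
  then show ?case using free_rel.cancel[of "w @ u" X v x b] by simp
qed (auto intro: free_rel.intros)

lemma free_rel_append_right:
  "(u, v) \<in> free_rel X \<Longrightarrow> w \<in> words X \<Longrightarrow> (u @ w, v @ w) \<in> free_rel X"
proof (induction rule: free_rel.induct)
  case (cancel u v x b)
  then show ?case using free_rel.cancel[of u X "v @ w" x b] by simp
qed (auto intro: free_rel.intros)

lemma free_rel_congruent2:
  "congruent2 (free_rel X) (free_rel X) (\<lambda>u v. free_rel X `` {u @ v})"
proof (rule congruent2I[OF equiv_free_rel equiv_free_rel])
  fix u v w assume uv: "(u, v) \<in> free_rel X" and w: "w \<in> words X"
  show "free_rel X `` {u @ w} = free_rel X `` {v @ w}"
    by (rule equiv_class_eq[OF equiv_free_rel free_rel_append_right[OF uv w]])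
  show "free_rel X `` {w @ u} = free_rel X `` {w @ v}"
    by (rule equiv_class_eq[OF equiv_free_rel free_rel_append_left[OF uv w]])
qed

lemma free_group_mult:
  assumes "u \<in> words X" "v \<in> words X"
  shows "(free_rel X `` {u}) \<otimes>\<^bsub>free_group X\<^esub> (free_rel X `` {v}) = free_rel X `` {u @ v}"
  using UN_equiv_class2[OF equiv_free_rel equiv_free_rel free_rel_congruent2 assms]
  by (simp add: free_group_def)

definition word_inv :: "'x word \<Rightarrow> 'x word" where
  "word_inv w = rev (map (\<lambda>(x, b). (x, \<not> b)) w)"

lemma word_inv_in_words: "w \<in> words X \<Longrightarrow> word_inv w \<in> words X"
  by (induction w) (auto simp: word_inv_def)

lemma word_inv_left: "w \<in> words X \<Longrightarrow> (word_inv w @ w, []) \<in> free_rel X"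
proof (induction w)
  case Nil
  then show ?case by (simp add: word_inv_def free_rel.refl)
next
  case (Cons a w)
  obtain x b where a: "a = (x, b)" by fastforce
  have "(word_inv w @ [(x, \<not> b), (x, \<not> \<not> b)] @ w, word_inv w @ w) \<in> free_rel X"
    using Cons.prems a by (intro free_rel.cancel) (auto simp: word_inv_in_words)
  moreover have "(word_inv w @ w, []) \<in> free_rel X"
    using Cons a by simp
  ultimately show ?case
    using free_rel.trans by (fastforce simp: a word_inv_def)
qed

lemma group_free_group: "group (free_group X)"
proof (rule groupI)
  fix A assume "A \<in> carrier (free_group X)"
  then obtain u where u: "u \<in> words X" "A = free_rel X `` {u}"
    by (auto simp: free_group_def elim: quotientE)
  have one: "\<one>\<^bsub>free_group X\<^esub> = free_rel X `` {[]}" by (simp add: free_group_def)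
  show "\<one>\<^bsub>free_group X\<^esub> \<otimes>\<^bsub>free_group X\<^esub> A = A"
    using free_group_mult[of "[]" X u] u by (simp add: one)
  have "free_rel X `` {word_inv u} \<otimes>\<^bsub>free_group X\<^esub> A = \<one>\<^bsub>free_group X\<^esub>"
    using u by (simp add: free_group_mult word_inv_in_words one
        equiv_class_eq[OF equiv_free_rel word_inv_left])
  moreover have "free_rel X `` {word_inv u} \<in> carrier (free_group X)"
    using u by (simp add: free_group_def quotientI word_inv_in_words)
  ultimately show "\<exists>B\<in>carrier (free_group X). B \<otimes>\<^bsub>free_group X\<^esub> A = \<one>\<^bsub>free_group X\<^esub>"
    by blast
  fix B assume "B \<in> carrier (free_group X)"
  then obtain v where v: "v \<in> words X" "B = free_rel X `` {v}"
    by (auto simp: free_group_def elim: quotientE)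
  have AB: "A \<otimes>\<^bsub>free_group X\<^esub> B = free_rel X `` {u @ v}"
    using u v free_group_mult by blast
  then show "A \<otimes>\<^bsub>free_group X\<^esub> B \<in> carrier (free_group X)"
    using u v by (simp add: free_group_def quotientI)
  fix C assume "C \<in> carrier (free_group X)"
  then obtain w where w: "w \<in> words X" "C = free_rel X `` {w}"
    by (auto simp: free_group_def elim: quotientE)
  show "A \<otimes>\<^bsub>free_group X\<^esub> B \<otimes>\<^bsub>free_group X\<^esub> C = A \<otimes>\<^bsub>free_group X\<^esub> (B \<otimes>\<^bsub>free_group X\<^esub> C)"
    using u v w by (simp add: free_group_mult)
next
  show "\<one>\<^bsub>free_group X\<^esub> \<in> carrier (free_group X)"
    by (simp add: free_group_def quotientI)
qed


section \<open>Finite generation and finite presentation\<close>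

definition normal_closure :: "('a, 'm) monoid_scheme \<Rightarrow> 'a set \<Rightarrow> 'a set" where
  "normal_closure G R =
     generate G {g \<otimes>\<^bsub>G\<^esub> r \<otimes>\<^bsub>G\<^esub> inv\<^bsub>G\<^esub> g | g r. g \<in> carrier G \<and> r \<in> R}"

definition presented_group :: "'x set \<Rightarrow> 'x word set set \<Rightarrow> 'x word set set monoid" where
  "presented_group X R = free_group X Mod normal_closure (free_group X) R"

definition finitely_generated :: "('a, 'm) monoid_scheme \<Rightarrow> bool" where
  "finitely_generated G \<longleftrightarrow>
     group G \<and> (\<exists>S. finite S \<and> S \<subseteq> carrier G \<and> generate G S = carrier G)"

text \<open>Taking the generators from \<^typ>\<open>nat\<close> is no restriction, as they are finite in number.\<close>

definition finitely_presented :: "('a, 'm) monoid_scheme \<Rightarrow> bool" where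
  "finitely_presented G \<longleftrightarrow>
     group G \<and>
     (\<exists>(X :: nat set) R. finite X \<and> finite R \<and> R \<subseteq> carrier (free_group X) \<and>
        G \<cong> presented_group X R)"

lemma (in group) normal_closure_normal:
  assumes "R \<subseteq> carrier G"
  shows "normal_closure G R \<lhd> G"
proof -
  let ?S = "{g \<otimes> r \<otimes> inv g | g r. g \<in> carrier G \<and> r \<in> R}"
  have S: "?S \<subseteq> carrier G" using assms by auto
  show ?thesis
    unfolding normal_closure_def
  proof (rule normal_generateI[OF S])
    fix h g assume "h \<in> ?S" and g: "g \<in> carrier G"
    then obtain k r where k: "k \<in> carrier G" "r \<in> R" "h = k \<otimes> r \<otimes> inv k" by blast
    then have "g \<otimes> h \<otimes> inv g = (g \<otimes> k) \<otimes> r \<otimes> inv (g \<otimes> k)"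
      using assms g by (auto simp: inv_mult_group m_assoc subset_iff)
    then show "g \<otimes> h \<otimes> inv g \<in> ?S" using k g by blast
  qed
qed


section \<open>The fibre product of \<open>- id\<close>\<close>

definition fibre_product_neg_id :: "('a, 'm) monoid_scheme \<Rightarrow> 'a set \<Rightarrow> ('a \<times> 'a) set" where
  "fibre_product_neg_id G N =
     {(g1, g2) \<in> carrier G \<times> carrier G. inv\<^bsub>G\<^esub> g1 <#\<^bsub>G\<^esub> N = g2 <#\<^bsub>G\<^esub> N}"

lemma (in group) normal_if_derived_subset:
  assumes N: "subgroup N G" and der: "derived G (carrier G) \<subseteq> N"
  shows "N \<lhd> G"
proof (rule normal_invI[OF N])
  fix g n assume g: "g \<in> carrier G" and n: "n \<in> N"
  have nG: "n \<in> carrier G" by (rule subgroup.mem_carrier[OF N n])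
  have "g \<otimes> n \<otimes> inv g \<otimes> inv n \<in> derived G (carrier G)"
    unfolding derived_def using g nG by (intro generate.incl) blast
  then have "g \<otimes> n \<otimes> inv g \<otimes> inv n \<otimes> n \<in> N"
    using der by (intro subgroup.m_closed[OF N _ n]) blast
  then show "g \<otimes> n \<otimes> inv g \<in> N" using g nG by (simp add: m_assoc)
qed

lemma (in group) fibre_product_neg_id_eq:
  assumes N: "subgroup N G" and der: "derived G (carrier G) \<subseteq> N"
  shows "fibre_product_neg_id G N =
    {(g1, g2) \<in> carrier G \<times> carrier G. inv\<^bsub>G Mod N\<^esub> (N #> g1) = N #> g2}"
proof -
  interpret normal N G using normal_if_derived_subset[OF assms] .
  have "inv\<^bsub>G Mod N\<^esub> (N #> g) = inv g <# N" if "g \<in> carrier G" for g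
    using that inv_FactGroup[of "N #> g"] rcos_inv[of g] coset_eq
    by (auto simp: carrier_FactGroup)
  then show ?thesis
    unfolding fibre_product_neg_id_def using coset_eq by auto
qed

lemma (in group) fibre_product_neg_id_iff:
  assumes N: "subgroup N G" and g: "g1 \<in> carrier G" "g2 \<in> carrier G"
  shows "(g1, g2) \<in> fibre_product_neg_id G N \<longleftrightarrow> g1 \<otimes> g2 \<in> N"
proof
  assume "(g1, g2) \<in> fibre_product_neg_id G N"
  then have "inv g1 <# N = g2 <# N" by (simp add: fibre_product_neg_id_def)
  moreover have "g2 \<in> g2 <# N"
    using g subgroup.one_closed[OF N] by (auto simp: l_coset_def intro!: bexI[of _ "\<one>"])
  ultimately obtain n where n: "n \<in> N" "g2 = inv g1 \<otimes> n" by (auto simp: l_coset_def)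
  then have "g1 \<otimes> g2 = n"
    using g subgroup.mem_carrier[OF N] by (simp add: m_assoc[symmetric])
  then show "g1 \<otimes> g2 \<in> N" using n by simp
next
  assume m: "g1 \<otimes> g2 \<in> N"
  have "inv g1 <# (g1 \<otimes> g2 <# N) = g2 <# N"
    using g subgroup.subset[OF N] by (simp add: lcos_m_assoc m_assoc[symmetric])
  moreover have "g1 \<otimes> g2 <# N = N"
    using coset_join3[OF _ N m] g by simp
  ultimately show "(g1, g2) \<in> fibre_product_neg_id G N"
    using g by (simp add: fibre_product_neg_id_def)
qed

lemma (in group) subgroup_fibre_product_neg_id:
  assumes N: "subgroup N G" and der: "derived G (carrier G) \<subseteq> N"
  shows "subgroup (fibre_product_neg_id G N) (G \<times>\<times> G)"
proof -
  interpret N: normal N G using normal_if_derived_subset[OF assms] .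
  interpret P: group "G \<times>\<times> G" using DirProd_group group_axioms by blast
  note iff = fibre_product_neg_id_iff[OF N]
  have sub: "fibre_product_neg_id G N \<subseteq> carrier (G \<times>\<times> G)"
    by (auto simp: fibre_product_neg_id_def)
  show ?thesis
  proof (rule P.subgroupI[OF sub])
    have "(\<one>, \<one>) \<in> fibre_product_neg_id G N" by (simp add: iff)
    then show "fibre_product_neg_id G N \<noteq> {}" by blast
  next
    fix a assume a: "a \<in> fibre_product_neg_id G N"
    obtain g h where gh: "a = (g, h)" by fastforce
    with a sub have c: "g \<in> carrier G" "h \<in> carrier G" by auto
    have "inv g \<otimes> (g \<otimes> h) \<otimes> g \<in> N"
      using N.inv_op_closed1[of g "g \<otimes> h"] a c by (simp add: gh iff)
    then have "h \<otimes> g \<in> N" using c by (simp add: m_assoc[symmetric])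
    then have "inv g \<otimes> inv h \<in> N"
      using c N.m_inv_closed inv_mult_group by metis
    then show "inv\<^bsub>G \<times>\<times> G\<^esub> a \<in> fibre_product_neg_id G N"
      using c by (simp add: gh iff inv_DirProd[OF group_axioms group_axioms])
  next
    fix a b assume a: "a \<in> fibre_product_neg_id G N" and b: "b \<in> fibre_product_neg_id G N"
    obtain g h where gh: "a = (g, h)" by fastforce
    obtain k l where kl: "b = (k, l)" by fastforce
    from a b sub gh kl have c: "g \<in> carrier G" "h \<in> carrier G" "k \<in> carrier G" "l \<in> carrier G"
      by auto
    let ?c = "k \<otimes> h \<otimes> inv k \<otimes> inv h"
    have "?c \<in> derived G (carrier G)"
      unfolding derived_def using c by (intro generate.incl) blast
    then have "g \<otimes> ?c \<otimes> inv g \<in> N" using der N.inv_op_closed2 c by blast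
    moreover have "g \<otimes> h \<in> N" "k \<otimes> l \<in> N" using a b c by (simp_all add: gh kl iff)
    ultimately have "(g \<otimes> ?c \<otimes> inv g) \<otimes> ((g \<otimes> h) \<otimes> (k \<otimes> l)) \<in> N" by blast
    moreover have "inv x \<otimes> (x \<otimes> y) = y" if "x \<in> carrier G" "y \<in> carrier G" for x y
      using that by (simp add: m_assoc[symmetric])
    ultimately have "(g \<otimes> k) \<otimes> (h \<otimes> l) \<in> N" using c by (simp add: m_assoc)
    then show "a \<otimes>\<^bsub>G \<times>\<times> G\<^esub> b \<in> fibre_product_neg_id G N"
      using c by (simp add: gh kl iff)
  qed
qed

end

theory Submission
  imports Defs
begin

text \<open>Write \<open>Q = G / N\<close> and \<open>H\<close> for the fibre product.

  If \<open>H\<close> is finitely presented but \<open>N\<close> is not finitely generated, Zorn's lemma yields a total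
  preorder on \<open>Q\<close>, with positive cone \<open>P\<close>, such that no finite set of steps reaches all of \<open>N\<close> by
  paths from \<open>1\<close> over \<open>P\<close>. The elements \<open>(x, 1)\<close> and \<open>(1, x)\<close> of \<open>H\<close> commute, and because of
  the sign in \<open>- id\<close> the conjugates \<open>x\<close> of normal generators of \<open>N\<close> along negative paths are
  reached by \<open>(x, 1)\<close> on the negative and by \<open>(1, x)\<close> on the positive side of the wall between the
  two cones. Counting crossings of one component of a strip around the wall is an exact cocycle, since
  the relators of \<open>H\<close> are short; hence \<open>x\<close> is already reached inside the strip, which contradicts
  the choice of \<open>P\<close>.

  Conversely, let \<open>N\<close> be finitely generated. For \<open>N = G\<close> the fibre product is \<open>G \<times> G\<close>, so it
  suffices to pass from \<open>\<langle>N, t\<rangle>\<close> down to \<open>N\<close>. Some finitely presented cover \<open>E\<close> of \<open>H\<close> admits a lift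
  of the conjugation by \<open>(t, 1)\<close>; the semidirect product of \<open>E\<close> with the integers maps onto the
  larger fibre product, which is finitely presented, and this forces the kernel of \<open>E \<rightarrow> H\<close> to be
  finitely generated as a normal subgroup.\<close>

section \<open>Presentations by words\<close>

text \<open>Bieri-Neumann-Strebel theory tests real characters of \<open>G / N\<close>; here total
  preorders take their place, because maximality alone produces them. Such a preorder may have many
  elements that are both positive and negative, so the wall has thickness, and the strip around it
  is measured by an element of the cone and not by a number. The obstacle in the forward direction
  is that \<open>N\<close> is at first only known to arise from finitely many elements by products
  and conjugation, and the conjugating paths are unbounded; the counting argument brings all these
  conjugates within reach of one finite set of steps. In the converse, conjugation by
  \<open>(t, 1)\<close> acts on the fibre product but need not lift to a given presentation, so the
  cover is defined by relations that themselves survive the twisting. The lift is inner on the left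
  factor of the cover and trivial on the right one. This makes the normal closure of suitably chosen
  kernel elements invariant, so that it can be divided out of the semidirect product.\<close>

lemma Cons_in_words: "a # w \<in> words X \<longleftrightarrow> fst a \<in> X \<and> w \<in> words X"
  by (cases a) simp

primrec word_val :: "('a, 'm) monoid_scheme \<Rightarrow> ('x \<Rightarrow> 'a) \<Rightarrow> 'x word \<Rightarrow> 'a" where
  "word_val G f [] = \<one>\<^bsub>G\<^esub>"
| "word_val G f (a # w) = (if snd a then f (fst a) else inv\<^bsub>G\<^esub> (f (fst a))) \<otimes>\<^bsub>G\<^esub> word_val G f w"

text \<open>Only elementary moves are built in: inserting and deleting cancelling pairs and
  relators. Inductions over null words therefore have little to check; closure under products and
  conjugation follows from \<open>null_words_context\<close>.\<close>

inductive_set null_words :: "'x set \<Rightarrow> 'x word set \<Rightarrow> 'x word set" for X R where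
  nil: "[] \<in> null_words X R"
| cancel_ins: "\<lbrakk>u @ v \<in> null_words X R; x \<in> X\<rbrakk> \<Longrightarrow> u @ [(x, b), (x, \<not> b)] @ v \<in> null_words X R"
| cancel_del: "\<lbrakk>u @ [(x, b), (x, \<not> b)] @ v \<in> null_words X R; x \<in> X\<rbrakk> \<Longrightarrow> u @ v \<in> null_words X R"
| rel_ins: "\<lbrakk>u @ v \<in> null_words X R; r \<in> R\<rbrakk> \<Longrightarrow> u @ r @ v \<in> null_words X R"
| rel_del: "\<lbrakk>u @ r @ v \<in> null_words X R; r \<in> R\<rbrakk> \<Longrightarrow> u @ v \<in> null_words X R"

text \<open>Stated inside a given group, without free group or quotient, and with letters of any
  type. Maps out of \<open>G\<close> and changes of the relators then become calculations with
  words.\<close>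

definition presentation :: "('a, 'm) monoid_scheme \<Rightarrow> 'x set \<Rightarrow> ('x \<Rightarrow> 'a) \<Rightarrow> 'x word set \<Rightarrow> bool" where
  "presentation G X f R \<longleftrightarrow> f \<in> X \<rightarrow> carrier G \<and> R \<subseteq> words X \<and> (\<forall>r\<in>R. word_val G f r = \<one>\<^bsub>G\<^esub>)
    \<and> (\<forall>g\<in>carrier G. \<exists>w\<in>words X. word_val G f w = g)
    \<and> (\<forall>w\<in>words X. word_val G f w = \<one>\<^bsub>G\<^esub> \<longrightarrow> w \<in> null_words X R)"

lemma presentationD:
  assumes "presentation G X f R"
  shows "f \<in> X \<rightarrow> carrier G" "R \<subseteq> words X" "\<And>r. r \<in> R \<Longrightarrow> word_val G f r = \<one>\<^bsub>G\<^esub>"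
    "\<And>g. g \<in> carrier G \<Longrightarrow> \<exists>w\<in>words X. word_val G f w = g"
    "\<And>w. w \<in> words X \<Longrightarrow> word_val G f w = \<one>\<^bsub>G\<^esub> \<Longrightarrow> w \<in> null_words X R"
  using assms unfolding presentation_def by blast+

lemma null_words_mono: "w \<in> null_words X R \<Longrightarrow> R \<subseteq> R' \<Longrightarrow> w \<in> null_words X R'"
  by (induction rule: null_words.induct) (blast intro: null_words.intros)+

lemma null_words_free_rel:
  "(u, v) \<in> free_rel X \<Longrightarrow> p @ u @ q \<in> null_words X R \<longleftrightarrow> p @ v @ q \<in> null_words X R"
proof (induction arbitrary: p q rule: free_rel.induct)
  case (cancel u v x b)
  then show ?case
    using null_words.cancel_ins[of "p @ u" "v @ q" X R x b] null_words.cancel_del[of "p @ u" x b "v @ q" X R]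
    by auto
qed auto

text \<open>A derivation of \<open>v\<close> is replayed between \<open>p\<close> and
  \<open>q\<close>. Each move has an inverse move, hence the equivalence.\<close>

lemma null_words_context:
  "v \<in> null_words X R \<Longrightarrow> p @ v @ q \<in> null_words X R \<longleftrightarrow> p @ q \<in> null_words X R"
proof (induction arbitrary: p q rule: null_words.induct)
  case nil then show ?case by simp
next
  case (cancel_ins u v x b)
  have "p @ (u @ [(x, b), (x, \<not> b)] @ v) @ q \<in> null_words X R \<longleftrightarrow> p @ (u @ v) @ q \<in> null_words X R"
    using null_words.cancel_ins[of "p @ u" "v @ q" X R x b] null_words.cancel_del[of "p @ u" x b "v @ q" X R]
      cancel_ins by auto
  then show ?case using cancel_ins by blast
next
  case (cancel_del u x b v)
  have "p @ (u @ [(x, b), (x, \<not> b)] @ v) @ q \<in> null_words X R \<longleftrightarrow> p @ (u @ v) @ q \<in> null_words X R"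
    using null_words.cancel_ins[of "p @ u" "v @ q" X R x b] null_words.cancel_del[of "p @ u" x b "v @ q" X R]
      cancel_del by auto
  then show ?case using cancel_del by blast
next
  case (rel_ins u v r)
  have "p @ (u @ r @ v) @ q \<in> null_words X R \<longleftrightarrow> p @ (u @ v) @ q \<in> null_words X R"
    using null_words.rel_ins[of "p @ u" "v @ q" X R r] null_words.rel_del[of "p @ u" r "v @ q" X R]
      rel_ins by auto
  then show ?case using rel_ins by blast
next
  case (rel_del u r v)
  have "p @ (u @ r @ v) @ q \<in> null_words X R \<longleftrightarrow> p @ (u @ v) @ q \<in> null_words X R"
    using null_words.rel_ins[of "p @ u" "v @ q" X R r] null_words.rel_del[of "p @ u" r "v @ q" X R]
      rel_del by auto
  then show ?case using rel_del by blast
qed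

lemma word_inv_word_inv: "word_inv (word_inv w) = w"
  by (simp add: word_inv_def rev_map[symmetric] comp_def case_prod_unfold)

lemma word_inv_right: "w \<in> words X \<Longrightarrow> (w @ word_inv w, []) \<in> free_rel X"
  using word_inv_left[of "word_inv w" X] by (simp add: word_inv_word_inv word_inv_in_words)

text \<open>\<open>word_inv w' @ w'\<close> is inserted after \<open>w\<close>; the null word
  \<open>w @ word_inv w'\<close> can then be dropped.\<close>

lemma null_words_cong:
  assumes "w \<in> words X" "w' \<in> words X" "w @ word_inv w' \<in> null_words X R"
  shows "p @ w @ q \<in> null_words X R \<longleftrightarrow> p @ w' @ q \<in> null_words X R"
proof -
  have "p @ w @ q \<in> null_words X R \<longleftrightarrow> (p @ w) @ (word_inv w' @ w') @ q \<in> null_words X R"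
    using null_words_free_rel[OF word_inv_left[OF assms(2)], of "p @ w" q R] by simp
  also have "\<dots> \<longleftrightarrow> p @ (w @ word_inv w') @ (w' @ q) \<in> null_words X R" by simp
  also have "\<dots> \<longleftrightarrow> p @ w' @ q \<in> null_words X R" using null_words_context[OF assms(3)] .
  finally show ?thesis .
qed

context group
begin

lemma inv_cancel_left [simp]: "x \<in> carrier G \<Longrightarrow> y \<in> carrier G \<Longrightarrow> inv x \<otimes> (x \<otimes> y) = y"
  by (simp add: m_assoc[symmetric])

lemma inv_cancel_left' [simp]: "x \<in> carrier G \<Longrightarrow> y \<in> carrier G \<Longrightarrow> x \<otimes> (inv x \<otimes> y) = y"
  by (simp add: m_assoc[symmetric])

lemma word_val_closed [simp]: "f \<in> X \<rightarrow> carrier G \<Longrightarrow> w \<in> words X \<Longrightarrow> word_val G f w \<in> carrier G"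
  by (induction w) (auto simp: Cons_in_words)

lemma word_val_append: "f \<in> X \<rightarrow> carrier G \<Longrightarrow> u \<in> words X \<Longrightarrow> v \<in> words X \<Longrightarrow>
    word_val G f (u @ v) = word_val G f u \<otimes> word_val G f v"
proof (induction u)
  case (Cons a u)
  have "f (fst a) \<in> carrier G" "word_val G f u \<in> carrier G" "word_val G f v \<in> carrier G"
    using Cons.prems word_val_closed[OF Cons.prems(1)] by (auto simp: Cons_in_words)
  with Cons show ?case by (simp add: Cons_in_words m_assoc)
next
  case Nil then show ?case using word_val_closed[OF Nil(1,3)] by simp
qed

lemma word_val_word_inv: "f \<in> X \<rightarrow> carrier G \<Longrightarrow> w \<in> words X \<Longrightarrow> word_val G f (word_inv w) = inv (word_val G f w)"
proof (induction w)
  case (Cons a w)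
  obtain x b where a: "a = (x, b)" by fastforce
  have c: "f x \<in> carrier G" "word_val G f w \<in> carrier G" "w \<in> words X" "x \<in> X"
    using Cons.prems word_val_closed[OF Cons.prems(1)] a by auto
  have "word_val G f (word_inv (a # w)) = word_val G f (word_inv w @ [(x, \<not> b)])"
    by (simp add: a word_inv_def)
  also have "\<dots> = word_val G f (word_inv w) \<otimes> word_val G f [(x, \<not> b)]"
    by (rule word_val_append[OF Cons.prems(1)]) (use c in \<open>auto simp: word_inv_in_words\<close>)
  finally show ?case using Cons c by (auto simp: a inv_mult_group)
qed (simp add: word_inv_def)

lemma word_val_free_rel: "(u, v) \<in> free_rel X \<Longrightarrow> f \<in> X \<rightarrow> carrier G \<Longrightarrow> word_val G f u = word_val G f v"
proof (induction rule: free_rel.induct)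
  case (cancel u v x b)
  have c: "f x \<in> carrier G" "word_val G f v \<in> carrier G" using cancel word_val_closed by auto
  have "word_val G f ([(x, b), (x, \<not> b)] @ v) = word_val G f v" using c by simp
  then show ?case using cancel word_val_append[of f X u v] word_val_append[of f X u "[(x, b), (x, \<not> b)] @ v"]
    by simp
qed auto

lemma null_words_in_words: "w \<in> null_words X R \<Longrightarrow> R \<subseteq> words X \<Longrightarrow> w \<in> words X"
  by (induction rule: null_words.induct) auto

lemma word_val_null_words:
  assumes "w \<in> null_words X R" "R \<subseteq> words X" "f \<in> X \<rightarrow> carrier G" "\<And>r. r \<in> R \<Longrightarrow> word_val G f r = \<one>"
  shows "word_val G f w = \<one>"
  using assms(1)
proof (induction rule: null_words.induct)
  case nil then show ?case by simp
next
  case (cancel_ins u v x b)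
  have w: "u \<in> words X" "v \<in> words X" using null_words_in_words[OF cancel_ins(1) assms(2)] by auto
  show ?case using word_val_free_rel[OF free_rel.cancel[OF w cancel_ins(2)] assms(3)] cancel_ins by simp
next
  case (cancel_del u x b v)
  have w: "u \<in> words X" "v \<in> words X" using null_words_in_words[OF cancel_del(1) assms(2)] by auto
  show ?case using word_val_free_rel[OF free_rel.cancel[OF w cancel_del(2)] assms(3), of b] cancel_del by simp
next
  case (rel_ins u v r)
  have w: "u \<in> words X" "v \<in> words X" "r \<in> words X"
    using null_words_in_words[OF rel_ins(1) assms(2)] rel_ins(2) assms(2) by auto
  show ?case using w word_val_append[OF assms(3)] word_val_closed[OF assms(3)] rel_ins assms(4) by simp
next
  case (rel_del u r v)
  have w: "u \<in> words X" "v \<in> words X" "r \<in> words X"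
    using null_words_in_words[OF rel_del(1) assms(2)] by auto
  show ?case using w word_val_append[OF assms(3)] word_val_closed[OF assms(3)] rel_del assms(4)
    by simp
qed

text \<open>Whether a word is null over \<open>R \<union> J\<close> depends only on its value,
  because words of equal value differ by a word that is null over \<open>R\<close>. So an element of
  the normal closure may be tested on a word that displays it as a product of conjugates of
  relators.\<close>

lemma null_words_normal_closure:
  assumes p: "presentation G X f R" and J: "J \<subseteq> words X" and w: "w \<in> words X"
    and n: "word_val G f w \<in> normal_closure G (word_val G f ` J)"
  shows "w \<in> null_words X (R \<union> J)"
proof -
  note f = presentationD(1)[OF p] and R = presentationD(2)[OF p]
    and sur = presentationD(4)[OF p] and ker = presentationD(5)[OF p]
  let ?N = "null_words X (R \<union> J)"
  have same: "u \<in> ?N \<longleftrightarrow> v \<in> ?N" if "u \<in> words X" "v \<in> words X" "word_val G f u = word_val G f v" for u v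
  proof -
    have "word_val G f (u @ word_inv v) = \<one>"
      using that by (simp add: word_val_append[OF f] word_val_word_inv[OF f] word_inv_in_words word_val_closed[OF f])
    then have "u @ word_inv v \<in> ?N"
      using ker that null_words_mono[of _ X R "R \<union> J"] by (simp add: word_inv_in_words)
    from null_words_cong[OF that(1,2) this, of "[]" "[]"] show ?thesis by simp
  qed
  have cj: "u @ j @ word_inv u \<in> ?N" if "u \<in> words X" "j \<in> ?N" for u j
    using null_words_context[OF that(2), of u "word_inv u"]
      null_words_free_rel[OF word_inv_right[OF that(1)], of "[]" "[]" "R \<union> J"] null_words.nil
    by auto
  have Jin: "j \<in> ?N" "word_inv j \<in> ?N" if "j \<in> J" for j
  proof -
    show "j \<in> ?N" using null_words.rel_ins[of "[]" "[]" X "R \<union> J" j] that null_words.nil by auto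
    have jw: "j \<in> words X" using that J by auto
    have "word_inv j @ j \<in> ?N"
      using null_words_free_rel[OF word_inv_left[OF jw], of "[]" "[]" "R \<union> J"] null_words.nil by auto
    then show "word_inv j \<in> ?N" using null_words.rel_del[of "word_inv j" j "[]" X "R \<union> J"] that by auto
  qed
  have sub: "word_val G f ` J \<subseteq> carrier G" using J word_val_closed[OF f] by auto
  have ncl: "normal_closure G (word_val G f ` J) \<subseteq> carrier G"
    using normal_closure_normal[OF sub] by (meson normal_imp_subgroup subgroup.subset)
  have "\<forall>w\<in>words X. word_val G f w = A \<longrightarrow> w \<in> ?N" if "A \<in> normal_closure G (word_val G f ` J)" for A
    using that unfolding normal_closure_def
  proof (induction rule: generate.induct)
    case one
    then show ?case using ker null_words_mono[of _ X R "R \<union> J"] by auto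
  next
    case (incl h)
    then obtain g j where gj: "g \<in> carrier G" "j \<in> J" "h = g \<otimes> word_val G f j \<otimes> inv g" by auto
    obtain u where u: "u \<in> words X" "word_val G f u = g" using sur gj by blast
    have jw: "j \<in> words X" using gj J by auto
    have e: "word_val G f (u @ j @ word_inv u) = h"
      using u jw gj by (simp add: word_val_append[OF f] word_val_word_inv[OF f] word_inv_in_words word_val_closed[OF f] m_assoc)
    show ?case using same[of _ "u @ j @ word_inv u"] cj[OF u(1) Jin(1)[OF gj(2)]] e u jw
      by (auto simp: word_inv_in_words)
  next
    case (inv h)
    then obtain g j where gj: "g \<in> carrier G" "j \<in> J" "h = g \<otimes> word_val G f j \<otimes> inv g" by auto
    obtain u where u: "u \<in> words X" "word_val G f u = g" using sur gj by blast
    have jw: "j \<in> words X" using gj J by auto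
    have jc: "word_val G f j \<in> carrier G" using jw word_val_closed[OF f] by auto
    have e: "word_val G f (u @ word_inv j @ word_inv u) = inv h"
      using u jw gj jc by (simp add: word_val_append[OF f] word_val_word_inv[OF f] word_inv_in_words
          word_val_closed[OF f] m_assoc inv_mult_group)
    show ?case using same[of _ "u @ word_inv j @ word_inv u"] cj[OF u(1) Jin(2)[OF gj(2)]] e u jw
      by (auto simp: word_inv_in_words)
  next
    case (eng h1 h2)
    have h: "h1 \<in> carrier G" "h2 \<in> carrier G"
      using eng(1,2) ncl unfolding normal_closure_def by auto
    obtain u v where uv: "u \<in> words X" "word_val G f u = h1" "v \<in> words X" "word_val G f v = h2"
      using sur h by metis
    have "u @ v \<in> ?N" using eng uv null_words_context[of u X "R \<union> J" "[]" v] by auto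
    moreover have "word_val G f (u @ v) = h1 \<otimes> h2" using uv by (simp add: word_val_append[OF f])
    ultimately show ?case using same[of _ "u @ v", THEN iffD2] uv(1,3) by (intro ballI impI) simp
  qed
  with n w show ?thesis by blast
qed

lemma normal_closure_least:
  assumes "K \<lhd> G" "R \<subseteq> K"
  shows "normal_closure G R \<subseteq> K"
  unfolding normal_closure_def
proof (rule generate_subgroup_incl)
  show "subgroup K G" using assms normal_imp_subgroup by blast
  show "{g \<otimes> r \<otimes> inv g |g r. g \<in> carrier G \<and> r \<in> R} \<subseteq> K"
    using assms(2) normal.inv_op_closed2[OF assms(1)] by (auto simp: subset_iff)
qed

lemma normal_closure_incl: "R \<subseteq> carrier G \<Longrightarrow> R \<subseteq> normal_closure G R"
proof
  fix r assume R: "R \<subseteq> carrier G" and r: "r \<in> R"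
  then have "r = \<one> \<otimes> r \<otimes> inv \<one>" by auto
  with r show "r \<in> normal_closure G R"
    unfolding normal_closure_def by (intro generate.incl) blast
qed

text \<open>Inserting or deleting a relator changes the value by a factor conjugate to the value of
  that relator or its inverse. This is meant for free groups, where relators may have nontrivial
  values.\<close>

lemma word_val_in_normal_closure:
  assumes f: "f \<in> X \<rightarrow> carrier G" and R: "R \<subseteq> words X" and "w \<in> null_words X R"
  shows "word_val G f w \<in> normal_closure G (word_val G f ` R)"
proof -
  have sub: "word_val G f ` R \<subseteq> carrier G" using R word_val_closed[OF f] by auto
  interpret N: normal "normal_closure G (word_val G f ` R)" G by (rule normal_closure_normal[OF sub])
  let ?N = "normal_closure G (word_val G f ` R)"
  have key: "a \<otimes> (b \<otimes> c) \<in> ?N \<longleftrightarrow> a \<otimes> c \<in> ?N"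
    if "a \<in> carrier G" "c \<in> carrier G" "b \<in> word_val G f ` R" for a b c
  proof -
    have b: "b \<in> carrier G" "b \<in> ?N" using that sub normal_closure_incl[OF sub] by auto
    have "a \<otimes> (b \<otimes> c) = (a \<otimes> b \<otimes> inv a) \<otimes> (a \<otimes> c)" using that b by (simp add: m_assoc)
    moreover have m: "a \<otimes> b \<otimes> inv a \<in> ?N" using N.inv_op_closed2[of a b] that b by auto
    moreover have "a \<otimes> c = inv (a \<otimes> b \<otimes> inv a) \<otimes> (a \<otimes> (b \<otimes> c))"
      using that b by (simp add: m_assoc inv_mult_group)
    ultimately show ?thesis using N.m_closed N.m_inv_closed by metis
  qed
  show ?thesis using assms(3)
  proof (induction rule: null_words.induct)
    case nil then show ?case by simp
  next
    case (cancel_ins u v x b)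
    have w: "u \<in> words X" "v \<in> words X" using null_words_in_words[OF cancel_ins(1) R] by auto
    show ?case using word_val_free_rel[OF free_rel.cancel[OF w cancel_ins(2)] f] cancel_ins by simp
  next
    case (cancel_del u x b v)
    have w: "u \<in> words X" "v \<in> words X" using null_words_in_words[OF cancel_del(1) R] by auto
    show ?case using word_val_free_rel[OF free_rel.cancel[OF w cancel_del(2)] f, of b] cancel_del by simp
  next
    case (rel_ins u v r)
    have w: "u \<in> words X" "v \<in> words X" "r \<in> words X"
      using null_words_in_words[OF rel_ins(1) R] rel_ins(2) R by auto
    show ?case using w word_val_append[OF f] word_val_closed[OF f] rel_ins key by simp
  next
    case (rel_del u r v)
    have w: "u \<in> words X" "v \<in> words X" "r \<in> words X"
      using null_words_in_words[OF rel_del(1) R] by auto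
    show ?case using w word_val_append[OF f] word_val_closed[OF f] rel_del key by simp
  qed
qed

end

lemma word_val_hom:
  assumes "group G" "group H" "h \<in> hom G H" "f \<in> X \<rightarrow> carrier G" "w \<in> words X"
  shows "h (word_val G f w) = word_val H (h \<circ> f) w"
proof -
  interpret group_hom G H h using assms by (simp add: group_hom_def group_hom_axioms_def)
  show ?thesis using assms(5)
  proof (induction w)
    case (Cons a w)
    have "f (fst a) \<in> carrier G" "word_val G f w \<in> carrier G"
      using Cons.prems assms(4) G.word_val_closed[OF assms(4)] by (auto simp: Cons_in_words)
    with Cons show ?case by (simp add: Cons_in_words)
  qed simp
qed

lemma word_val_cong: "\<lbrakk>\<And>x. x \<in> X \<Longrightarrow> f x = g x; w \<in> words X\<rbrakk> \<Longrightarrow> word_val G f w = word_val G g w"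
  by (induction w) (auto simp: Cons_in_words)

section \<open>Quotients, free groups and the universal property of a presentation\<close>

lemma presentation_quotient:
  assumes G: "group G" and H: "group H" and p: "presentation G X f R"
    and h: "h \<in> hom G H" and sur: "h ` carrier G = carrier H" and J: "J \<subseteq> words X"
    and ker: "kernel G H h = normal_closure G (word_val G f ` J)"
  shows "presentation H X (h \<circ> f) (R \<union> J)"
proof -
  interpret group_hom G H h using assms by (simp add: group_hom_def group_hom_axioms_def)
  note f = presentationD(1)[OF p] and R = presentationD(2)[OF p]
    and surG = presentationD(4)[OF p]
  have e: "word_val H (h \<circ> f) w = h (word_val G f w)" if "w \<in> words X" for w
    using word_val_hom[OF G H h f that] by simp
  have sub: "word_val G f ` J \<subseteq> carrier G" using J G.word_val_closed[OF f] by auto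
  have relH: "word_val H (h \<circ> f) r = \<one>\<^bsub>H\<^esub>" if "r \<in> R \<union> J" for r
  proof (cases "r \<in> R")
    case True then show ?thesis using e[of r] R presentationD(3)[OF p True] by auto
  next
    case False
    then have r: "r \<in> J" "r \<in> words X" using that J by auto
    have "word_val G f r \<in> kernel G H h" unfolding ker using r G.normal_closure_incl[OF sub] by auto
    then show ?thesis using e r by (simp add: kernel_def)
  qed
  have surH: "\<exists>w\<in>words X. word_val H (h \<circ> f) w = g" if g: "g \<in> carrier H" for g
  proof -
    obtain k where k: "k \<in> carrier G" "g = h k" using g unfolding sur[symmetric] by (rule imageE)
    obtain w where "w \<in> words X" "word_val G f w = k" using surG k(1) by metis
    then show ?thesis using e[of w] k(2) by (intro bexI[of _ w]) simp_all
  qed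
  have kerH: "w \<in> null_words X (R \<union> J)" if "w \<in> words X" "word_val H (h \<circ> f) w = \<one>\<^bsub>H\<^esub>" for w
  proof (rule G.null_words_normal_closure[OF p J that(1)])
    show "word_val G f w \<in> normal_closure G (word_val G f ` J)"
      unfolding ker[symmetric] using that e G.word_val_closed[OF f] by (simp add: kernel_def)
  qed
  have fH: "h \<circ> f \<in> X \<rightarrow> carrier H" using f by (auto simp: Pi_iff)
  show ?thesis unfolding presentation_def
    by (intro conjI ballI impI fH surH Un_least R J; (rule relH kerH)?; assumption)
qed

lemma presentation_free_group:
  "presentation (free_group X) X (\<lambda>x. free_rel X `` {[(x, True)]}) {}"
proof -
  interpret group "free_group X" by (rule group_free_group)
  let ?f = "\<lambda>x. free_rel X `` {[(x, True)]}"
  have f: "?f \<in> X \<rightarrow> carrier (free_group X)"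
    by (auto simp: free_group_def intro!: quotientI)
  have inv: "inv\<^bsub>free_group X\<^esub> (?f x) = free_rel X `` {[(x, False)]}" if "x \<in> X" for x
  proof (rule inv_equality)
    have "([(x, False), (x, True)], []) \<in> free_rel X"
      using free_rel.cancel[of "[]" X "[]" x False] that by simp
    then show "free_rel X `` {[(x, False)]} \<otimes>\<^bsub>free_group X\<^esub> ?f x = \<one>\<^bsub>free_group X\<^esub>"
      using free_group_mult[of "[(x, False)]" X "[(x, True)]"] that equiv_class_eq[OF equiv_free_rel]
      by (simp add: free_group_def)
  qed (use that f in \<open>auto simp: free_group_def intro!: quotientI\<close>)
  have e: "word_val (free_group X) ?f w = free_rel X `` {w}" if "w \<in> words X" for w
    using that
  proof (induction w)
    case Nil then show ?case by (simp add: free_group_def)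
  next
    case (Cons a w)
    obtain x b where a: "a = (x, b)" by fastforce
    have "word_val (free_group X) ?f (a # w) = free_rel X `` {[(x, b)]} \<otimes>\<^bsub>free_group X\<^esub> free_rel X `` {w}"
      using Cons inv a by auto
    also have "\<dots> = free_rel X `` {[(x, b)] @ w}"
      by (rule free_group_mult) (use Cons a in auto)
    finally show ?case by (simp add: a)
  qed
  have "w \<in> null_words X {}" if "w \<in> words X" "word_val (free_group X) ?f w = \<one>\<^bsub>free_group X\<^esub>" for w
  proof -
    have "free_rel X `` {w} = free_rel X `` {[]}" using e that by (simp add: free_group_def)
    then have "(w, []) \<in> free_rel X" using eq_equiv_class[OF _ equiv_free_rel] by force
    from null_words_free_rel[OF this, of "[]" "[]" "{}"] show ?thesis using null_words.nil by auto
  qed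
  moreover have "\<exists>w\<in>words X. word_val (free_group X) ?f w = g" if "g \<in> carrier (free_group X)" for g
    using that e by (auto simp: free_group_def elim!: quotientE)
  ultimately show ?thesis using f by (simp add: presentation_def)
qed

text \<open>Von Dyck's theorem. A word is chosen for every element of \<open>G\<close>; the choice
  does not matter, since two words for one element differ by a null word, whose value in
  \<open>K\<close> is trivial.\<close>

lemma presentation_hom_ext:
  assumes G: "group G" and K: "group K" and p: "presentation G X f R"
    and k: "k \<in> X \<rightarrow> carrier K" and rel: "\<And>r. r \<in> R \<Longrightarrow> word_val K k r = \<one>\<^bsub>K\<^esub>"
  obtains h where "h \<in> hom G K" "\<And>w. w \<in> words X \<Longrightarrow> h (word_val G f w) = word_val K k w"
    "\<And>x. x \<in> X \<Longrightarrow> h (f x) = k x"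
proof -
  interpret G: group G by fact
  interpret K: group K by fact
  note f = presentationD(1)[OF p] and R = presentationD(2)[OF p] and sur = presentationD(4)[OF p]
  define wd where "wd g = (SOME w. w \<in> words X \<and> word_val G f w = g)" for g
  have wd: "wd g \<in> words X" "word_val G f (wd g) = g" if "g \<in> carrier G" for g
    unfolding wd_def using sur[OF that] someI_ex[of "\<lambda>w. w \<in> words X \<and> word_val G f w = g"] by blast+
  have same: "word_val K k u = word_val K k v" if "u \<in> words X" "v \<in> words X" "word_val G f u = word_val G f v" for u v
  proof -
    have c: "word_val K k u \<in> carrier K" "word_val K k v \<in> carrier K" using that K.word_val_closed[OF k] by auto
    have "word_val G f (u @ word_inv v) = \<one>\<^bsub>G\<^esub>"
      using that by (simp add: G.word_val_append[OF f] G.word_val_word_inv[OF f] word_inv_in_words G.word_val_closed[OF f])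
    then have "u @ word_inv v \<in> null_words X R"
      using presentationD(5)[OF p] that by (simp add: word_inv_in_words)
    from K.word_val_null_words[OF this R k rel]
    have "word_val K k u \<otimes>\<^bsub>K\<^esub> inv\<^bsub>K\<^esub> word_val K k v = \<one>\<^bsub>K\<^esub>"
      using that by (simp add: K.word_val_append[OF k] K.word_val_word_inv[OF k] word_inv_in_words)
    then show ?thesis using c K.inv_equality[of "word_val K k u" "inv\<^bsub>K\<^esub> word_val K k v"] by simp
  qed
  define h where "h g = word_val K k (wd g)" for g
  have hw: "h (word_val G f w) = word_val K k w" if "w \<in> words X" for w
    unfolding h_def using that wd[of "word_val G f w"] G.word_val_closed[OF f] by (intro same) auto
  show ?thesis
  proof (rule that[of h])
    show "h \<in> hom G K"
    proof (rule homI)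
      fix x assume "x \<in> carrier G"
      then show "h x \<in> carrier K" unfolding h_def using wd K.word_val_closed[OF k] by auto
      fix y assume "y \<in> carrier G"
      then show "h (x \<otimes>\<^bsub>G\<^esub> y) = h x \<otimes>\<^bsub>K\<^esub> h y"
        using hw[of "wd x @ wd y"] wd[OF \<open>x \<in> carrier G\<close>] wd[of y]
        by (simp add: G.word_val_append[OF f] K.word_val_append[OF k] h_def)
    qed
    show "h (word_val G f w) = word_val K k w" if "w \<in> words X" for w using hw that .
    show "h (f x) = k x" if "x \<in> X" for x
      using hw[of "[(x, True)]"] that f k by (simp add: Pi_iff)
  qed
qed

lemma (in group) word_val_in_generate:
  assumes f: "f \<in> Y \<rightarrow> carrier G" and w: "w \<in> words Y"
  shows "word_val G f w \<in> generate G (f ` Y)"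
  using w
proof (induction w)
  case (Cons a w)
  then have a: "f (fst a) \<in> f ` Y" and w: "word_val G f w \<in> generate G (f ` Y)"
    by (simp_all add: Cons_in_words)
  show ?case using generate.eng[OF generate.incl[OF a] w] generate.eng[OF generate.inv[OF a] w] by simp
qed (simp add: generate.one)

lemma (in group) presentation_generators:
  assumes p: "presentation G X f R"
  shows "generate G (f ` X) = carrier G"
proof
  note f = presentationD(1)[OF p]
  then show "generate G (f ` X) \<subseteq> carrier G" by (intro generate_incl) auto
  show "carrier G \<subseteq> generate G (f ` X)"
    using presentationD(4)[OF p] word_val_in_generate[OF f] by blast
qed

lemma (in group) normal_closure_empty: "normal_closure G {} = {\<one>}"
  by (simp add: normal_closure_def generate_empty)

text \<open>An isomorphism is a quotient map whose kernel is the normal closure of the empty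
  set.\<close>

lemma presentation_iso:
  assumes G: "group G" and H: "group H" and p: "presentation G X f R" and h: "h \<in> iso G H"
  shows "presentation H X (h \<circ> f) R"
proof -
  have hom: "h \<in> hom G H" and bij: "bij_betw h (carrier G) (carrier H)" using h by (auto simp: iso_def)
  interpret group_hom G H h using G H hom by (simp add: group_hom_def group_hom_axioms_def)
  have "kernel G H h = normal_closure G (word_val G f ` {})"
    using bij inj_onD[of h "carrier G" _ "\<one>\<^bsub>G\<^esub>"]
    by (auto simp: G.normal_closure_empty kernel_def bij_betw_def)
  from presentation_quotient[OF G H p hom _ _ this] bij show ?thesis
    by (simp add: bij_betw_def)
qed

lemma normal_Mod_hom:
  assumes "N \<lhd> G"
  shows "group (G Mod N)" "(\<lambda>g. N #>\<^bsub>G\<^esub> g) \<in> hom G (G Mod N)"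
    "(\<lambda>g. N #>\<^bsub>G\<^esub> g) ` carrier G = carrier (G Mod N)"
    "kernel G (G Mod N) (\<lambda>g. N #>\<^bsub>G\<^esub> g) = N"
proof -
  interpret normal N G by fact
  show "group (G Mod N)" by (rule factorgroup_is_group)
  show "(\<lambda>g. N #>\<^bsub>G\<^esub> g) \<in> hom G (G Mod N)" by (rule r_coset_hom_Mod)
  show "(\<lambda>g. N #>\<^bsub>G\<^esub> g) ` carrier G = carrier (G Mod N)"
    by (auto simp: FactGroup_def RCOSETS_def)
  show "kernel G (G Mod N) (\<lambda>g. N #>\<^bsub>G\<^esub> g) = N"
    using subset rcos_const[OF is_group] rcos_self[OF _ is_subgroup] by (auto simp: kernel_def FactGroup_def)
qed

lemma presentation_presented_group:
  assumes R: "R \<subseteq> words X"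
  defines "F \<equiv> free_group X" and "g \<equiv> \<lambda>x. free_rel X `` {[(x, True)]}"
  shows "\<exists>f. presentation (presented_group X (word_val F g ` R)) X f R"
    and "group (presented_group X (word_val F g ` R))"
proof -
  interpret F: group F unfolding F_def by (rule group_free_group)
  have p: "presentation F X g {}" unfolding F_def g_def by (rule presentation_free_group)
  then have g: "g \<in> X \<rightarrow> carrier F" by (rule presentationD)
  have "word_val F g ` R \<subseteq> carrier F" using R F.word_val_closed[OF g] by auto
  then have n: "normal_closure F (word_val F g ` R) \<lhd> F" by (rule F.normal_closure_normal)
  note q = normal_Mod_hom[OF n]
  show "group (presented_group X (word_val F g ` R))"
    using q(1) by (simp add: presented_group_def F_def)
  show "\<exists>f. presentation (presented_group X (word_val F g ` R)) X f R"
    using presentation_quotient[OF F.group_axioms q(1) p q(2,3) R q(4)]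
    by (auto simp: presented_group_def F_def)
qed

text \<open>Relators come as classes in the free group; representing words are chosen for the
  finitely many of them.\<close>

lemma finitely_presented_presentation:
  assumes "finitely_presented G"
  shows "\<exists>(X :: nat set) f R. finite X \<and> finite R \<and> presentation G X f R"
proof -
  obtain X :: "nat set" and R where X: "finite X" "finite R" "R \<subseteq> carrier (free_group X)"
    and i: "G \<cong> presented_group X R" and G: "group G"
    using assms by (auto simp: finitely_presented_def)
  interpret G: group G by fact
  let ?F = "free_group X" and ?g = "\<lambda>x. free_rel X `` {[(x, True)]}"
  have "R \<subseteq> word_val ?F ?g ` words X" using X(3) presentationD(4)[OF presentation_free_group[of X]] by blast
  then obtain S where S: "S \<subseteq> words X" "finite S" "R = word_val ?F ?g ` S"
    using X(2) by (meson finite_subset_image)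
  obtain f where p: "presentation (presented_group X R) X f S"
    using presentation_presented_group(1)[OF S(1)] S(3) by auto
  have "group (presented_group X R)"
    using presentation_presented_group(2)[OF S(1)] S(3) by auto
  moreover obtain h where "h \<in> iso (presented_group X R) G"
    using G.iso_sym[OF i] by (auto simp: is_iso_def)
  ultimately show ?thesis using presentation_iso[OF _ G p] X S by blast
qed

section \<open>Change of letters and finite presentability\<close>

lemma null_words_map:
  "w \<in> null_words X R \<Longrightarrow> map (apfst e) w \<in> null_words (e ` X) (map (apfst e) ` R)"
proof (induction rule: null_words.induct)
  case (cancel_del u x b v)
  then show ?case using null_words.cancel_del[of "map (apfst e) u" "e x" b "map (apfst e) v"] by simp
next
  case (rel_del u r v)
  then show ?case using null_words.rel_del[of "map (apfst e) u" "map (apfst e) r" "map (apfst e) v"] by simp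
next
  case (cancel_ins u v x b)
  then show ?case using null_words.cancel_ins[of "map (apfst e) u" "map (apfst e) v"] by simp
next
  case (rel_ins u v r)
  then show ?case using null_words.rel_ins[of "map (apfst e) u" "map (apfst e) v"] by simp
qed (simp add: null_words.nil)

lemma map_in_words: "w \<in> words X \<Longrightarrow> map (apfst e) w \<in> words (e ` X)"
  by (induction w) (auto simp: Cons_in_words)

lemma word_val_map_apfst: "word_val K f (map (apfst g) w) = word_val K (f \<circ> g) w"
  by (induction w) auto

lemma words_mono: "X \<subseteq> Z \<Longrightarrow> words X \<subseteq> words Z"
  unfolding words_def by (intro lists_mono) auto

lemma presentation_rename:
  assumes p: "presentation G X f R" and e: "inj_on e X"
  shows "presentation G (e ` X) (f \<circ> the_inv_into X e) (map (apfst e) ` R)"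
proof -
  let ?f = "f \<circ> the_inv_into X e"
  have word_val: "word_val G ?f (map (apfst e) w) = word_val G f w" if "w \<in> words X" for w
    using that e by (induction w) (auto simp: Cons_in_words the_inv_into_f_f)
  have words: "\<exists>w\<in>words X. w' = map (apfst e) w" if "w' \<in> words (e ` X)" for w'
    using that
  proof (induction w')
    case (Cons a w')
    then obtain w where "w \<in> words X" "w' = map (apfst e) w" by (auto simp: Cons_in_words)
    moreover obtain x where "x \<in> X" "fst a = e x" using Cons.prems by (auto simp: Cons_in_words)
    ultimately show ?case by (intro bexI[of _ "(x, snd a) # w"]) (auto simp: prod_eq_iff)
  qed (auto intro: bexI[of _ "[]"])
  have "w' \<in> null_words (e ` X) (map (apfst e) ` R)"
    if w': "w' \<in> words (e ` X)" "word_val G ?f w' = \<one>\<^bsub>G\<^esub>" for w'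
  proof -
    obtain w where "w \<in> words X" "w' = map (apfst e) w" using words w'(1) by blast
    then show ?thesis using w' word_val null_words_map[OF presentationD(5)[OF p]] by simp
  qed
  moreover have "\<exists>w\<in>words (e ` X). word_val G ?f w = g" if "g \<in> carrier G" for g
    using presentationD(4)[OF p that] word_val map_in_words[of _ X e] by metis
  moreover have "?f \<in> e ` X \<rightarrow> carrier G"
    using e presentationD(1)[OF p] by (auto simp: the_inv_into_f_f Pi_iff)
  moreover have "map (apfst e) ` R \<subseteq> words (e ` X)"
    using presentationD(2)[OF p] map_in_words[of _ X e] by blast
  moreover have "word_val G ?f r = \<one>\<^bsub>G\<^esub>" if "r \<in> map (apfst e) ` R" for r
    using that presentationD(2,3)[OF p] word_val by (auto simp: subset_iff)
  ultimately show ?thesis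
    unfolding presentation_def by metis
qed

text \<open>The letters are renamed to natural numbers, as \<open>finitely_presented\<close>
  demands. The free group on them maps onto \<open>G\<close>; a word for an element of the kernel is
  null, so that element lies in the normal closure of the relators.\<close>

lemma presentation_finitely_presented:
  fixes X :: "'x set"
  assumes G: "group G" and fin: "finite X" "finite R" and p: "presentation G X f R"
  shows "finitely_presented G"
proof -
  interpret G: group G by fact
  obtain e :: "'x \<Rightarrow> nat" where e: "inj_on e X"
    using fin(1) finite_imp_inj_to_nat_seg by blast
  define Y where "Y = e ` X"
  define k where "k = f \<circ> the_inv_into X e"
  define S where "S = map (apfst e) ` R"
  have q: "presentation G Y k S" unfolding Y_def k_def S_def by (rule presentation_rename[OF p e])
  have finY: "finite Y" "finite S" using fin by (auto simp: Y_def S_def)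
  note k = presentationD(1)[OF q] and S = presentationD(2,3)[OF q] and sur = presentationD(4)[OF q]
  let ?F = "free_group Y" and ?g = "\<lambda>x. free_rel Y `` {[(x, True)]}"
  interpret F: group ?F by (rule group_free_group)
  note fp = presentation_free_group[of Y]
  note g = presentationD(1)[OF fp]
  obtain h where h: "h \<in> hom ?F G" and hw: "\<And>w. w \<in> words Y \<Longrightarrow> h (word_val ?F ?g w) = word_val G k w"
    using presentation_hom_ext[OF F.group_axioms G fp k] by blast
  interpret h: group_hom ?F G h using h by (simp add: group_hom_def group_hom_axioms_def)
  have "h ` carrier ?F = carrier G"
  proof
    show "carrier G \<subseteq> h ` carrier ?F"
    proof
      fix x assume "x \<in> carrier G"
      then obtain w where w: "w \<in> words Y" "word_val G k w = x" using sur by blast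
      then have "x = h (word_val ?F ?g w)" using hw by simp
      then show "x \<in> h ` carrier ?F" by (rule image_eqI[OF _ F.word_val_closed[OF g w(1)]])
    qed
  qed (use h.hom_closed in blast)
  then have "?F Mod kernel ?F G h \<cong> G" by (rule h.FactGroup_iso)
  moreover have "kernel ?F G h = normal_closure ?F (word_val ?F ?g ` S)"
  proof
    have "word_val ?F ?g ` S \<subseteq> kernel ?F G h"
      using S hw F.word_val_closed[OF g] by (auto simp: kernel_def)
    then show "normal_closure ?F (word_val ?F ?g ` S) \<subseteq> kernel ?F G h"
      by (rule F.normal_closure_least[OF h.normal_kernel])
    show "kernel ?F G h \<subseteq> normal_closure ?F (word_val ?F ?g ` S)"
    proof
      fix A assume A: "A \<in> kernel ?F G h"
      then obtain w where w: "w \<in> words Y" "A = word_val ?F ?g w"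
        using presentationD(4)[OF fp] by (auto simp: kernel_def)
      with A have "w \<in> null_words Y S"
        using hw by (intro presentationD(5)[OF q]) (auto simp: kernel_def)
      then show "A \<in> normal_closure ?F (word_val ?F ?g ` S)"
        unfolding w(2) by (rule F.word_val_in_normal_closure[OF g S(1)])
    qed
  qed
  ultimately have "presented_group Y (word_val ?F ?g ` S) \<cong> G" by (simp add: presented_group_def)
  moreover have "group (presented_group Y (word_val ?F ?g ` S))"
    by (rule presentation_presented_group(2)[OF S(1)])
  ultimately have "G \<cong> presented_group Y (word_val ?F ?g ` S)" by (rule group.iso_sym[rotated])
  moreover have "word_val ?F ?g ` S \<subseteq> carrier ?F" using S F.word_val_closed[OF g] by auto
  ultimately show ?thesis using G finY unfolding finitely_presented_def by blast
qed

section \<open>Kernels of maps onto finitely presented groups\<close>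

lemma hom_eq_on_generate:
  assumes "group_hom G H h" "group_hom G H k" "S \<subseteq> carrier G" "\<And>s. s \<in> S \<Longrightarrow> h s = k s"
    "x \<in> generate G S"
  shows "h x = k x"
proof -
  interpret h: group_hom G H h by fact
  interpret k: group_hom G H k by fact
  have sub: "generate G S \<subseteq> carrier G" by (rule h.G.generate_incl[OF assms(3)])
  show ?thesis using assms(5)
  proof (induction rule: generate.induct)
    case (inv x) then show ?case using assms(3,4) by auto
  next
    case (eng x y)
    then have "x \<in> carrier G" "y \<in> carrier G" using sub by auto
    with eng show ?case by simp
  qed (use assms in auto)
qed

text \<open>\<open>L\<close> consists of the relators of \<open>H\<close> evaluated at lifts of its
  generators, and of each generator of \<open>E\<close> divided by a lifted word for its image.
  Modulo \<open>L\<close> there is a map back from \<open>H\<close>, and its composite with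
  \<open>h\<close> agrees with the quotient map on generators.\<close>

lemma kernel_finitely_normally_generated:
  assumes hom: "group_hom E H h" and sur: "h ` carrier E = carrier H"
    and S: "finite S" "S \<subseteq> carrier E" "generate E S = carrier E" and fp: "finitely_presented H"
  shows "\<exists>L. finite L \<and> L \<subseteq> kernel E H h \<and> kernel E H h = normal_closure E L"
proof -
  interpret group_hom E H h by fact
  obtain X :: "nat set" and f R where X: "finite X" "finite R" and p: "presentation H X f R"
    using finitely_presented_presentation[OF fp] by blast
  note f = presentationD(1)[OF p] and R = presentationD(2,3)[OF p] and surH = presentationD(4)[OF p]
  have "\<forall>x\<in>X. \<exists>e. e \<in> carrier E \<and> h e = f x"
    using f sur by (metis Pi_iff imageE)
  then obtain k where k: "\<forall>x\<in>X. k x \<in> carrier E \<and> h (k x) = f x" by metis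
  then have kE: "k \<in> X \<rightarrow> carrier E" by auto
  have hk: "h (word_val E k w) = word_val H f w" if "w \<in> words X" for w
    using word_val_hom[OF G.group_axioms H.group_axioms homh kE that] word_val_cong[OF _ that, of "h \<circ> k" f H] k
    by auto
  have "\<forall>s\<in>S. \<exists>w\<in>words X. word_val H f w = h s" using surH S(2) hom_closed by blast
  then obtain wd where wd: "\<forall>s\<in>S. wd s \<in> words X \<and> word_val H f (wd s) = h s" by metis
  define L where "L = word_val E k ` R \<union> (\<lambda>s. s \<otimes>\<^bsub>E\<^esub> inv\<^bsub>E\<^esub> word_val E k (wd s)) ` S"
  have ker: "kernel E H h \<lhd> E" by (rule normal_kernel)
  have L: "L \<subseteq> kernel E H h" "finite L"
    using X(2) S R hk wd G.word_val_closed[OF kE] by (auto simp: L_def kernel_def subset_iff)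
  have LE: "L \<subseteq> carrier E" using L by (auto simp: kernel_def)
  have n: "normal_closure E L \<lhd> E" by (rule G.normal_closure_normal[OF LE])
  interpret N: normal "normal_closure E L" E by (rule n)
  let ?q = "\<lambda>g. normal_closure E L #>\<^bsub>E\<^esub> g"
  note q = normal_Mod_hom[OF n]
  interpret Q: group "E Mod normal_closure E L" by (rule q(1))
  interpret q: group_hom E "E Mod normal_closure E L" ?q
    by (simp add: group_hom_def group_hom_axioms_def q G.group_axioms)
  have q1: "?q a = \<one>\<^bsub>E Mod normal_closure E L\<^esub>" if "a \<in> L" for a
    using that G.normal_closure_incl[OF LE] q(4) by (auto simp: kernel_def)
  have qe: "?q (word_val E k w) = word_val (E Mod normal_closure E L) (?q \<circ> k) w" if "w \<in> words X" for w
    by (rule word_val_hom[OF G.group_axioms q(1,2) kE that])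
  have cl: "?q \<circ> k \<in> X \<rightarrow> carrier (E Mod normal_closure E L)"
    using kE q.hom_closed by (simp add: Pi_iff)
  have rel: "word_val (E Mod normal_closure E L) (?q \<circ> k) r = \<one>\<^bsub>E Mod normal_closure E L\<^esub>" if "r \<in> R" for r
    using qe[of r] q1[of "word_val E k r"] that R by (auto simp: L_def)
  obtain \<phi> where \<phi>: "\<phi> \<in> hom H (E Mod normal_closure E L)"
    "\<And>w. w \<in> words X \<Longrightarrow> \<phi> (word_val H f w) = word_val (E Mod normal_closure E L) (?q \<circ> k) w"
    by (rule presentation_hom_ext[OF H.group_axioms q(1) p cl rel]) (assumption | rule that)+
  interpret \<phi>: group_hom H "E Mod normal_closure E L" \<phi>
    by (simp add: group_hom_def group_hom_axioms_def q \<phi> H.group_axioms)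
  interpret \<phi>h: group_hom E "E Mod normal_closure E L" "\<phi> \<circ> h"
    using Group.hom_compose[OF homh \<phi>(1)] by (simp add: group_hom_def group_hom_axioms_def q G.group_axioms)
  have gens: "(\<phi> \<circ> h) s = ?q s" if s: "s \<in> S" for s
  proof -
    have w: "wd s \<in> words X" "h s = word_val H f (wd s)" using wd s by auto
    have c: "s \<in> carrier E" "word_val E k (wd s) \<in> carrier E" using s S w G.word_val_closed[OF kE] by auto
    have "s \<otimes>\<^bsub>E\<^esub> inv\<^bsub>E\<^esub> word_val E k (wd s) \<in> L" using s by (auto simp: L_def)
    from q1[OF this] have "?q s \<otimes>\<^bsub>E Mod normal_closure E L\<^esub> inv\<^bsub>E Mod normal_closure E L\<^esub> ?q (word_val E k (wd s))
       = \<one>\<^bsub>E Mod normal_closure E L\<^esub>" using c by (simp only: q.hom_mult q.hom_inv G.inv_closed)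
    then have "?q s = ?q (word_val E k (wd s))"
      using c q.hom_closed Q.inv_equality[of "?q s" "inv\<^bsub>E Mod normal_closure E L\<^esub> ?q (word_val E k (wd s))"]
      by (metis Q.inv_closed Q.inv_inv)
    then show ?thesis using \<phi>(2)[OF w(1)] qe[OF w(1)] w(2) by simp
  qed
  have "kernel E H h \<subseteq> normal_closure E L"
  proof
    fix x assume x: "x \<in> kernel E H h"
    then have xE: "x \<in> carrier E" by (simp add: kernel_def)
    have "(\<phi> \<circ> h) x = ?q x"
      by (rule hom_eq_on_generate[OF \<phi>h.group_hom_axioms q.group_hom_axioms S(2) gens])
        (use xE S in auto)
    then have "x \<in> kernel E (E Mod normal_closure E L) ?q" using x by (simp add: kernel_def)
    then show "x \<in> normal_closure E L" using q(4) by simp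
  qed
  then show ?thesis using L G.normal_closure_least[OF ker L(1)] by blast
qed

section \<open>Cocycles on the Cayley graph\<close>

primrec path_sum :: "('a, 'm) monoid_scheme \<Rightarrow> ('x \<Rightarrow> 'a) \<Rightarrow> ('a \<Rightarrow> 'a \<Rightarrow> int) \<Rightarrow> 'a \<Rightarrow> 'x word \<Rightarrow> int" where
  "path_sum G f c h [] = 0"
| "path_sum G f c h (a # w) = c h (h \<otimes>\<^bsub>G\<^esub> word_val G f [a]) + path_sum G f c (h \<otimes>\<^bsub>G\<^esub> word_val G f [a]) w"

lemma finite_words_length_le: "finite X \<Longrightarrow> finite {w \<in> words X. length w \<le> n}"
proof -
  assume "finite X"
  then have "finite {w. set w \<subseteq> X \<times> (UNIV :: bool set) \<and> length w \<le> n}"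
    by (intro finite_lists_length_le) auto
  moreover have "{w \<in> words X. length w \<le> n} = {w. set w \<subseteq> X \<times> (UNIV :: bool set) \<and> length w \<le> n}"
    by (auto simp: words_def)
  ultimately show ?thesis by simp
qed

lemma (in group) path_sum_append:
  assumes "f \<in> X \<rightarrow> carrier G" "h \<in> carrier G" "u \<in> words X" "v \<in> words X"
  shows "path_sum G f c h (u @ v) = path_sum G f c h u + path_sum G f c (h \<otimes> word_val G f u) v"
  using assms(2-)
proof (induction u arbitrary: h)
  case (Cons a u)
  have c: "word_val G f [a] \<in> carrier G" "word_val G f u \<in> carrier G"
    using Cons.prems word_val_closed[OF assms(1)] by (auto simp: Cons_in_words simp del: word_val.simps)
  have "word_val G f (a # u) = word_val G f [a] \<otimes> word_val G f u"
    using word_val_append[OF assms(1), of "[a]" u] Cons.prems by (simp add: Cons_in_words)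
  then show ?case using Cons c by (simp add: Cons_in_words m_assoc del: word_val.simps)
qed simp

text \<open>With sufficiently long steps, triangles fill every relator loop, so the complex of
  triangles over the Cayley graph behaves as a simply connected one and cocycles are coboundaries.
  \<open>S\<close> is fixed before the cocycle, since the cocycle of \<open>crossing_count\<close>
  is built from \<open>S\<close>.\<close>

lemma (in group) triangle_cocycle_exact:
  assumes fp: "finitely_presented G" and S0: "finite S0" "S0 \<subseteq> carrier G"
  obtains S where "finite S" "S \<subseteq> carrier G" "S0 \<subseteq> S" "\<And>s. s \<in> S \<Longrightarrow> inv s \<in> S"
    "\<And>c :: 'a \<Rightarrow> 'a \<Rightarrow> int.
      (\<And>h s s'. \<lbrakk>h \<in> carrier G; s \<in> S; s' \<in> S; s \<otimes> s' \<in> S\<rbrakk> \<Longrightarrow>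
        c h (h \<otimes> s) + c (h \<otimes> s) (h \<otimes> s \<otimes> s') = c h (h \<otimes> s \<otimes> s')) \<Longrightarrow>
      \<exists>F. \<forall>h\<in>carrier G. \<forall>s\<in>S0. c h (h \<otimes> s) = F (h \<otimes> s) - F h"
proof -
  obtain X :: "nat set" and f R where X: "finite X" "finite R" and p: "presentation G X f R"
    using finitely_presented_presentation[OF fp] by blast
  note f = presentationD(1)[OF p] and R = presentationD(2)[OF p] and rel = presentationD(3)[OF p]
    and sur = presentationD(4)[OF p] and ker = presentationD(5)[OF p]
  define wd where "wd g = (SOME w. w \<in> words X \<and> word_val G f w = g)" for g
  have wd: "wd g \<in> words X" "word_val G f (wd g) = g" if "g \<in> carrier G" for g
    unfolding wd_def using sur[OF that] someI_ex[of "\<lambda>w. w \<in> words X \<and> word_val G f w = g"] by blast+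
  \<comment> \<open>\<open>n\<close> bounds the relators and the chosen words for \<open>S0\<close>;
    the 2 accommodates a cancelling pair of letters.\<close>
  define n where "n = Max (insert 2 (length ` (R \<union> wd ` S0)))"
  have fin: "finite (insert 2 (length ` (R \<union> wd ` S0)))" using X S0 by auto
  have n: "2 \<le> n" "\<And>r. r \<in> R \<Longrightarrow> length r \<le> n" "\<And>s. s \<in> S0 \<Longrightarrow> length (wd s) \<le> n"
    unfolding n_def using fin by (auto intro!: Max_ge)
  define B where "B = {w \<in> words X. length w \<le> n}"
  define S where "S = word_val G f ` B"
  have inS: "word_val G f w \<in> S" if "w \<in> words X" "length w \<le> n" for w
    using that by (auto simp: S_def B_def)
  have SB: "S \<subseteq> carrier G" using word_val_closed[OF f] by (auto simp: S_def B_def)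
  have F: "\<exists>F. \<forall>h\<in>carrier G. \<forall>s\<in>S0. c h (h \<otimes> s) = F (h \<otimes> s) - F h"
    if tri: "\<And>h s s'. \<lbrakk>h \<in> carrier G; s \<in> S; s' \<in> S; s \<otimes> s' \<in> S\<rbrakk> \<Longrightarrow>
        c h (h \<otimes> s) + c (h \<otimes> s) (h \<otimes> s \<otimes> s') = c h (h \<otimes> s \<otimes> s')" for c :: "'a \<Rightarrow> 'a \<Rightarrow> int"
  proof -
    have "\<one> \<in> S" using inS[of "[]"] by simp
    then have refl: "c h h = 0" if "h \<in> carrier G" for h using tri[of h \<one> \<one>] that by simp
    \<comment> \<open>Prefixes of a short word are short, so triangles with apex \<open>h\<close>
      replace the walk by a single jump.\<close>
    have short: "path_sum G f c h w = c h (h \<otimes> word_val G f w)"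
      if "h \<in> carrier G" "w \<in> words X" "length w \<le> n" for h w
      using that(2,3)
    proof (induction w rule: rev_induct)
      case Nil then show ?case using refl that(1) by simp
    next
      case (snoc a w)
      have w: "w \<in> words X" "[a] \<in> words X" "length w \<le> n" using snoc.prems by auto
      have cl: "word_val G f w \<in> carrier G" "word_val G f [a] \<in> carrier G" using w word_val_closed[OF f] by blast+
      have e: "word_val G f (w @ [a]) = word_val G f w \<otimes> word_val G f [a]" using word_val_append[OF f w(1,2)] .
      have "path_sum G f c h (w @ [a]) = path_sum G f c h w + path_sum G f c (h \<otimes> word_val G f w) [a]"
        by (rule path_sum_append[OF f that(1) w(1,2)])
      also have "\<dots> = c h (h \<otimes> word_val G f w) + c (h \<otimes> word_val G f w) (h \<otimes> word_val G f w \<otimes> word_val G f [a])"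
        using snoc.IH w by simp
      also have "\<dots> = c h (h \<otimes> word_val G f w \<otimes> word_val G f [a])"
        using that(1) inS[OF w(1,3)] inS[OF w(2)] inS[of "w @ [a]"] snoc.prems n(1) e
        by (intro tri) auto
      finally show ?case using e cl that(1) by (simp only: m_assoc)
    qed
    have loop: "path_sum G f c h (u @ r @ v) = path_sum G f c h (u @ v)"
      if "h \<in> carrier G" "u \<in> words X" "v \<in> words X" "r \<in> words X" "length r \<le> n" "word_val G f r = \<one>" for h u v r
    proof -
      have c: "h \<otimes> word_val G f u \<in> carrier G" using that word_val_closed[OF f] by simp
      have "path_sum G f c (h \<otimes> word_val G f u) r = 0" using short[OF c that(4,5)] refl c that(6) by simp
      then show ?thesis using that c by (simp add: path_sum_append[OF f])
    qed
    have null: "\<forall>h\<in>carrier G. path_sum G f c h w = 0" if "w \<in> null_words X R" for w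
      using that
    proof (induction rule: null_words.induct)
      case (cancel_ins u v x b)
      have w: "u \<in> words X" "v \<in> words X" using null_words_in_words[OF cancel_ins(1) R] by auto
      have "word_val G f [(x, b), (x, \<not> b)] = \<one>" using cancel_ins(2) f by (auto simp: Pi_iff)
      then show ?case using loop[OF _ w, of _ "[(x, b), (x, \<not> b)]"] cancel_ins n(1) by simp
    next
      case (cancel_del u x b v)
      have w: "u \<in> words X" "v \<in> words X" using null_words_in_words[OF cancel_del(1) R] by auto
      have "word_val G f [(x, b), (x, \<not> b)] = \<one>" using cancel_del(2) f by (auto simp: Pi_iff)
      then show ?case using loop[OF _ w, of _ "[(x, b), (x, \<not> b)]"] cancel_del n(1) by simp
    next
      case (rel_ins u v r)
      have w: "u \<in> words X" "v \<in> words X" using null_words_in_words[OF rel_ins(1) R] by auto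
      show ?case using loop[OF _ w, of _ r] rel_ins n(2) R rel by auto
    next
      case (rel_del u r v)
      have w: "u \<in> words X" "v \<in> words X" using null_words_in_words[OF rel_del(1) R] by auto
      show ?case using loop[OF _ w, of _ r] rel_del n(2) R rel by auto
    qed simp
    define F where "F g = path_sum G f c \<one> (wd g)" for g
    \<comment> \<open>Two words lead from \<open>\<one>\<close> to the same point. Closing both up
      with the same return word gives two null words, so the sums agree.\<close>
    have path: "F (h \<otimes> word_val G f w) = F h + path_sum G f c h w" if h: "h \<in> carrier G" and w: "w \<in> words X" for h w
    proof -
      let ?u = "wd h @ w" and ?v = "wd (h \<otimes> word_val G f w)"
      have c: "word_val G f w \<in> carrier G" using w word_val_closed[OF f] by blast
      have v: "?v \<in> words X" "word_val G f ?v = h \<otimes> word_val G f w" using wd[of "h \<otimes> word_val G f w"] h c by auto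
      have u: "?u \<in> words X" "word_val G f ?u = h \<otimes> word_val G f w"
        using wd[OF h] w by (auto simp: word_val_append[OF f])
      have iv: "word_inv ?v \<in> words X" using v by (simp add: word_inv_in_words)
      have "word_val G f (?u @ word_inv ?v) = \<one>" "word_val G f (?v @ word_inv ?v) = \<one>"
        using u v iv h c by (simp_all only: word_val_append[OF f] word_val_word_inv[OF f] r_inv m_closed)
      then have "path_sum G f c \<one> (?u @ word_inv ?v) = 0" "path_sum G f c \<one> (?v @ word_inv ?v) = 0"
        using ker null u(1) v(1) iv by (simp_all del: append_assoc)
      then have "path_sum G f c \<one> ?u = path_sum G f c \<one> ?v"
        using u v iv by (simp only: path_sum_append[OF f one_closed u(1) iv] path_sum_append[OF f one_closed v(1) iv])
      moreover have "path_sum G f c \<one> ?u = F h + path_sum G f c h w"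
        using path_sum_append[OF f one_closed wd(1)[OF h] w] wd[OF h] h by (simp add: F_def)
      ultimately show ?thesis by (simp add: F_def)
    qed
    have "c h (h \<otimes> s) = F (h \<otimes> s) - F h" if "h \<in> carrier G" "s \<in> S0" for h s
      using path[of h "wd s"] short[of h "wd s"] wd[of s] n(3) that S0 by auto
    then show ?thesis by blast
  qed
  have Sinv: "inv s \<in> S" if s: "s \<in> S" for s
  proof -
    obtain w where w: "w \<in> words X" "length w \<le> n" "s = word_val G f w" using s by (auto simp: S_def B_def)
    then show ?thesis using inS[of "word_inv w"] word_val_word_inv[OF f w(1)] word_inv_in_words[OF w(1)]
      by (simp add: word_inv_def)
  qed
  have S0S: "S0 \<subseteq> S" using wd inS n(3) S0 by (metis subsetI subset_iff)
  have finS: "finite S" unfolding S_def B_def using finite_words_length_le[OF X(1)] by blast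
  show ?thesis by (rule that[OF finS SB S0S Sinv F])
qed

section \<open>Paths over submonoids of an abelian quotient\<close>

text \<open>Paths in the Cayley graph that start at \<open>1\<close>, take steps in \<open>S\<close> and stay over \<open>W\<close>;
  the starting point itself is not required to lie over \<open>W\<close>.\<close>

inductive_set paths :: "('a, 'm) monoid_scheme \<Rightarrow> ('a \<Rightarrow> 'q) \<Rightarrow> 'a set \<Rightarrow> 'q set \<Rightarrow> 'a set"
  for G q S W where
  one: "\<one>\<^bsub>G\<^esub> \<in> paths G q S W"
| step: "\<lbrakk>g \<in> paths G q S W; s \<in> S; q (g \<otimes>\<^bsub>G\<^esub> s) \<in> W\<rbrakk> \<Longrightarrow> g \<otimes>\<^bsub>G\<^esub> s \<in> paths G q S W"

lemma paths_mono: "g \<in> paths G q S W \<Longrightarrow> S \<subseteq> S' \<Longrightarrow> W \<subseteq> W' \<Longrightarrow> g \<in> paths G q S' W'"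
  by (induction rule: paths.induct) (auto intro: paths.intros)

text \<open>A path visits only finitely many points, so it runs over a single member of the
  chain.\<close>

lemma paths_chain:
  assumes "g \<in> paths G q S (\<Union>\<C>)" "\<C> \<noteq> {}" "\<And>A B. A \<in> \<C> \<Longrightarrow> B \<in> \<C> \<Longrightarrow> A \<subseteq> B \<or> B \<subseteq> A"
  shows "\<exists>W\<in>\<C>. g \<in> paths G q S W"
  using assms(1)
proof (induction rule: paths.induct)
  case one
  then show ?case using assms(2) paths.one by fastforce
next
  case (step g s)
  then obtain W V where "W \<in> \<C>" "g \<in> paths G q S W" "V \<in> \<C>" "q (g \<otimes>\<^bsub>G\<^esub> s) \<in> V" by blast
  then show ?case using assms(3)[of W V] step(2) paths_mono[of g G q S W S V]
    by (meson paths.step order_refl subsetD)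
qed

lemma finite_paths_chain:
  assumes "finite C" "C \<subseteq> paths G q S (\<Union>\<C>)" "\<C> \<noteq> {}"
    and "\<And>A B. A \<in> \<C> \<Longrightarrow> B \<in> \<C> \<Longrightarrow> A \<subseteq> B \<or> B \<subseteq> A"
  shows "\<exists>W\<in>\<C>. C \<subseteq> paths G q S W"
  using assms(1,2)
proof (induction rule: finite_induct)
  case empty
  then show ?case using assms(3) by auto
next
  case (insert x C)
  obtain W where W: "W \<in> \<C>" "C \<subseteq> paths G q S W" using insert by auto
  obtain V where V: "V \<in> \<C>" "x \<in> paths G q S V"
    using insert.prems paths_chain[of x G q S \<C>, OF _ assms(3,4)] by (metis insert_subset)
  show ?case
  proof (cases "W \<subseteq> V")
    case True
    then have "C \<subseteq> paths G q S V" using W(2) paths_mono[of _ G q S W S V] by blast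
    with V show ?thesis by blast
  next
    case False
    then have "V \<subseteq> W" using assms(4) W V by blast
    then have "x \<in> paths G q S W" using V(2) paths_mono[of _ G q S V S W] by blast
    with W show ?thesis by blast
  qed
qed

lemma (in group) paths_closed: "g \<in> paths G q S W \<Longrightarrow> S \<subseteq> carrier G \<Longrightarrow> g \<in> carrier G"
  by (induction rule: paths.induct) auto

section \<open>Reaching the kernel of a map onto an abelian group\<close>

locale abelian_image = group_hom G Q q
  for G :: "('a, 'm) monoid_scheme" (structure) and Q :: "('q, 'n) monoid_scheme" and q +
  assumes comm_image: "comm_group Q" and surj: "q ` carrier G = carrier Q"
begin

sublocale Q: comm_group Q by (rule comm_image)

abbreviation N where "N \<equiv> kernel G Q q"

abbreviation Q_mult (infixl "\<cdot>" 70) where "a \<cdot> b \<equiv> a \<otimes>\<^bsub>Q\<^esub> b"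
abbreviation Q_inv ("inv\<^sub>Q _" [81] 80) where "inv\<^sub>Q a \<equiv> inv\<^bsub>Q\<^esub> a"
abbreviation Q_one ("\<one>\<^sub>Q") where "\<one>\<^sub>Q \<equiv> \<one>\<^bsub>Q\<^esub>"

definition submon :: "'q set \<Rightarrow> bool" where
  "submon P \<longleftrightarrow> P \<subseteq> carrier Q \<and> \<one>\<^sub>Q \<in> P \<and> (\<forall>a\<in>P. \<forall>b\<in>P. a \<cdot> b \<in> P)"

text \<open>Connectivity in the spirit of Bieri-Neumann-Strebel, with a submonoid in place of a
  half-space; for the trivial submonoid it yields finite generation of \<open>N\<close>. The set of
  steps is existentially quantified, so it may grow in the course of an argument.\<close>

definition fg_over :: "'q set \<Rightarrow> bool" where
  "fg_over P \<longleftrightarrow> (\<exists>S. finite S \<and> S \<subseteq> carrier G \<and> N \<subseteq> paths G q S P)"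

text \<open>Generation by products and by conjugation with letters, encoded as an induction
  principle. Inversion is not among the operations, because the sets \<open>K\<close> to which it is
  applied are only seen to be closed under products.\<close>

definition conj_gen :: "'a set \<Rightarrow> 'a set \<Rightarrow> bool" where
  "conj_gen T Y \<longleftrightarrow> T \<subseteq> carrier G \<and> (\<forall>t\<in>T. inv t \<in> T) \<and> Y \<subseteq> N \<and>
    (\<forall>K. \<one> \<in> K \<and> Y \<subseteq> K \<and> (\<forall>a\<in>K \<inter> N. \<forall>b\<in>K \<inter> N. a \<otimes> b \<in> K)
      \<and> (\<forall>a\<in>K \<inter> N. \<forall>t\<in>T. inv t \<otimes> a \<otimes> t \<in> K) \<longrightarrow> N \<subseteq> K)"

lemma conj_gen_induct:
  assumes "conj_gen T Y" "\<one> \<in> K" "Y \<subseteq> K"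
    "\<And>a b. a \<in> K \<inter> N \<Longrightarrow> b \<in> K \<inter> N \<Longrightarrow> a \<otimes> b \<in> K"
    "\<And>a t. a \<in> K \<inter> N \<Longrightarrow> t \<in> T \<Longrightarrow> inv t \<otimes> a \<otimes> t \<in> K"
  shows "N \<subseteq> K"
proof -
  have "(\<forall>a\<in>K \<inter> N. \<forall>b\<in>K \<inter> N. a \<otimes> b \<in> K) \<and> (\<forall>a\<in>K \<inter> N. \<forall>t\<in>T. inv t \<otimes> a \<otimes> t \<in> K)"
    using assms(4,5) by simp
  then show ?thesis using assms(1-3) unfolding conj_gen_def by simp
qed

lemma in_N: "n \<in> N \<longleftrightarrow> n \<in> carrier G \<and> q n = \<one>\<^sub>Q"
  by (simp add: kernel_def)

lemma paths_image:
  "g \<in> paths G q S W \<Longrightarrow> \<one>\<^sub>Q \<in> W \<Longrightarrow> q g \<in> W"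
  by (induction rule: paths.induct) auto

text \<open>The path to \<open>h\<close> is translated by \<open>g\<close>, and its projection by
  \<open>q g\<close>.\<close>

lemma paths_append:
  assumes "h \<in> paths G q S V" "g \<in> paths G q S W" "S \<subseteq> carrier G"
    and "\<And>v. v \<in> V \<Longrightarrow> q g \<cdot> v \<in> W"
  shows "g \<otimes> h \<in> paths G q S W"
  using assms(1)
proof (induction rule: paths.induct)
  case one
  then show ?case using assms(2) G.paths_closed[OF assms(2,3)] by simp
next
  case (step h s)
  have c: "g \<in> carrier G" "h \<in> carrier G" "s \<in> carrier G"
    using G.paths_closed assms step by blast+
  then have "q (g \<otimes> h \<otimes> s) \<in> W" using assms(4)[OF step(3)] by (simp add: G.m_assoc)
  from paths.step[of "g \<otimes> h" G q S W s, OF step.IH step(2) this]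
  show ?case using c by (simp add: G.m_assoc)
qed

text \<open>Conjugation by \<open>t\<close> turns a step \<open>s\<close> into \<open>s\<close>
  followed by the commutator of \<open>s\<close> and \<open>t\<close>, and leaves the projection
  unchanged because \<open>Q\<close> is abelian. If these commutators can be inserted everywhere,
  the reached set is invariant under conjugation; then the elements that can be inserted everywhere
  are closed under the operations of \<open>conj_gen\<close>.\<close>

lemma kernel_subset_paths:
  assumes TY: "conj_gen T Y" and S: "S \<subseteq> carrier G" and W: "\<one>\<^sub>Q \<in> W"
    and move: "\<And>g n. \<lbrakk>g \<in> paths G q S W;
      n \<in> Y \<union> (\<lambda>(s, t). inv s \<otimes> (inv t \<otimes> (s \<otimes> t))) ` (S \<times> T)\<rbrakk> \<Longrightarrow> g \<otimes> n \<in> paths G q S W"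
  shows "N \<subseteq> paths G q S W"
proof -
  let ?P = "paths G q S W"
  have T: "T \<subseteq> carrier G" "\<And>t. t \<in> T \<Longrightarrow> inv t \<in> T" and Y: "Y \<subseteq> N" using TY by (auto simp: conj_gen_def)
  have PG: "g \<in> carrier G" if "g \<in> ?P" for g using G.paths_closed[OF that S] .
  have conj: "inv t \<otimes> g \<otimes> t \<in> ?P" if "g \<in> ?P" and t: "t \<in> T" for g t
    using that(1)
  proof (induction rule: paths.induct)
    case one
    then show ?case using t T paths.one[of G] by (auto simp: subset_iff)
  next
    case (step g s)
    have c: "g \<in> carrier G" "s \<in> carrier G" "t \<in> carrier G" using PG step S T t by auto
    have "q (inv t \<otimes> g \<otimes> t \<otimes> s) = q (g \<otimes> s)"
      using c hom_closed by (simp add: Q.m_ac)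
    then have W: "q (inv t \<otimes> g \<otimes> t \<otimes> s) \<in> W" using step(3) by simp
    have "inv t \<otimes> g \<otimes> t \<otimes> s \<in> ?P"
      by (rule paths.step[OF step.IH step(2) W])
    moreover have "inv s \<otimes> (inv t \<otimes> (s \<otimes> t)) \<in> (\<lambda>(s, t). inv s \<otimes> (inv t \<otimes> (s \<otimes> t))) ` (S \<times> T)"
      using step(2) t by (intro image_eqI[of _ _ "(s, t)"]) auto
    ultimately have "inv t \<otimes> g \<otimes> t \<otimes> s \<otimes> (inv s \<otimes> (inv t \<otimes> (s \<otimes> t))) \<in> ?P"
      using move by blast
    then show ?case using c by (simp add: G.m_assoc)
  qed
  define K where "K = {n. \<forall>g\<in>?P. g \<otimes> n \<in> ?P}"
  have "N \<subseteq> K"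
  proof -
    have "\<one> \<in> K" using PG by (auto simp: K_def)
    moreover have "Y \<subseteq> K" using move by (auto simp: K_def)
    moreover have "a \<otimes> b \<in> K" if "a \<in> K \<inter> N" "b \<in> K \<inter> N" for a b
      using that PG by (auto simp: K_def in_N G.m_assoc[symmetric])
    moreover have "inv t \<otimes> a \<otimes> t \<in> K" if a: "a \<in> K \<inter> N" and t: "t \<in> T" for a t
      unfolding K_def
    proof (intro CollectI ballI)
      fix g assume g: "g \<in> ?P"
      have c: "g \<in> carrier G" "a \<in> carrier G" "t \<in> carrier G" using PG g a t T by (auto simp: in_N)
      \<comment> \<open>To insert a conjugate of \<open>a\<close> at \<open>g\<close>, conjugate
        \<open>g\<close> back, insert \<open>a\<close>, and conjugate forth.\<close>
      have "inv (inv t) \<otimes> g \<otimes> inv t \<in> ?P" by (rule conj[OF g T(2)[OF t]])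
      then have "inv (inv t) \<otimes> g \<otimes> inv t \<otimes> a \<in> ?P" using a by (simp add: K_def)
      from conj[OF this t] show "g \<otimes> (inv t \<otimes> a \<otimes> t) \<in> ?P"
        using c by (simp add: G.m_assoc)
    qed
    ultimately show ?thesis by (rule conj_gen_induct[OF TY])
  qed
  moreover have "n \<in> ?P" if "n \<in> N \<inter> K" for n
    using that paths.one[of G q S W] G.l_one[of n] by (auto simp: K_def in_N)
  ultimately show ?thesis by blast
qed

text \<open>A path over a submonoid may be started at any point over it, so elements reached once
  can be inserted everywhere. Thus finitely many elements decide whether \<open>S\<close> suffices,
  which lets the property pass from the union of a chain to a member.\<close>

lemma fg_over_criterion:
  assumes TY: "conj_gen T Y" and S: "finite S" "S \<subseteq> carrier G" and P: "submon P"
    and C: "Y \<union> (\<lambda>(s, t). inv s \<otimes> (inv t \<otimes> (s \<otimes> t))) ` (S \<times> T) \<subseteq> paths G q S P"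
  shows "fg_over P"
proof -
  have "N \<subseteq> paths G q S P"
  proof (rule kernel_subset_paths[OF TY S(2)])
    show "\<one>\<^sub>Q \<in> P" using P by (simp add: submon_def)
    show "g \<otimes> n \<in> paths G q S P" if "g \<in> paths G q S P"
      "n \<in> Y \<union> (\<lambda>(s, t). inv s \<otimes> (inv t \<otimes> (s \<otimes> t))) ` (S \<times> T)" for g n
      using that C P paths_image[OF that(1)]
      by (intro paths_append[OF _ that(1) S(2), of n P]) (auto simp: submon_def)
  qed
  then show ?thesis using S by (auto simp: fg_over_def)
qed

lemma conj_gen_commutators:
  assumes TY: "conj_gen T Y" and S: "S \<subseteq> carrier G"
  shows "Y \<union> (\<lambda>(s, t). inv s \<otimes> (inv t \<otimes> (s \<otimes> t))) ` (S \<times> T) \<subseteq> N"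
proof -
  have "inv s \<otimes> (inv t \<otimes> (s \<otimes> t)) \<in> N" if "s \<in> S" "t \<in> T" for s t
  proof -
    have c: "s \<in> carrier G" "t \<in> carrier G" using that S TY by (auto simp: conj_gen_def)
    have "q (inv s \<otimes> (inv t \<otimes> (s \<otimes> t))) = inv\<^sub>Q q s \<cdot> (q s \<cdot> (inv\<^sub>Q q t \<cdot> q t))"
      using c hom_closed by (simp add: Q.m_ac)
    also have "\<dots> = \<one>\<^sub>Q" using c hom_closed by simp
    finally show ?thesis using c by (simp add: in_N)
  qed
  then show ?thesis using TY by (auto simp: conj_gen_def)
qed

section \<open>Adjoining one element to a submonoid\<close>

definition adjoin :: "'q set \<Rightarrow> 'q \<Rightarrow> 'q set" where
  "adjoin P a = {p \<cdot> a [^]\<^bsub>Q\<^esub> (i :: nat) | p i. p \<in> P}"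

text \<open>Slabs of bounded height over \<open>P\<close>; finitely many paths over
  \<open>adjoin P a\<close> fit into one of them.\<close>

definition window :: "'q set \<Rightarrow> 'q \<Rightarrow> nat \<Rightarrow> 'q set" where
  "window P a m = {p \<cdot> a [^]\<^bsub>Q\<^esub> i | p i. p \<in> P \<and> i \<le> m}"

lemma adjoin_window: "adjoin P a = \<Union> (range (window P a))"
  by (auto simp: adjoin_def window_def)

lemma window_mono: "m \<le> n \<Longrightarrow> window P a m \<subseteq> window P a n"
  by (fastforce simp: window_def)

lemma finite_paths_window:
  assumes "finite C" "C \<subseteq> paths G q S (adjoin P a)"
  shows "\<exists>m. C \<subseteq> paths G q S (window P a m)"
proof -
  have "A \<subseteq> B \<or> B \<subseteq> A" if AB: "A \<in> range (window P a)" "B \<in> range (window P a)" for A B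
  proof -
    obtain m n where "A = window P a m" "B = window P a n" using AB by blast
    then show ?thesis using window_mono[of m n P a] window_mono[of n m P a] by (cases "m \<le> n") auto
  qed
  from finite_paths_chain[OF assms(1) assms(2)[unfolded adjoin_window] _ this] show ?thesis by blast
qed

lemma submon_adjoin:
  assumes P: "submon P" and a: "a \<in> carrier Q"
  shows "submon (adjoin P a)" "P \<subseteq> adjoin P a" "a \<in> adjoin P a"
proof -
  have PQ: "P \<subseteq> carrier Q" using P by (simp add: submon_def)
  show "P \<subseteq> adjoin P a"
  proof
    fix p assume "p \<in> P"
    then show "p \<in> adjoin P a" using PQ unfolding adjoin_def
      by (intro CollectI exI[of _ p] exI[of _ "0::nat"]) auto
  qed
  show "a \<in> adjoin P a" using P a unfolding adjoin_def submon_def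
    by (intro CollectI exI[of _ "\<one>\<^sub>Q"] exI[of _ "1::nat"]) auto
  have "x \<cdot> y \<in> adjoin P a" if xy: "x \<in> adjoin P a" "y \<in> adjoin P a" for x y
  proof -
    obtain p i p' j where p: "p \<in> P" "p' \<in> P" "x = p \<cdot> a [^]\<^bsub>Q\<^esub> (i::nat)" "y = p' \<cdot> a [^]\<^bsub>Q\<^esub> (j::nat)"
      using xy by (auto simp: adjoin_def)
    have "p \<in> carrier Q" "p' \<in> carrier Q" using p PQ by auto
    then have "x \<cdot> y = (p \<cdot> p') \<cdot> a [^]\<^bsub>Q\<^esub> (i + j)"
      using p a by (simp add: Q.m_ac H.nat_pow_mult[symmetric])
    then show ?thesis using p P unfolding adjoin_def submon_def by blast
  qed
  then show "submon (adjoin P a)"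
    using P PQ a \<open>P \<subseteq> adjoin P a\<close> by (auto simp: submon_def adjoin_def)
qed

text \<open>A loop in \<open>window P a m\<close> or in \<open>window P a\<inverse> m\<close> can be inserted at every point of
  \<open>window P a (2 * m)\<close>, upwards in the lower half and downwards in the upper half.\<close>

lemma fg_over_adjoin:
  assumes TY: "conj_gen T Y" "finite T" "finite Y" and P: "submon P" and a: "a \<in> carrier Q"
    and up: "fg_over (adjoin P a)" and down: "fg_over (adjoin P (inv\<^sub>Q a))"
  shows "fg_over P"
proof -
  obtain S1 S2 where S1: "finite S1" "S1 \<subseteq> carrier G" "N \<subseteq> paths G q S1 (adjoin P a)"
    and S2: "finite S2" "S2 \<subseteq> carrier G" "N \<subseteq> paths G q S2 (adjoin P (inv\<^sub>Q a))"
    using up down by (auto simp: fg_over_def)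
  define S where "S = S1 \<union> S2"
  have S: "finite S" "S \<subseteq> carrier G" using S1 S2 by (auto simp: S_def)
  have Nup: "N \<subseteq> paths G q S (adjoin P a)" and Ndown: "N \<subseteq> paths G q S (adjoin P (inv\<^sub>Q a))"
    using S1(3) S2(3) paths_mono[of _ G q _ _ S] by (auto simp: S_def)
  define C where "C = Y \<union> (\<lambda>(s, t). inv s \<otimes> (inv t \<otimes> (s \<otimes> t))) ` (S \<times> T)"
  have C: "finite C" "C \<subseteq> N" using conj_gen_commutators[OF TY(1) S(2)] TY S by (auto simp: C_def)
  obtain m1 m2 where "C \<subseteq> paths G q S (window P a m1)" "C \<subseteq> paths G q S (window P (inv\<^sub>Q a) m2)"
    using finite_paths_window[OF C(1)] C(2) Nup Ndown by (meson order_trans)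
  moreover define m where "m = max m1 m2"
  ultimately have m: "C \<subseteq> paths G q S (window P a m)" "C \<subseteq> paths G q S (window P (inv\<^sub>Q a) m)"
    using window_mono[of m1 m P a] window_mono[of m2 m P "inv\<^sub>Q a"] paths_mono[of _ G q S _ S] by auto
  define W where "W = window P a (2 * m)"
  have PQ: "P \<subseteq> carrier Q" and P1: "\<one>\<^sub>Q \<in> P" and PP: "\<And>x y. x \<in> P \<Longrightarrow> y \<in> P \<Longrightarrow> x \<cdot> y \<in> P"
    using P by (auto simp: submon_def)
  have W1: "\<one>\<^sub>Q \<in> W" unfolding W_def window_def using P1
    by (intro CollectI exI[of _ "\<one>\<^sub>Q"] exI[of _ "0::nat"]) auto
  have inW: "x \<in> W" if "x = p \<cdot> a [^]\<^bsub>Q\<^esub> i" "p \<in> P" "i \<le> 2 * m" for x p i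
    using that unfolding W_def window_def by blast
  have NW: "N \<subseteq> paths G q S W"
  proof (rule kernel_subset_paths[OF TY(1) S(2) W1])
    fix g n assume g: "g \<in> paths G q S W"
      and "n \<in> Y \<union> (\<lambda>(s, t). inv s \<otimes> (inv t \<otimes> (s \<otimes> t))) ` (S \<times> T)"
    then have n: "n \<in> C" by (simp add: C_def)
    obtain p i where p: "p \<in> P" "i \<le> 2 * m" "q g = p \<cdot> a [^]\<^bsub>Q\<^esub> i"
      using paths_image[OF g W1] by (auto simp: W_def window_def)
    have pQ: "p \<in> carrier Q" using p PQ by auto
    show "g \<otimes> n \<in> paths G q S W"
    proof (cases "i \<le> m")
      case True
      show ?thesis
      proof (rule paths_append[OF _ g S(2)])
        show "n \<in> paths G q S (window P a m)" using m n by blast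
        fix v assume "v \<in> window P a m"
        then obtain p' j where v: "p' \<in> P" "j \<le> m" "v = p' \<cdot> a [^]\<^bsub>Q\<^esub> j" by (auto simp: window_def)
        have "p' \<in> carrier Q" using v PQ by auto
        then have "q g \<cdot> v = (p \<cdot> p') \<cdot> a [^]\<^bsub>Q\<^esub> (i + j)"
          using p v a pQ by (simp add: Q.m_ac H.nat_pow_mult[symmetric])
        then show "q g \<cdot> v \<in> W" by (rule inW) (use True v p PP in auto)
      qed
    next
      case False
      show ?thesis
      proof (rule paths_append[OF _ g S(2)])
        show "n \<in> paths G q S (window P (inv\<^sub>Q a) m)" using m n by blast
        fix v assume "v \<in> window P (inv\<^sub>Q a) m"
        then obtain p' j where v: "p' \<in> P" "j \<le> m" "v = p' \<cdot> inv\<^sub>Q a [^]\<^bsub>Q\<^esub> j" by (auto simp: window_def)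
        have p'Q: "p' \<in> carrier Q" using v PQ by auto
        have "a [^]\<^bsub>Q\<^esub> i = a [^]\<^bsub>Q\<^esub> (i - j) \<cdot> a [^]\<^bsub>Q\<^esub> j"
          using a v False by (simp add: H.nat_pow_mult)
        then have "q g \<cdot> v = (p \<cdot> p') \<cdot> (a [^]\<^bsub>Q\<^esub> (i - j) \<cdot> (a [^]\<^bsub>Q\<^esub> j \<cdot> inv\<^sub>Q (a [^]\<^bsub>Q\<^esub> j)))"
          using p v a pQ p'Q by (simp add: Q.m_ac H.nat_pow_inv)
        also have "\<dots> = (p \<cdot> p') \<cdot> a [^]\<^bsub>Q\<^esub> (i - j)" using a by simp
        finally show "q g \<cdot> v \<in> W" by (rule inW) (use False v p PP in auto)
      qed
    qed
  qed
  \<comment> \<open>It remains to pass from the window to \<open>P\<close>. A point \<open>d\<close>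
    over \<open>W\<close> is represented by \<open>d \<otimes> inv u\<close> with a power
    \<open>u\<close> of \<alpha> from the finite set \<open>U\<close>; steps between representatives
    form a finite set.\<close>
  obtain \<alpha> where \<alpha>: "\<alpha> \<in> carrier G" "q \<alpha> = a" using a surj by (metis imageE)
  define U where "U = (\<lambda>i. \<alpha> [^] i) ` {..2 * m}"
  have U: "finite U" "U \<subseteq> carrier G" using \<alpha> by (auto simp: U_def)
  have U1: "\<one> \<in> U" unfolding U_def by (rule image_eqI[of _ _ "0::nat"]) auto
  define S' where "S' = (\<lambda>(u, s, v). u \<otimes> s \<otimes> inv v) ` (U \<times> insert \<one> S \<times> U)"
  have S': "finite S'" "S' \<subseteq> carrier G" using U S by (auto simp: S'_def)
  have S'I: "u \<otimes> s \<otimes> inv v \<in> S'" if "u \<in> U" "s \<in> insert \<one> S" "v \<in> U" for u s v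
    unfolding S'_def using that by (intro image_eqI[of _ _ "(u, s, v)"]) auto
  have UW: "\<exists>u\<in>U. q (d \<otimes> inv u) \<in> P" if d: "d \<in> carrier G" "q d \<in> W" for d
  proof -
    obtain p i where p: "p \<in> P" "i \<le> 2 * m" "q d = p \<cdot> a [^]\<^bsub>Q\<^esub> i"
      using d by (auto simp: W_def window_def)
    have "p \<in> carrier Q" using p PQ by auto
    then have "q (d \<otimes> inv (\<alpha> [^] i)) = p"
      using d p a \<alpha> by (simp add: hom_nat_pow H.m_assoc)
    then show ?thesis using p by (auto simp: U_def)
  qed
  have "d \<otimes> inv u \<in> paths G q S' P"
    if "d \<in> paths G q S W" "u \<in> U" "q (d \<otimes> inv u) \<in> P" for d u
    using that
  proof (induction arbitrary: u rule: paths.induct)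
    case (one u)
    have u: "u \<in> carrier G" using one U by auto
    have "\<one> \<otimes> (\<one> \<otimes> \<one> \<otimes> inv u) \<in> paths G q S' P"
      by (rule paths.step[OF paths.one S'I]) (use one U1 u in auto)
    then show ?case using u by simp
  next
    case (step d s u)
    have c: "d \<in> carrier G" "s \<in> carrier G" "u \<in> carrier G"
      using G.paths_closed[OF step(1) S(2)] step S U by auto
    obtain u0 where u0: "u0 \<in> U" "q (d \<otimes> inv u0) \<in> P"
      using UW[OF c(1)] paths_image[OF step(1) W1] by blast
    have u0c: "u0 \<in> carrier G" using u0 U by auto
    have e: "d \<otimes> inv u0 \<otimes> (u0 \<otimes> s \<otimes> inv u) = d \<otimes> s \<otimes> inv u"
      using c u0c by (simp add: G.m_assoc)
    have "d \<otimes> inv u0 \<otimes> (u0 \<otimes> s \<otimes> inv u) \<in> paths G q S' P"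
      by (rule paths.step[OF step.IH[OF u0] S'I]) (use u0 step e in auto)
    then show ?case by (simp only: e)
  qed
  from this[OF _ U1] have "N \<subseteq> paths G q S' P"
    using NW P1 by (force simp: in_N)
  then show ?thesis using S' by (auto simp: fg_over_def)
qed

text \<open>Zorn's lemma applies because a union with \<open>fg_over\<close> has, by
  \<open>fg_over_criterion\<close>, a member with \<open>fg_over\<close>. If a maximal
  \<open>P\<close> contained neither \<open>a\<close> nor its inverse, both enlargements would
  satisfy \<open>fg_over\<close>, and by \<open>fg_over_adjoin\<close> so would
  \<open>P\<close>.\<close>

lemma ex_total_not_fg_over:
  assumes TY: "conj_gen T Y" "finite T" "finite Y" and not: "\<not> fg_over {\<one>\<^sub>Q}"
  obtains P where "submon P" "\<not> fg_over P" "\<And>a. a \<in> carrier Q \<Longrightarrow> a \<in> P \<or> inv\<^sub>Q a \<in> P"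
proof -
  define \<D> where "\<D> = {P. submon P \<and> \<not> fg_over P}"
  have "{\<one>\<^sub>Q} \<in> \<D>" using not by (simp add: \<D>_def submon_def)
  then have ne: "\<D> \<noteq> {}" by blast
  have chain: "\<Union>\<C> \<in> \<D>" if neC: "\<C> \<noteq> {}" and "subset.chain \<D> \<C>" for \<C>
  proof -
    have sub: "\<And>P. P \<in> \<C> \<Longrightarrow> submon P" "\<And>P. P \<in> \<C> \<Longrightarrow> \<not> fg_over P"
      and lin: "\<And>A B. A \<in> \<C> \<Longrightarrow> B \<in> \<C> \<Longrightarrow> A \<subseteq> B \<or> B \<subseteq> A"
      using that(2) by (auto simp: subset.chain_def \<D>_def)
    have "a \<cdot> b \<in> \<Union>\<C>" if ab: "a \<in> \<Union>\<C>" "b \<in> \<Union>\<C>" for a b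
    proof -
      obtain A B where "A \<in> \<C>" "a \<in> A" "B \<in> \<C>" "b \<in> B" using ab by blast
      then obtain D where "D \<in> \<C>" "a \<in> D" "b \<in> D" using lin[of A B] by blast
      then show ?thesis using sub(1)[of D] by (auto simp: submon_def)
    qed
    then have "submon (\<Union>\<C>)" using sub(1) that(1) unfolding submon_def by blast
    moreover have "\<not> fg_over (\<Union>\<C>)"
    proof
      assume "fg_over (\<Union>\<C>)"
      then obtain S where S: "finite S" "S \<subseteq> carrier G" "N \<subseteq> paths G q S (\<Union>\<C>)"
        by (auto simp: fg_over_def)
      define C where "C = Y \<union> (\<lambda>(s, t). inv s \<otimes> (inv t \<otimes> (s \<otimes> t))) ` (S \<times> T)"
      have "finite C" "C \<subseteq> N" using conj_gen_commutators[OF TY(1) S(2)] TY S by (auto simp: C_def)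
      then obtain P where "P \<in> \<C>" "C \<subseteq> paths G q S P"
        using finite_paths_chain[OF _ _ neC lin] S(3) by (meson order_trans)
      then show False using fg_over_criterion[OF TY(1) S(1,2)] sub unfolding C_def by blast
    qed
    ultimately show ?thesis by (simp add: \<D>_def)
  qed
  obtain P where P: "P \<in> \<D>" and max: "\<And>P'. P' \<in> \<D> \<Longrightarrow> P \<subseteq> P' \<Longrightarrow> P' = P"
    using subset_Zorn_nonempty[OF ne chain] by blast
  have sP: "submon P" and nP: "\<not> fg_over P" using P by (auto simp: \<D>_def)
  have fg: "fg_over (adjoin P a)" if "a \<in> carrier Q" "a \<notin> P" for a
    using max[of "adjoin P a"] submon_adjoin[OF sP that(1)] that(2) by (auto simp: \<D>_def)
  show ?thesis
    by (rule that[OF sP nP]) (use fg fg_over_adjoin[OF TY sP] nP in blast)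
qed

text \<open>A path over the trivial submonoid never leaves \<open>N\<close>, hence each of its steps
  lies in \<open>N\<close>.\<close>

lemma fg_over_one:
  assumes "fg_over {\<one>\<^sub>Q}"
  shows "\<exists>S. finite S \<and> S \<subseteq> N \<and> generate G S = N"
proof -
  obtain S where S: "finite S" "S \<subseteq> carrier G" "N \<subseteq> paths G q S {\<one>\<^sub>Q}"
    using assms by (auto simp: fg_over_def)
  have "g \<in> generate G (S \<inter> N) \<and> q g = \<one>\<^sub>Q" if "g \<in> paths G q S {\<one>\<^sub>Q}" for g
    using that
  proof (induction rule: paths.induct)
    case (step g s)
    have c: "g \<in> carrier G" "s \<in> carrier G" using G.paths_closed[OF step(1) S(2)] step S by auto
    then have "s \<in> S \<inter> N" using step by (auto simp: in_N)
    then show ?case using step by (auto intro: generate.eng generate.incl)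
  qed (auto intro: generate.one)
  moreover have "generate G (S \<inter> N) \<subseteq> N" by (rule G.generate_subgroup_incl[OF _ subgroup_kernel]) auto
  ultimately show ?thesis using S by (intro exI[of _ "S \<inter> N"]) auto
qed

end

section \<open>Fibre products over a totally preordered quotient\<close>

context abelian_image
begin

text \<open>The two coordinates have inverse projections, so a pair above the wall on the left is
  below it on the right.\<close>

definition fibre_set :: "('a \<times> 'a) set" where
  "fibre_set = {(g, h). g \<in> carrier G \<and> h \<in> carrier G \<and> q g \<cdot> q h = \<one>\<^sub>Q}"

definition fibre_group :: "('a \<times> 'a) monoid" where
  "fibre_group = (G \<times>\<times> G)\<lparr>carrier := fibre_set\<rparr>"

abbreviation fibre_set_mult (infixl "\<odot>" 70) where "x \<odot> y \<equiv> x \<otimes>\<^bsub>fibre_group\<^esub> y"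

lemma in_fibre_set: "x \<in> fibre_set \<longleftrightarrow> fst x \<in> carrier G \<and> snd x \<in> carrier G \<and> q (snd x) = inv\<^sub>Q q (fst x)"
proof (cases "fst x \<in> carrier G \<and> snd x \<in> carrier G")
  case True
  then have c: "q (fst x) \<in> carrier Q" "q (snd x) \<in> carrier Q" by auto
  have "q (fst x) \<cdot> q (snd x) = \<one>\<^sub>Q \<longleftrightarrow> q (snd x) = inv\<^sub>Q q (fst x)"
  proof
    assume "q (fst x) \<cdot> q (snd x) = \<one>\<^sub>Q"
    then have "inv\<^sub>Q q (fst x) = q (snd x)" using c Q.m_comm[OF c] by (intro H.inv_equality) simp_all
    then show "q (snd x) = inv\<^sub>Q q (fst x)" ..
  next
    assume "q (snd x) = inv\<^sub>Q q (fst x)"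
    then show "q (fst x) \<cdot> q (snd x) = \<one>\<^sub>Q" using c(1) by simp
  qed
  with True show ?thesis by (auto simp: fibre_set_def case_prod_unfold)
qed (auto simp: fibre_set_def)

lemma subgroup_fibre_set: "subgroup fibre_set (G \<times>\<times> G)"
proof -
  interpret P: group "G \<times>\<times> G" using DirProd_group G.group_axioms by blast
  show ?thesis
  proof (rule P.subgroupI)
    show "fibre_set \<subseteq> carrier (G \<times>\<times> G)" by (auto simp: fibre_set_def)
    have "(\<one>, \<one>) \<in> fibre_set" by (simp add: fibre_set_def)
    then show "fibre_set \<noteq> {}" by blast
    show "inv\<^bsub>G \<times>\<times> G\<^esub> a \<in> fibre_set" if "a \<in> fibre_set" for a
      using that by (cases a) (auto simp: in_fibre_set inv_DirProd[OF G.group_axioms G.group_axioms])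
    show "a \<otimes>\<^bsub>G \<times>\<times> G\<^esub> b \<in> fibre_set" if "a \<in> fibre_set" "b \<in> fibre_set" for a b
      using that hom_closed by (cases a, cases b) (auto simp: in_fibre_set H.inv_mult_group Q.m_comm)
  qed
qed

lemma group_fibre_group: "group fibre_group"
proof -
  interpret P: group "G \<times>\<times> G" using DirProd_group G.group_axioms by blast
  show ?thesis unfolding fibre_group_def by (rule P.subgroup_imp_group[OF subgroup_fibre_set])
qed

lemma fibre_group_simps:
  "carrier fibre_group = fibre_set" "\<one>\<^bsub>fibre_group\<^esub> = (\<one>, \<one>)"
  "x \<otimes>\<^bsub>fibre_group\<^esub> y = (fst x \<otimes> fst y, snd x \<otimes> snd y)"
  by (simp_all add: fibre_group_def DirProd_def case_prod_unfold)

lemma inv_fibre_group: "x \<in> fibre_set \<Longrightarrow> inv\<^bsub>fibre_group\<^esub> x = (inv fst x, inv snd x)"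
proof -
  assume x: "x \<in> fibre_set"
  interpret P: group "G \<times>\<times> G" using DirProd_group G.group_axioms by blast
  have "inv\<^bsub>fibre_group\<^esub> x = inv\<^bsub>G \<times>\<times> G\<^esub> x"
    unfolding fibre_group_def by (rule P.m_inv_consistent[OF subgroup_fibre_set x])
  then show ?thesis using x inv_DirProd[OF G.group_axioms G.group_axioms, of "fst x" "snd x"]
    by (simp add: in_fibre_set)
qed

text \<open>Additively, \<sigma> is an upper bound of the negatives of the elements of
  \<open>A\<close>; it will serve as the width of the strip.\<close>

lemma total_upper_bound:
  assumes P: "submon P" and tot: "\<And>a. a \<in> carrier Q \<Longrightarrow> a \<in> P \<or> inv\<^sub>Q a \<in> P"
    and A: "finite A" "A \<subseteq> carrier Q"
  shows "\<exists>\<sigma>\<in>P. \<forall>a\<in>A. \<sigma> \<cdot> a \<in> P"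
  using A
proof (induction rule: finite_induct)
  case empty
  then show ?case using P by (auto simp: submon_def)
next
  case (insert a A)
  have PQ: "P \<subseteq> carrier Q" and P1: "\<one>\<^sub>Q \<in> P" and PP: "\<And>x y. x \<in> P \<Longrightarrow> y \<in> P \<Longrightarrow> x \<cdot> y \<in> P"
    using P by (auto simp: submon_def)
  obtain \<sigma> where \<sigma>: "\<sigma> \<in> P" "\<forall>a\<in>A. \<sigma> \<cdot> a \<in> P" using insert by auto
  have a: "a \<in> carrier Q" using insert by auto
  have "\<exists>\<tau>\<in>P. \<tau> \<cdot> a \<in> P"
  proof (cases "a \<in> P")
    case True then show ?thesis using P1 a by (intro bexI[of _ "\<one>\<^sub>Q"]) auto
  next
    case False then show ?thesis using tot[OF a] P1 a by (intro bexI[of _ "inv\<^sub>Q a"]) auto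
  qed
  then obtain \<tau> where \<tau>: "\<tau> \<in> P" "\<tau> \<cdot> a \<in> P" by blast
  have c: "\<sigma> \<in> carrier Q" "\<tau> \<in> carrier Q" using \<sigma> \<tau> PQ by auto
  have "\<tau> \<cdot> \<sigma> \<cdot> x \<in> P" if "x \<in> insert a A" for x
  proof (cases "x = a")
    case True
    then have "\<tau> \<cdot> \<sigma> \<cdot> x = \<sigma> \<cdot> (\<tau> \<cdot> a)" using c a by (simp add: Q.m_ac)
    then show ?thesis using PP \<sigma> \<tau> by simp
  next
    case False
    then have x: "x \<in> A" "x \<in> carrier Q" using that insert by auto
    then have "\<tau> \<cdot> \<sigma> \<cdot> x = \<tau> \<cdot> (\<sigma> \<cdot> x)" using c by (simp add: Q.m_ac)
    then show ?thesis using PP \<sigma> \<tau> x by simp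
  qed
  then show ?case using PP \<sigma> \<tau> by blast
qed

text \<open>\<open>z\<close> is the smaller of \<open>x\<close> and \<open>y\<close>, described by
  its effect on membership in \<open>P\<close>.\<close>

lemma total_lower_bound:
  assumes P: "submon P" and tot: "\<And>a. a \<in> carrier Q \<Longrightarrow> a \<in> P \<or> inv\<^sub>Q a \<in> P"
    and xy: "x \<in> carrier Q" "y \<in> carrier Q"
  shows "\<exists>z\<in>carrier Q. \<forall>w\<in>carrier Q. z \<cdot> w \<in> P \<longrightarrow> x \<cdot> w \<in> P \<and> y \<cdot> w \<in> P"
proof -
  have PQ: "P \<subseteq> carrier Q" and PP: "\<And>x y. x \<in> P \<Longrightarrow> y \<in> P \<Longrightarrow> x \<cdot> y \<in> P"
    using P by (auto simp: submon_def)
  have *: "b \<cdot> w \<in> P" if "b \<cdot> inv\<^sub>Q a \<in> P" "a \<cdot> w \<in> P" "a \<in> carrier Q" "b \<in> carrier Q" "w \<in> carrier Q" for a b w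
  proof -
    have "(b \<cdot> inv\<^sub>Q a) \<cdot> (a \<cdot> w) = b \<cdot> w"
      using that by (simp add: H.m_assoc)
    then show ?thesis using PP[OF that(1,2)] by simp
  qed
  show ?thesis
  proof (cases "y \<cdot> inv\<^sub>Q x \<in> P")
    case True
    then show ?thesis using *[of y x] xy by (intro bexI[of _ x]) auto
  next
    case False
    then have "inv\<^sub>Q (y \<cdot> inv\<^sub>Q x) \<in> P" using tot[of "y \<cdot> inv\<^sub>Q x"] xy by auto
    then have "x \<cdot> inv\<^sub>Q y \<in> P" using xy by (simp add: H.inv_mult_group)
    then show ?thesis using *[of x y] xy by (intro bexI[of _ y]) auto
  qed
qed

text \<open>Let \<open>B\<close> be the component of \<open>1\<close> in a wide strip around the wall between \<open>P\<close> and its complement.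
  Counting the signed crossings of the wall inside \<open>B\<close> gives a cocycle on the Cayley graph of the
  fibre product; its relators are short compared with the strip, so it is exact. If neither
  \<open>(x, 1)\<close> nor \<open>(1, x)\<close> were in \<open>B\<close>, their commutator would describe a closed path with a
  positive number of crossings.\<close>

lemma crossing_count:
  assumes fp: "finitely_presented fibre_group" and P: "submon P"
    and tot: "\<And>a. a \<in> carrier Q \<Longrightarrow> a \<in> P \<or> inv\<^sub>Q a \<in> P"
    and T: "finite T" "T \<subseteq> carrier G" "\<And>t. t \<in> T \<Longrightarrow> inv t \<in> T" and Y: "finite Y" "Y \<subseteq> N"
  obtains S \<sigma> where "finite S" "S \<subseteq> carrier G" "T \<subseteq> S" "\<sigma> \<in> P"
    "\<And>v y. \<lbrakk>v \<in> paths G q T {x \<in> carrier Q. inv\<^sub>Q x \<in> P}; y \<in> Y\<rbrakk> \<Longrightarrow> v \<otimes> y \<otimes> inv v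
      \<in> paths G q S {x \<in> carrier Q. \<sigma> \<cdot> x \<in> P \<and> \<sigma> \<cdot> inv\<^sub>Q x \<in> P}"
proof -
  interpret F: group fibre_group by (rule group_fibre_group)
  have PQ: "P \<subseteq> carrier Q" and P1: "\<one>\<^sub>Q \<in> P" and PP: "\<And>x y. x \<in> P \<Longrightarrow> y \<in> P \<Longrightarrow> x \<cdot> y \<in> P"
    using P by (auto simp: submon_def)
  have YG: "Y \<subseteq> carrier G" "\<And>y. y \<in> Y \<Longrightarrow> q y = \<one>\<^sub>Q" using Y by (auto simp: in_N)
  \<comment> \<open>Each letter occurs in both coordinates, because one path in \<open>G\<close>
    will be followed on the left below the wall and on the right above it.\<close>
  define S0 where "S0 = (\<lambda>t. (t, inv t)) ` T \<union> (\<lambda>t. (inv t, t)) ` T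
    \<union> (\<lambda>y. (y, \<one>)) ` Y \<union> (\<lambda>y. (\<one>, y)) ` Y"
  have S0: "finite S0" "S0 \<subseteq> carrier fibre_group"
    using T Y YG by (auto simp: S0_def fibre_group_simps in_fibre_set subset_iff)
  obtain S where S: "finite S" "S \<subseteq> carrier fibre_group" "S0 \<subseteq> S" "\<And>s. s \<in> S \<Longrightarrow> inv\<^bsub>fibre_group\<^esub> s \<in> S"
    and exact: "\<And>c :: 'a \<times> 'a \<Rightarrow> 'a \<times> 'a \<Rightarrow> int.
      (\<And>h s s'. \<lbrakk>h \<in> carrier fibre_group; s \<in> S; s' \<in> S; s \<odot> s' \<in> S\<rbrakk> \<Longrightarrow>
        c h (h \<odot> s) + c (h \<odot> s) (h \<odot> s \<odot> s') = c h (h \<odot> s \<odot> s')) \<Longrightarrow>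
      \<exists>F. \<forall>h\<in>carrier fibre_group. \<forall>s\<in>S0. c h (h \<odot> s) = F (h \<odot> s) - F h"
    using F.triangle_cocycle_exact[OF fp S0] by metis
  define SG where "SG = fst ` S \<union> snd ` S"
  have Sfib: "s \<in> fibre_set" if "s \<in> S" for s using that S(2) by (auto simp: fibre_group_simps)
  have SG: "finite SG" "SG \<subseteq> carrier G" using S Sfib by (auto simp: SG_def in_fibre_set)
  have TSG: "T \<subseteq> SG"
  proof
    fix t assume "t \<in> T"
    then have "(t, inv t) \<in> S" using S(3) by (auto simp: S0_def)
    then have "fst (t, inv t) \<in> fst ` S" by (rule imageI)
    then show "t \<in> SG" by (simp add: SG_def)
  qed
  \<comment> \<open>Steps of \<open>S\<close> change the height by at most \<sigma>, up or down;
    hence a step across the wall has both ends in the strip.\<close>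
  obtain \<sigma> where \<sigma>: "\<sigma> \<in> P" "\<forall>a\<in>q ` SG. \<sigma> \<cdot> a \<in> P"
    using total_upper_bound[OF P tot finite_imageI[OF SG(1)], of q] SG(2) hom_closed by blast
  have \<sigma>Q: "\<sigma> \<in> carrier Q" using \<sigma> PQ by auto
  have step1: "\<sigma> \<cdot> q (fst s) \<in> P" if "s \<in> S" for s using \<sigma>(2) that by (auto simp: SG_def)
  have step2: "\<sigma> \<cdot> inv\<^sub>Q q (fst s) \<in> P" if "s \<in> S" for s
    using step1[OF S(4)[OF that]] Sfib[OF that] by (simp add: inv_fibre_group in_fibre_set)
  define Strip where "Strip = {x \<in> carrier Q. \<sigma> \<cdot> x \<in> P \<and> \<sigma> \<cdot> inv\<^sub>Q x \<in> P}"
  have Strip1: "\<one>\<^sub>Q \<in> Strip" using \<sigma> \<sigma>Q by (simp add: Strip_def)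
  define p where "p h = q (fst h)" for h :: "'a \<times> 'a"
  have pQ: "p h \<in> carrier Q" if "h \<in> fibre_set" for h using that by (simp add: p_def in_fibre_set)
  have pm: "p (h \<odot> k) = p h \<cdot> p k" if "h \<in> fibre_set" "k \<in> fibre_set" for h k
    using that by (simp add: p_def fibre_group_simps in_fibre_set)
  have mc: "h \<odot> k \<in> fibre_set" if "h \<in> fibre_set" "k \<in> fibre_set" for h k
    using F.m_closed[of h k] that by (simp add: fibre_group_simps(1))
  define B where "B = paths fibre_group p S Strip"
  have Bfib: "h \<in> fibre_set" if "h \<in> B" for h
    using F.paths_closed[of h p S Strip] that S(2) by (simp add: B_def fibre_group_simps(1))
  have B1: "\<one>\<^bsub>fibre_group\<^esub> \<in> B" unfolding B_def by (rule paths.one)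
  have adj: "h \<in> B \<longleftrightarrow> h \<odot> s \<in> B"
    if h: "h \<in> fibre_set" and s: "s \<in> S" and str: "p h \<in> Strip" "p (h \<odot> s) \<in> Strip" for h s
  proof
    assume "h \<in> B"
    then show "h \<odot> s \<in> B" using s str unfolding B_def by (intro paths.step) auto
  next
    assume "h \<odot> s \<in> B"
    moreover have e: "h \<odot> s \<odot> inv\<^bsub>fibre_group\<^esub> s = h"
      using h Sfib[OF s] F.m_assoc[of h s "inv\<^bsub>fibre_group\<^esub> s"] F.r_inv[of s] F.r_one[of h] F.inv_closed[of s]
      by (simp only: fibre_group_simps(1))
    ultimately have "h \<odot> s \<odot> inv\<^bsub>fibre_group\<^esub> s \<in> B"
      unfolding B_def by (intro paths.step[OF _ S(4)[OF s]]) (use e str in auto)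
    then show "h \<in> B" by (simp only: e)
  qed
  \<comment> \<open>The preorder need not be antisymmetric. Elements of both signs lie in the strip,
    and there the two cones have to be reconciled.\<close>
  have zero: "x \<in> Strip" if "x \<in> P" "inv\<^sub>Q x \<in> P" for x
    using that PP \<sigma>(1) PQ by (auto simp: Strip_def)
  have cross: "x \<in> Strip" "y \<in> Strip"
    if "x \<in> P" "inv\<^sub>Q y \<in> P" "y = x \<cdot> d" "d \<in> carrier Q" "\<sigma> \<cdot> d \<in> P" for x y d
  proof -
    have x: "x \<in> carrier Q" using that PQ by auto
    have "\<sigma> \<cdot> inv\<^sub>Q x = (\<sigma> \<cdot> d) \<cdot> inv\<^sub>Q y"
    proof -
      have "(\<sigma> \<cdot> d) \<cdot> inv\<^sub>Q y = \<sigma> \<cdot> (d \<cdot> (inv\<^sub>Q d \<cdot> inv\<^sub>Q x))"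
        using x that(3,4) \<sigma>Q by (simp add: H.inv_mult_group H.m_assoc)
      then show ?thesis using x that(4) by simp
    qed
    then show "x \<in> Strip" using x PP[OF that(5,2)] PP[OF \<sigma>(1) that(1)] by (simp add: Strip_def)
    have "\<sigma> \<cdot> y = (\<sigma> \<cdot> d) \<cdot> x" using x that(3,4) \<sigma>Q by (simp add: Q.m_ac)
    then show "y \<in> Strip" using x that(3,4) PP[OF that(5,1)] PP[OF \<sigma>(1) that(2)] by (simp add: Strip_def)
  qed
  define f :: "'a \<times> 'a \<Rightarrow> int" where "f h = (if p h \<in> P then 1 else 0)" for h
  \<comment> \<open>A crossing counts only within the component \<open>B\<close>. Testing one end is
    enough: by \<open>B_cross\<close> a crossing edge has both ends in \<open>B\<close> or
    neither.\<close>
  define c where "c h k = (if h \<in> B then f k - f h else 0)" for h k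
  have crossing: "p h \<in> Strip \<and> p (h \<odot> s) \<in> Strip"
    if h: "h \<in> fibre_set" and s: "s \<in> S" and ne: "f h \<noteq> f (h \<odot> s)" for h s
  proof -
    have e: "p (h \<odot> s) = p h \<cdot> p s" using pm h Sfib[OF s] .
    have cl: "p h \<in> carrier Q" "p s \<in> carrier Q" using pQ h Sfib[OF s] by auto
    show ?thesis
    proof (cases "p h \<in> P")
      case True
      then have "p (h \<odot> s) \<notin> P" using ne by (auto simp: f_def)
      then have "inv\<^sub>Q p (h \<odot> s) \<in> P" using tot[of "p (h \<odot> s)"] e cl by auto
      from cross[OF True this e cl(2)] show ?thesis using step1[OF s] by (simp add: p_def)
    next
      case False
      then have "inv\<^sub>Q p h \<in> P" "p (h \<odot> s) \<in> P" using ne tot[OF cl(1)] by (auto simp: f_def split: if_splits)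
      moreover have "p h = p (h \<odot> s) \<cdot> inv\<^sub>Q p s" using e cl by (simp add: H.m_assoc)
      ultimately show ?thesis using cross[of "p (h \<odot> s)" "p h" "inv\<^sub>Q p s"] step2[OF s] cl
        by (simp add: p_def)
    qed
  qed
  have B_cross: "h \<in> B \<longleftrightarrow> h \<odot> s \<in> B"
    if "h \<in> fibre_set" "s \<in> S" "f h \<noteq> f (h \<odot> s)" for h s
    using adj crossing that by blast
  have "c h (h \<odot> s) + c (h \<odot> s) (h \<odot> s \<odot> s') = c h (h \<odot> s \<odot> s')"
    if h: "h \<in> carrier fibre_group" and s: "s \<in> S" "s' \<in> S" "s \<odot> s' \<in> S" for h s s'
  proof -
    have hf: "h \<in> fibre_set" using h by (simp add: fibre_group_simps(1))
    have e: "h \<odot> s \<odot> s' = h \<odot> (s \<odot> s')"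
      using h s S(2) by (intro F.m_assoc) auto
    \<comment> \<open>If \<open>f\<close> is constant on the triangle, all terms vanish. Otherwise
      two of its three edges cross the wall and preserve membership in \<open>B\<close>, so all
      three corners agree in it.\<close>
    have BB: "h \<in> B \<longleftrightarrow> h \<odot> s \<in> B" if "\<not> (f h = f (h \<odot> s) \<and> f h = f (h \<odot> s \<odot> s'))"
    proof (cases "f h = f (h \<odot> s)")
      case True
      then have "f h \<noteq> f (h \<odot> (s \<odot> s'))" "f (h \<odot> s) \<noteq> f (h \<odot> s \<odot> s')"
        using that e by auto
      then show ?thesis
        using B_cross[OF hf s(3)] B_cross[OF mc[OF hf Sfib[OF s(1)]] s(2)] e by simp
    next
      case False
      then show ?thesis using B_cross[OF hf s(1)] by simp
    qed
    show ?thesis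
    proof (cases "f h = f (h \<odot> s) \<and> f h = f (h \<odot> s \<odot> s')")
      case True
      then show ?thesis by (simp add: c_def)
    next
      case False
      then show ?thesis using BB by (simp add: c_def)
    qed
  qed
  from exact[of c, OF this] obtain F
    where F: "\<And>h s. h \<in> fibre_set \<Longrightarrow> s \<in> S0 \<Longrightarrow> c h (h \<odot> s) = F (h \<odot> s) - F h"
    unfolding fibre_group_simps(1) by blast
  have pos_edge: "F (h \<odot> s) = F h"
    if "h \<in> fibre_set" "s \<in> S0" "p h \<in> P" "p (h \<odot> s) \<in> P" for h s
    using F[OF that(1,2)] that(3,4) by (simp add: c_def f_def split: if_splits)
  \<comment> \<open>\<open>F\<close> does not change along steps inside \<open>P\<close>. Between
    negative elements it may still change, because those that are also positive carry
    \<open>f = 1\<close>; subtracting \<open>f\<close> on \<open>B\<close> removes this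
    jump.\<close>
  define D where "D h = F h - (if h \<in> B then f h else 0)" for h
  have neg_edge: "D (h \<odot> s) = D h"
    if h: "h \<in> fibre_set" "s \<in> S0" and neg: "inv\<^sub>Q p h \<in> P" "inv\<^sub>Q p (h \<odot> s) \<in> P" for h s
  proof (cases "f h = 0 \<and> f (h \<odot> s) = 0")
    case True
    then show ?thesis using F[OF h] by (simp add: D_def c_def split: if_splits)
  next
    case False
    have sS: "s \<in> S" using h S(3) by auto
    have "h \<in> B \<longleftrightarrow> h \<odot> s \<in> B"
    proof (cases "f h = f (h \<odot> s)")
      case True
      then have "p h \<in> P" "p (h \<odot> s) \<in> P" using False by (auto simp: f_def split: if_splits)
      then show ?thesis using zero neg adj[OF h(1) sS] by blast
    next
      case False then show ?thesis by (rule B_cross[OF h(1) sS])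
    qed
    then show ?thesis using F[OF h] by (simp add: D_def c_def split: if_splits)
  qed
  let ?neg = "{x \<in> carrier Q. inv\<^sub>Q x \<in> P}"
  have neg1: "\<one>\<^sub>Q \<in> ?neg" using P1 by simp
  \<comment> \<open>The path is followed in the first coordinate, where it has negative height;
    inverse letters in the second coordinate keep the pair in the fibre product.\<close>
  have lift_neg: "\<exists>v'. (v, v') \<in> fibre_set \<and> (\<forall>h\<in>fibre_set. p h = \<one>\<^sub>Q \<longrightarrow> D (h \<odot> (v, v')) = D h)"
    if "v \<in> paths G q T ?neg" for v
    using that
  proof (induction rule: paths.induct)
    case one
    then show ?case by (intro exI[of _ "\<one>"]) (auto simp: in_fibre_set fibre_group_simps)
  next
    case (step v t)
    obtain v' where v': "(v, v') \<in> fibre_set" "\<And>h. h \<in> fibre_set \<Longrightarrow> p h = \<one>\<^sub>Q \<Longrightarrow> D (h \<odot> (v, v')) = D h"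
      using step.IH by blast
    have t: "t \<in> carrier G" "(t, inv t) \<in> S0" "(t, inv t) \<in> fibre_set"
      using step(2) T by (auto simp: S0_def in_fibre_set)
    have vc: "v \<in> carrier G" "v' \<in> carrier G" using v' by (auto simp: in_fibre_set)
    have e: "h \<odot> (v \<otimes> t, v' \<otimes> inv t) = h \<odot> (v, v') \<odot> (t, inv t)" if "h \<in> fibre_set" for h
      using that vc t by (simp add: fibre_group_simps in_fibre_set G.m_assoc)
    have "D (h \<odot> (v \<otimes> t, v' \<otimes> inv t)) = D h" if h: "h \<in> fibre_set" "p h = \<one>\<^sub>Q" for h
    proof -
      have "D (h \<odot> (v, v') \<odot> (t, inv t)) = D (h \<odot> (v, v'))"
      proof (rule neg_edge[OF mc[OF h(1) v'(1)] t(2)])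
        have pv: "p (h \<odot> (v, v')) = q v" using h v'(1) pm[OF h(1) v'(1)] vc by (simp add: p_def)
        then show "inv\<^sub>Q p (h \<odot> (v, v')) \<in> P" using paths_image[OF step(1) neg1] by simp
        have "p (h \<odot> (v, v') \<odot> (t, inv t)) = q (v \<otimes> t)"
          using pm[OF mc[OF h(1) v'(1)] t(3)] pv vc t by (simp add: p_def)
        then show "inv\<^sub>Q p (h \<odot> (v, v') \<odot> (t, inv t)) \<in> P" using step(3) by simp
      qed
      then show ?thesis using e[OF h(1)] v'(2)[OF h] by simp
    qed
    moreover have "(v \<otimes> t, v' \<otimes> inv t) \<in> fibre_set"
      using mc[OF v'(1) t(3)] by (simp add: fibre_group_simps)
    ultimately show ?case by blast
  qed
  \<comment> \<open>Followed in the second coordinate, the same path has the inverse height and runs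
    over \<open>P\<close>.\<close>
  have lift_pos: "\<exists>v'. (v', v) \<in> fibre_set \<and> (\<forall>h\<in>fibre_set. p h = \<one>\<^sub>Q \<longrightarrow> F (h \<odot> (v', v)) = F h)"
    if "v \<in> paths G q T ?neg" for v
    using that
  proof (induction rule: paths.induct)
    case one
    then show ?case by (intro exI[of _ "\<one>"]) (auto simp: in_fibre_set fibre_group_simps)
  next
    case (step v t)
    obtain v' where v': "(v', v) \<in> fibre_set" "\<And>h. h \<in> fibre_set \<Longrightarrow> p h = \<one>\<^sub>Q \<Longrightarrow> F (h \<odot> (v', v)) = F h"
      using step.IH by blast
    have t: "t \<in> carrier G" "(inv t, t) \<in> S0" "(inv t, t) \<in> fibre_set"
      using step(2) T by (auto simp: S0_def in_fibre_set)
    have vc: "v \<in> carrier G" "v' \<in> carrier G" "q v' = inv\<^sub>Q q v" using v' by (auto simp: in_fibre_set)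
    have e: "h \<odot> (v' \<otimes> inv t, v \<otimes> t) = h \<odot> (v', v) \<odot> (inv t, t)" if "h \<in> fibre_set" for h
      using that vc t by (simp add: fibre_group_simps in_fibre_set G.m_assoc)
    have "F (h \<odot> (v' \<otimes> inv t, v \<otimes> t)) = F h" if h: "h \<in> fibre_set" "p h = \<one>\<^sub>Q" for h
    proof -
      have "F (h \<odot> (v', v) \<odot> (inv t, t)) = F (h \<odot> (v', v))"
      proof (rule pos_edge[OF mc[OF h(1) v'(1)] t(2)])
        have pv: "p (h \<odot> (v', v)) = inv\<^sub>Q q v" using h v'(1) pm[OF h(1) v'(1)] vc by (simp add: p_def)
        then show "p (h \<odot> (v', v)) \<in> P" using paths_image[OF step(1) neg1] by simp
        have "p (h \<odot> (v', v) \<odot> (inv t, t)) = inv\<^sub>Q q (v \<otimes> t)"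
          using pm[OF mc[OF h(1) v'(1)] t(3)] pv vc t hom_closed by (simp add: p_def H.inv_mult_group Q.m_comm)
        then show "p (h \<odot> (v', v) \<odot> (inv t, t)) \<in> P" using step(3) by simp
      qed
      then show ?thesis using e[OF h(1)] v'(2)[OF h] by simp
    qed
    moreover have "(v' \<otimes> inv t, v \<otimes> t) \<in> fibre_set"
      using mc[OF v'(1) t(3)] by (simp add: fibre_group_simps)
    ultimately show ?case by blast
  qed
  \<comment> \<open>The strip is symmetric under inversion, so walking inside \<open>B\<close>
    projects to paths over the strip in both coordinates.\<close>
  have Bpaths: "fst h \<in> paths G q SG Strip \<and> snd h \<in> paths G q SG Strip" if "h \<in> B" for h
    using that unfolding B_def
  proof (induction rule: paths.induct)
    case one
    then show ?case by (simp add: fibre_group_simps paths.one)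
  next
    case (step h s)
    have hf: "h \<in> fibre_set" using step(1) Bfib by (simp add: B_def)
    have hs: "h \<odot> s \<in> fibre_set" by (rule mc[OF hf Sfib[OF step(2)]])
    have "q (snd (h \<odot> s)) = inv\<^sub>Q p (h \<odot> s)" using hs by (simp add: in_fibre_set p_def)
    then have "q (snd (h \<odot> s)) \<in> Strip" using step(3) by (simp add: Strip_def)
    moreover have "fst s \<in> SG" "snd s \<in> SG" using step(2) by (auto simp: SG_def)
    ultimately show ?case using step
      by (auto simp: fibre_group_simps p_def intro!: paths.step)
  qed
  have main: "v \<otimes> y \<otimes> inv v \<in> paths G q SG Strip" if v: "v \<in> paths G q T ?neg" and y: "y \<in> Y" for v y
  proof -
    define x where "x = v \<otimes> y \<otimes> inv v"
    have vc: "v \<in> carrier G" by (rule G.paths_closed[OF v T(2)])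
    have yc: "y \<in> carrier G" "q y = \<one>\<^sub>Q" using y YG by auto
    have x: "x \<in> carrier G" "q x = \<one>\<^sub>Q" using vc yc by (auto simp: x_def)
    have xv: "x \<otimes> v = v \<otimes> y" using vc yc by (simp add: x_def G.m_assoc)
    have ab: "(x, \<one>) \<in> fibre_set" "(\<one>, x) \<in> fibre_set" using x by (auto simp: in_fibre_set)
    have pv: "inv\<^sub>Q q v \<in> P" using paths_image[OF v neg1] by simp
    \<comment> \<open>The conjugate \<open>x\<close> is followed along \<open>v\<close>,
      \<open>y\<close> and back. The way back is replaced by a second lift of \<open>v\<close> that
      starts at \<open>h \<odot> (x, \<one>)\<close> and ends where the step \<open>y\<close>
      leads.\<close>
    have loop_neg: "D (h \<odot> (x, \<one>)) = D h" if h: "h \<in> fibre_set" "p h = \<one>\<^sub>Q" for h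
    proof -
      obtain v' where v': "(v, v') \<in> fibre_set" "\<And>h. h \<in> fibre_set \<Longrightarrow> p h = \<one>\<^sub>Q \<Longrightarrow> D (h \<odot> (v, v')) = D h"
        using lift_neg[OF v] by blast
      have s: "(y, \<one>) \<in> S0" "(y, \<one>) \<in> fibre_set" using y yc by (auto simp: S0_def in_fibre_set)
      have hv: "h \<odot> (v, v') \<in> fibre_set" by (rule mc[OF h(1) v'(1)])
      have ph: "p (h \<odot> (v, v')) = q v" "p (h \<odot> (v, v') \<odot> (y, \<one>)) = q v"
        using pm[OF hv s(2)] pm[OF h(1) v'(1)] h vc yc by (simp_all add: p_def)
      have hx: "h \<odot> (x, \<one>) \<in> fibre_set" "p (h \<odot> (x, \<one>)) = \<one>\<^sub>Q"
        using mc[OF h(1) ab(1)] pm[OF h(1) ab(1)] h x by (simp_all add: p_def)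
      have e: "h \<odot> (x, \<one>) \<odot> (v, v') = h \<odot> (v, v') \<odot> (y, \<one>)"
        using h v'(1) x vc yc xv by (simp add: fibre_group_simps in_fibre_set G.m_assoc)
      have "D (h \<odot> (x, \<one>)) = D (h \<odot> (x, \<one>) \<odot> (v, v'))"
        using v'(2)[OF hx] by simp
      also have "\<dots> = D (h \<odot> (v, v'))"
        unfolding e by (rule neg_edge[OF hv s(1)]) (use ph pv in simp_all)
      also have "\<dots> = D h" by (rule v'(2)[OF h])
      finally show ?thesis .
    qed
    have loop_pos: "F (h \<odot> (\<one>, x)) = F h" if h: "h \<in> fibre_set" "p h = \<one>\<^sub>Q" for h
    proof -
      obtain v' where v': "(v', v) \<in> fibre_set" "\<And>h. h \<in> fibre_set \<Longrightarrow> p h = \<one>\<^sub>Q \<Longrightarrow> F (h \<odot> (v', v)) = F h"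
        using lift_pos[OF v] by blast
      have v'q: "q v' = inv\<^sub>Q q v" "v' \<in> carrier G" using v'(1) by (auto simp: in_fibre_set)
      have s: "(\<one>, y) \<in> S0" "(\<one>, y) \<in> fibre_set" using y yc by (auto simp: S0_def in_fibre_set)
      have hv: "h \<odot> (v', v) \<in> fibre_set" by (rule mc[OF h(1) v'(1)])
      have ph: "p (h \<odot> (v', v)) = inv\<^sub>Q q v" "p (h \<odot> (v', v) \<odot> (\<one>, y)) = inv\<^sub>Q q v"
        using pm[OF hv s(2)] pm[OF h(1) v'(1)] h vc yc v'q by (simp_all add: p_def)
      have hx: "h \<odot> (\<one>, x) \<in> fibre_set" "p (h \<odot> (\<one>, x)) = \<one>\<^sub>Q"
        using mc[OF h(1) ab(2)] pm[OF h(1) ab(2)] h x by (simp_all add: p_def)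
      have e: "h \<odot> (\<one>, x) \<odot> (v', v) = h \<odot> (v', v) \<odot> (\<one>, y)"
        using h v'(1) x vc yc xv by (simp add: fibre_group_simps in_fibre_set G.m_assoc)
      have "F (h \<odot> (\<one>, x)) = F (h \<odot> (\<one>, x) \<odot> (v', v))"
        using v'(2)[OF hx] by simp
      also have "\<dots> = F (h \<odot> (v', v))"
        unfolding e by (rule pos_edge[OF hv s(1)]) (use ph pv in simp_all)
      also have "\<dots> = F h" by (rule v'(2)[OF h])
      finally show ?thesis .
    qed
    \<comment> \<open>The square with corners \<open>(1, 1)\<close>, \<open>(x, 1)\<close>,
      \<open>(x, x)\<close>, \<open>(1, x)\<close> closes because the two elements commute. Its left
      edges preserve \<open>D\<close>, its right edges \<open>F\<close>. With the second and fourth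
      corner outside \<open>B\<close>, leaving \<open>(1, 1)\<close> lowers \<open>F\<close> by one,
      and at \<open>(x, x)\<close> the difference between \<open>F\<close> and \<open>D\<close> has
      the wrong sign to make up for it.\<close>
    have "(x, \<one>) \<in> B \<or> (\<one>, x) \<in> B"
    proof (rule ccontr)
      assume n: "\<not> ((x, \<one>) \<in> B \<or> (\<one>, x) \<in> B)"
      have one: "(\<one>, \<one>) \<in> fibre_set" "p (\<one>, \<one>) = \<one>\<^sub>Q" "(\<one>, \<one>) \<in> B"
        using B1 by (auto simp: in_fibre_set p_def fibre_group_simps)
      have pab: "p (x, \<one>) = \<one>\<^sub>Q" "p (\<one>, x) = \<one>\<^sub>Q" using x by (auto simp: p_def)
      have "D (x, \<one>) = D (\<one>, \<one>)" using loop_neg[OF one(1,2)] x by (simp add: fibre_group_simps)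
      moreover have "f (\<one>, \<one>) = 1" using one(2) P1 by (simp add: f_def)
      ultimately have "F (x, \<one>) = F (\<one>, \<one>) - 1" using n one(3) by (simp add: D_def)
      moreover have "F (x, x) = F (x, \<one>)" using loop_pos[OF ab(1) pab(1)] x by (simp add: fibre_group_simps)
      moreover have "F (\<one>, x) = F (\<one>, \<one>)" using loop_pos[OF one(1,2)] x by (simp add: fibre_group_simps)
      moreover have "D (x, x) = D (\<one>, x)" using loop_neg[OF ab(2) pab(2)] x by (simp add: fibre_group_simps)
      moreover have "D (\<one>, x) = F (\<one>, x)" using n by (simp add: D_def)
      moreover have "D (x, x) \<le> F (x, x)" by (simp add: D_def f_def)
      ultimately show False by simp
    qed
    then show ?thesis using Bpaths unfolding x_def by fastforce
  qed
  show ?thesis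
    by (rule that[OF SG TSG \<sigma>(1)]) (use main in \<open>simp add: Strip_def\<close>)
qed

end

section \<open>Commuting generators\<close>

lemma (in group) generate_commute:
  assumes A: "A \<subseteq> carrier G" and x: "x \<in> carrier G" and c: "\<And>a. a \<in> A \<Longrightarrow> a \<otimes> x = x \<otimes> a"
    and g: "g \<in> generate G A"
  shows "g \<otimes> x = x \<otimes> g"
  using g
proof (induction rule: generate.induct)
  case (inv a)
  then have a: "a \<in> carrier G" using A by auto
  have "inv a \<otimes> (a \<otimes> x) \<otimes> inv a = inv a \<otimes> (x \<otimes> a) \<otimes> inv a" using c[OF inv] by simp
  then show ?case using a x by (simp add: m_assoc)
next
  case (eng g h)
  have gh: "g \<in> carrier G" "h \<in> carrier G" using eng generate_in_carrier[OF A] by auto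
  have "g \<otimes> h \<otimes> x = g \<otimes> (x \<otimes> h)" using gh x eng by (simp add: m_assoc)
  also have "\<dots> = x \<otimes> (g \<otimes> h)" using gh x eng by (simp add: m_assoc[symmetric])
  finally show ?case .
qed (use x c in auto)

lemma (in group) generate_comm_group:
  assumes A: "A \<subseteq> carrier G" "generate G A = carrier G"
    and c: "\<And>a b. a \<in> A \<Longrightarrow> b \<in> A \<Longrightarrow> a \<otimes> b = b \<otimes> a"
  shows "comm_group G"
proof (rule group_comm_groupI)
  fix x y assume xy: "x \<in> carrier G" "y \<in> carrier G"
  have "b \<otimes> y = y \<otimes> b" if "b \<in> A" for b
    using generate_commute[OF A(1), of b y] c that A xy by force
  then show "x \<otimes> y = y \<otimes> x" using generate_commute[OF A(1) xy(2)] A xy by auto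
qed

section \<open>From the strip to the positive cone\<close>

context abelian_image
begin

text \<open>\<open>K\<close> collects the \<open>n\<close> whose conjugates along all sufficiently
  deep negative paths are reached inside the strip, with a depth depending on \<open>n\<close>.
  Depths for two elements have a common lower bound, so \<open>K\<close> passes the induction of
  \<open>conj_gen\<close>. A path to \<open>n\<close> then climbs along \<open>inv v\<close> for a
  deep \<open>v\<close>, so high that the shifted strip lies over \<open>P\<close>, runs there to
  \<open>n \<otimes> inv v\<close>, and descends along \<open>v\<close>.\<close>

lemma total_fg_over:
  assumes fp: "finitely_presented fibre_group" and P: "submon P"
    and tot: "\<And>a. a \<in> carrier Q \<Longrightarrow> a \<in> P \<or> inv\<^sub>Q a \<in> P"
    and TY: "conj_gen T Y" "finite T" "finite Y" and gen: "generate G T = carrier G"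
  shows "fg_over P"
proof -
  have T: "T \<subseteq> carrier G" "\<And>t. t \<in> T \<Longrightarrow> inv t \<in> T" and Y: "Y \<subseteq> N"
    using TY(1) by (auto simp: conj_gen_def)
  have PQ: "P \<subseteq> carrier Q" and P1: "\<one>\<^sub>Q \<in> P" and PP: "\<And>x y. x \<in> P \<Longrightarrow> y \<in> P \<Longrightarrow> x \<cdot> y \<in> P"
    using P by (auto simp: submon_def)
  define M where "M = {x \<in> carrier Q. inv\<^sub>Q x \<in> P}"
  have M1: "\<one>\<^sub>Q \<in> M" using P1 by (simp add: M_def)
  have MM: "x \<cdot> y \<in> M" if "x \<in> M" "y \<in> M" for x y
    using that PP by (auto simp: M_def H.inv_mult_group)
  obtain S \<sigma> where S: "finite S" "S \<subseteq> carrier G" "T \<subseteq> S" and \<sigma>: "\<sigma> \<in> P"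
    and Ypath: "\<And>v y. \<lbrakk>v \<in> paths G q T M; y \<in> Y\<rbrakk> \<Longrightarrow> v \<otimes> y \<otimes> inv v
      \<in> paths G q S {x \<in> carrier Q. \<sigma> \<cdot> x \<in> P \<and> \<sigma> \<cdot> inv\<^sub>Q x \<in> P}"
    by (rule crossing_count[OF fp P tot TY(2) T TY(3) Y, folded M_def]) (assumption | rule that)+
  have \<sigma>Q: "\<sigma> \<in> carrier Q" using \<sigma> PQ by auto
  define Strip where "Strip = {x \<in> carrier Q. \<sigma> \<cdot> x \<in> P \<and> \<sigma> \<cdot> inv\<^sub>Q x \<in> P}"
  note Ypath = Ypath[folded Strip_def]
  define K where "K = {n \<in> carrier G. \<exists>x\<in>carrier Q. \<forall>v\<in>paths G q T M.
    x \<cdot> inv\<^sub>Q q v \<in> P \<longrightarrow> v \<otimes> n \<otimes> inv v \<in> paths G q S Strip}"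
  have vG: "v \<in> carrier G" if "v \<in> paths G q T M" for v by (rule G.paths_closed[OF that T(1)])
  have "N \<subseteq> K"
  proof (rule conj_gen_induct[OF TY(1)])
    have "v \<otimes> \<one> \<otimes> inv v \<in> paths G q S Strip" if "v \<in> paths G q T M" for v
      using vG[OF that] paths.one[of G] by simp
    then show "\<one> \<in> K" by (auto simp: K_def)
    show "Y \<subseteq> K" using Y Ypath by (auto simp: K_def in_N)
  next
    fix a b assume ab: "a \<in> K \<inter> N" "b \<in> K \<inter> N"
    then have c: "a \<in> carrier G" "b \<in> carrier G" by (auto simp: in_N)
    obtain x y where x: "x \<in> carrier Q" "\<And>v. v \<in> paths G q T M \<Longrightarrow> x \<cdot> inv\<^sub>Q q v \<in> P \<Longrightarrow>
        v \<otimes> a \<otimes> inv v \<in> paths G q S Strip"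
      and y: "y \<in> carrier Q" "\<And>v. v \<in> paths G q T M \<Longrightarrow> y \<cdot> inv\<^sub>Q q v \<in> P \<Longrightarrow>
        v \<otimes> b \<otimes> inv v \<in> paths G q S Strip"
      using ab unfolding K_def by blast
    obtain z where z: "z \<in> carrier Q" "\<And>w. w \<in> carrier Q \<Longrightarrow> z \<cdot> w \<in> P \<Longrightarrow> x \<cdot> w \<in> P \<and> y \<cdot> w \<in> P"
      using total_lower_bound[OF P tot x(1) y(1)] by blast
    have "v \<otimes> (a \<otimes> b) \<otimes> inv v \<in> paths G q S Strip"
      if v: "v \<in> paths G q T M" "z \<cdot> inv\<^sub>Q q v \<in> P" for v
    proof -
      have vc: "v \<in> carrier G" by (rule vG[OF v(1)])
      have w: "x \<cdot> inv\<^sub>Q q v \<in> P" "y \<cdot> inv\<^sub>Q q v \<in> P" using z(2)[OF _ v(2)] vc by auto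
      have "q (v \<otimes> a \<otimes> inv v) = \<one>\<^sub>Q" using ab vc by (simp add: in_N)
      then have "(v \<otimes> a \<otimes> inv v) \<otimes> (v \<otimes> b \<otimes> inv v) \<in> paths G q S Strip"
        by (intro paths_append[OF y(2)[OF v(1) w(2)] x(2)[OF v(1) w(1)] S(2)]) (simp add: Strip_def)
      moreover have "(v \<otimes> a \<otimes> inv v) \<otimes> (v \<otimes> b \<otimes> inv v) = v \<otimes> (a \<otimes> b) \<otimes> inv v"
        using c vc by (simp add: G.m_assoc)
      ultimately show ?thesis by simp
    qed
    then show "a \<otimes> b \<in> K" using c z(1) unfolding K_def by blast
  next
    fix a t assume a: "a \<in> K \<inter> N" and t: "t \<in> T"
    then have c: "a \<in> carrier G" "t \<in> carrier G" using T by (auto simp: in_N)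
    obtain x where x: "x \<in> carrier Q" "\<And>v. v \<in> paths G q T M \<Longrightarrow> x \<cdot> inv\<^sub>Q q v \<in> P \<Longrightarrow>
        v \<otimes> a \<otimes> inv v \<in> paths G q S Strip"
      using a unfolding K_def by blast
    \<comment> \<open>Conjugation by \<open>t\<close> lengthens the path \<open>v\<close> by
      \<open>inv t\<close>. The longer path must remain negative and remain deep enough for
      \<open>x\<close>, hence the two bounds.\<close>
    obtain z where z: "z \<in> carrier Q" "\<And>w. w \<in> carrier Q \<Longrightarrow> z \<cdot> w \<in> P \<Longrightarrow>
        q t \<cdot> w \<in> P \<and> x \<cdot> q t \<cdot> w \<in> P"
      using total_lower_bound[OF P tot, of "q t" "x \<cdot> q t"] x(1) c by auto
    have "v \<otimes> (inv t \<otimes> a \<otimes> t) \<otimes> inv v \<in> paths G q S Strip"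
      if v: "v \<in> paths G q T M" "z \<cdot> inv\<^sub>Q q v \<in> P" for v
    proof -
      have vc: "v \<in> carrier G" by (rule vG[OF v(1)])
      have w: "q t \<cdot> inv\<^sub>Q q v \<in> P" "x \<cdot> q t \<cdot> inv\<^sub>Q q v \<in> P" using z(2)[OF _ v(2)] vc by auto
      have qi: "inv\<^sub>Q q (v \<otimes> inv t) = q t \<cdot> inv\<^sub>Q q v" using c vc by (simp add: H.inv_mult_group)
      have "v \<otimes> inv t \<in> paths G q T M"
        by (rule paths.step[OF v(1) T(2)[OF t]]) (use w(1) qi c vc in \<open>simp add: M_def\<close>)
      from x(2)[OF this] have "v \<otimes> inv t \<otimes> a \<otimes> inv (v \<otimes> inv t) \<in> paths G q S Strip"
        unfolding qi using w(2) c vc x(1) by (simp add: H.m_assoc)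
      then show ?thesis using c vc by (simp add: G.m_assoc G.inv_mult_group)
    qed
    then show "inv t \<otimes> a \<otimes> t \<in> K" using c z(1) unfolding K_def by blast
  qed
  \<comment> \<open>Only descending letters, so that heights are monotone along the path;
    \<open>up\<close> and \<open>down\<close> rest on this.\<close>
  define T' where "T' = {t \<in> T. q t \<in> M}"
  have T': "T' \<subseteq> carrier G" "T' \<subseteq> T" using T by (auto simp: T'_def)
  \<comment> \<open>Letters over \<open>P\<close> are dropped from a word for \<open>x\<close> and
    the others kept; the end of the resulting path is at most as high as \<open>x\<close>.\<close>
  have far: "\<exists>v\<in>paths G q T' M. q x \<cdot> inv\<^sub>Q q v \<in> P" if "x \<in> generate G T" for x
  proof -
    have single: "\<exists>v\<in>paths G q T' M. q t \<cdot> inv\<^sub>Q q v \<in> P" if t: "t \<in> T" for t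
    proof (cases "q t \<in> P")
      case True
      then show ?thesis using paths.one[of G q T' M] t T by (intro bexI[of _ "\<one>"]) auto
    next
      case False
      have tc: "t \<in> carrier G" using t T by auto
      have "t \<in> T'" using False tot[of "q t"] t tc by (auto simp: T'_def M_def)
      then have "\<one> \<otimes> t \<in> paths G q T' M"
        by (intro paths.step paths.one) (use tc in \<open>simp_all add: T'_def\<close>)
      then show ?thesis using tc P1 by (intro bexI[of _ t]) auto
    qed
    show ?thesis using that
    proof (induction rule: generate.induct)
      case one
      then show ?case using paths.one[of G q T' M] P1 by (intro bexI[of _ "\<one>"]) auto
    next
      case (incl t) then show ?case by (rule single)
    next
      case (inv t) then show ?case by (intro single T(2))
    next
      case (eng x y)
      obtain v w where v: "v \<in> paths G q T' M" "q x \<cdot> inv\<^sub>Q q v \<in> P"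
        and w: "w \<in> paths G q T' M" "q y \<cdot> inv\<^sub>Q q w \<in> P" using eng.IH by blast
      have c: "x \<in> carrier G" "y \<in> carrier G" "v \<in> carrier G" "w \<in> carrier G"
        using eng gen G.paths_closed[OF _ T'(1)] v w by auto
      have "q (x \<otimes> y) \<cdot> inv\<^sub>Q q (v \<otimes> w) = (q x \<cdot> inv\<^sub>Q q v) \<cdot> (q y \<cdot> inv\<^sub>Q q w)"
        using c hom_closed by (simp add: Q.m_ac H.inv_mult_group)
      moreover have "v \<otimes> w \<in> paths G q T' M"
        using paths_image[OF v(1) M1] MM by (intro paths_append[OF w(1) v(1) T'(1)])
      ultimately show ?case using PP v(2) w(2) by (intro bexI[of _ "v \<otimes> w"]) auto
    qed
  qed
  have up: "inv v \<in> paths G q S P" if "v \<in> paths G q T' M" for v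
    using that
  proof (induction rule: paths.induct)
    case one then show ?case by (simp add: paths.one)
  next
    case (step v t)
    have c: "v \<in> carrier G" "t \<in> carrier G" using step T' G.paths_closed[OF step(1) T'(1)] by auto
    have t: "inv t \<in> S" "q (inv t) \<in> P" using step(2) T S c by (auto simp: T'_def M_def)
    have "\<one> \<otimes> inv t \<in> paths G q S P"
      by (rule paths.step[OF paths.one t(1)]) (use t c in simp)
    then have "inv t \<in> paths G q S P" using c by simp
    from paths_append[OF step.IH this S(2)] show ?case
      using c PP t(2) by (simp add: G.inv_mult_group)
  qed
  \<comment> \<open>Heights fall along \<open>v\<close>, so every intermediate point is above the
    endpoint, which lies over \<open>P\<close>.\<close>
  have down: "g \<otimes> v \<in> paths G q S P"
    if "v \<in> paths G q T' M" "g \<in> paths G q S P" "q (g \<otimes> v) \<in> P" for g v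
    using that
  proof (induction rule: paths.induct)
    case one then show ?case using G.paths_closed[OF one(1) S(2)] by simp
  next
    case (step v t)
    have c: "v \<in> carrier G" "t \<in> carrier G" "g \<in> carrier G"
      using step T' G.paths_closed[OF step(1) T'(1)] G.paths_closed[OF step.prems(1) S(2)] by auto
    have t: "t \<in> S" "inv\<^sub>Q q t \<in> P" using step(2) S by (auto simp: T'_def M_def)
    have "q (g \<otimes> v) = q (g \<otimes> (v \<otimes> t)) \<cdot> inv\<^sub>Q q t"
      using c by (simp add: H.m_assoc)
    then have "g \<otimes> v \<in> paths G q S P" using step PP t by simp
    then have "g \<otimes> v \<otimes> t \<in> paths G q S P"
      by (rule paths.step[OF _ t(1)]) (use step.prems(2) c in \<open>simp add: G.m_assoc\<close>)
    then show ?case using c by (simp add: G.m_assoc)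
  qed
  have "N \<subseteq> paths G q S P"
  proof
    fix n assume n: "n \<in> N"
    then have nc: "n \<in> carrier G" "q n = \<one>\<^sub>Q" by (auto simp: in_N)
    obtain x where x: "x \<in> carrier Q" "\<And>v. v \<in> paths G q T M \<Longrightarrow> x \<cdot> inv\<^sub>Q q v \<in> P \<Longrightarrow>
        v \<otimes> n \<otimes> inv v \<in> paths G q S Strip"
      using n \<open>N \<subseteq> K\<close> unfolding K_def by blast
    \<comment> \<open>Deep enough both for \<open>n\<close> and for the width \<sigma> of the
      strip.\<close>
    obtain z where z: "z \<in> carrier Q" "\<And>w. w \<in> carrier Q \<Longrightarrow> z \<cdot> w \<in> P \<Longrightarrow>
        x \<cdot> w \<in> P \<and> inv\<^sub>Q \<sigma> \<cdot> w \<in> P"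
      using total_lower_bound[OF P tot, of x "inv\<^sub>Q \<sigma>"] x(1) \<sigma>Q by auto
    obtain g where g: "g \<in> carrier G" "z = q g" using z(1) unfolding surj[symmetric] by (rule imageE)
    obtain v where v: "v \<in> paths G q T' M" "z \<cdot> inv\<^sub>Q q v \<in> P"
      using far[of g] g gen by blast
    have vc: "v \<in> carrier G" by (rule G.paths_closed[OF v(1) T'(1)])
    have w: "x \<cdot> inv\<^sub>Q q v \<in> P" "inv\<^sub>Q \<sigma> \<cdot> inv\<^sub>Q q v \<in> P" using z(2)[OF _ v(2)] vc by auto
    have "v \<in> paths G q T M" using paths_mono[OF v(1) T'(2)] by blast
    from x(2)[OF this w(1)] have k: "v \<otimes> n \<otimes> inv v \<in> paths G q S Strip" .
    have "inv v \<otimes> (v \<otimes> n \<otimes> inv v) \<in> paths G q S P"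
    proof (rule paths_append[OF k up[OF v(1)] S(2)])
      fix u assume u: "u \<in> Strip"
      then have uc: "u \<in> carrier Q" "\<sigma> \<cdot> u \<in> P" by (auto simp: Strip_def)
      have "q (inv v) \<cdot> u = (inv\<^sub>Q q v \<cdot> inv\<^sub>Q \<sigma>) \<cdot> (\<sigma> \<cdot> u)"
        using uc vc \<sigma>Q by (simp add: H.m_assoc)
      also have "inv\<^sub>Q q v \<cdot> inv\<^sub>Q \<sigma> = inv\<^sub>Q \<sigma> \<cdot> inv\<^sub>Q q v" using vc \<sigma>Q by (simp add: Q.m_comm)
      finally show "q (inv v) \<cdot> u \<in> P" using PP w(2) uc(2) by simp
    qed
    then have "n \<otimes> inv v \<in> paths G q S P" using vc nc by (simp add: G.m_assoc)
    from down[OF v(1) this] show "n \<in> paths G q S P" using vc nc P1 by (simp add: G.m_assoc)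
  qed
  then show ?thesis using S by (auto simp: fg_over_def)
qed

text \<open>Dividing by \<open>Y\<close> makes \<open>G\<close> abelian, because \<open>Y\<close>
  contains the commutators of letters. The fibre product over this new quotient contains the
  generators of the old one, because \<open>Y\<close> contains the products of their coordinates. So
  it contains all pairs \<open>(n, \<one>)\<close> with \<open>n\<close> in \<open>N\<close>, which
  puts \<open>N\<close> into the normal closure of \<open>Y\<close>.\<close>

lemma ex_conj_gen:
  assumes fp: "finitely_presented fibre_group" and X: "finite X" "X \<subseteq> carrier G" "generate G X = carrier G"
  shows "\<exists>T Y. conj_gen T Y \<and> finite T \<and> finite Y \<and> generate G T = carrier G"
proof -
  interpret F: group fibre_group by (rule group_fibre_group)
  interpret GG: group "G \<times>\<times> G" using DirProd_group G.group_axioms by blast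
  obtain X' :: "nat set" and f R where X': "finite X'" "presentation fibre_group X' f R"
    using finitely_presented_presentation[OF fp] by blast
  define SH where "SH = f ` X'"
  have SH: "finite SH" "SH \<subseteq> fibre_set" "generate fibre_group SH = fibre_set"
    using X'(1) presentationD(1)[OF X'(2)] F.presentation_generators[OF X'(2)]
    by (auto simp: SH_def fibre_group_simps)
  define T where "T = X \<union> (\<lambda>x. inv x) ` X"
  have T: "finite T" "T \<subseteq> carrier G" "\<And>t. t \<in> T \<Longrightarrow> inv t \<in> T" using X by (auto simp: T_def)
  have genT: "generate G T = carrier G"
    using G.mono_generate[of X T] X(3) G.generate_incl[OF T(2)] by (auto simp: T_def)
  define Y where "Y = (\<lambda>s. fst s \<otimes> snd s) ` SH
    \<union> (\<lambda>(s, t). s \<otimes> t \<otimes> inv (t \<otimes> s)) ` (T \<times> T)"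
  have YN: "Y \<subseteq> N"
  proof -
    have "fst s \<otimes> snd s \<in> N" if "s \<in> SH" for s
      using that SH(2) by (auto simp: in_N in_fibre_set)
    moreover have "s \<otimes> t \<otimes> inv (t \<otimes> s) \<in> N" if "s \<in> T" "t \<in> T" for s t
    proof -
      have c: "s \<in> carrier G" "t \<in> carrier G" using that T by auto
      then have "q (s \<otimes> t) = q (t \<otimes> s)" by (simp add: Q.m_comm)
      then show ?thesis using c by (simp add: in_N del: hom_mult) (simp add: c)
    qed
    ultimately show ?thesis by (auto simp: Y_def)
  qed
  have Y: "finite Y" "Y \<subseteq> carrier G" using SH T YN by (auto simp: Y_def in_N)
  let ?N = "normal_closure G Y"
  let ?q = "\<lambda>g. ?N #>\<^bsub>G\<^esub> g"
  have nN: "?N \<lhd> G" by (rule G.normal_closure_normal[OF Y(2)])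
  note qq = normal_Mod_hom[OF nN]
  interpret q: group_hom G "G Mod ?N" ?q
    by (simp add: group_hom_def group_hom_axioms_def qq G.group_axioms)
  have kerY: "?q y = \<one>\<^bsub>G Mod ?N\<^esub>" if "y \<in> Y" for y
    using that G.normal_closure_incl[OF Y(2)] qq(4) by (auto simp: kernel_def)
  have "comm_group (G Mod ?N)"
  proof (rule group.generate_comm_group[OF qq(1)])
    show "?q ` T \<subseteq> carrier (G Mod ?N)" using T q.hom_closed by auto
    show "generate (G Mod ?N) (?q ` T) = carrier (G Mod ?N)"
      using q.generate_img[OF T(2)] genT qq(3) by simp
    fix a b assume ab: "a \<in> ?q ` T" "b \<in> ?q ` T"
    obtain s where s: "s \<in> T" "a = ?q s" using ab(1) by (rule imageE)
    obtain t where t: "t \<in> T" "b = ?q t" using ab(2) by (rule imageE)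
    have c: "s \<in> carrier G" "t \<in> carrier G" using s t T by auto
    have "s \<otimes> t \<otimes> inv (t \<otimes> s) \<in> Y" using s t by (force simp: Y_def)
    from kerY[OF this] have "?q (s \<otimes> t) \<otimes>\<^bsub>G Mod ?N\<^esub> inv\<^bsub>G Mod ?N\<^esub> ?q (t \<otimes> s) = \<one>\<^bsub>G Mod ?N\<^esub>"
      using c by (simp only: q.hom_mult q.hom_inv G.inv_closed G.m_closed)
    then have "?q (s \<otimes> t) = ?q (t \<otimes> s)"
      using c q.hom_closed q.H.inv_equality[of "?q (s \<otimes> t)" "inv\<^bsub>G Mod ?N\<^esub> ?q (t \<otimes> s)"]
      by (metis G.m_closed q.H.inv_closed q.H.inv_inv)
    then show "a \<otimes>\<^bsub>G Mod ?N\<^esub> b = b \<otimes>\<^bsub>G Mod ?N\<^esub> a" using s t c by (simp only: q.hom_mult)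
  qed
  then interpret A: abelian_image G "G Mod ?N" ?q
    by (intro abelian_image.intro abelian_image_axioms.intro q.group_hom_axioms qq(3))
  have "SH \<subseteq> A.fibre_set"
  proof
    fix s assume s: "s \<in> SH"
    then have c: "fst s \<in> carrier G" "snd s \<in> carrier G" using SH(2) by (auto simp: in_fibre_set)
    have "fst s \<otimes> snd s \<in> Y" using s by (simp add: Y_def)
    from kerY[OF this] show "s \<in> A.fibre_set" using c by (simp add: A.fibre_set_def case_prod_unfold)
  qed
  then have "generate (G \<times>\<times> G) SH \<subseteq> A.fibre_set"
    by (rule GG.generate_subgroup_incl[OF _ A.subgroup_fibre_set])
  moreover have "generate (G \<times>\<times> G) SH = fibre_set"
    using GG.generate_consistent[OF SH(2) subgroup_fibre_set] SH(3) by (simp add: fibre_group_def)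
  ultimately have fibre_set: "fibre_set \<subseteq> A.fibre_set" by simp
  have N: "N \<subseteq> ?N"
  proof
    fix n assume "n \<in> N"
    then have n: "n \<in> carrier G" "(n, \<one>) \<in> fibre_set" by (auto simp: in_N in_fibre_set)
    then have "(n, \<one>) \<in> A.fibre_set" using fibre_set by blast
    then have e: "?q n \<otimes>\<^bsub>G Mod ?N\<^esub> ?q \<one> = \<one>\<^bsub>G Mod ?N\<^esub>" unfolding A.fibre_set_def by blast
    have "?q n = \<one>\<^bsub>G Mod ?N\<^esub>"
      using e q.H.r_one[OF q.hom_closed[OF n(1)]] unfolding q.hom_one by (rule box_equals[OF _ _ HOL.refl])
    then have "n \<in> kernel G (G Mod ?N) ?q" using n(1) unfolding kernel_def by blast
    then show "n \<in> ?N" unfolding qq(4) .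
  qed
  \<comment> \<open>The inverses of \<open>Y\<close> are listed explicitly, since
    \<open>conj_gen\<close> provides no inversion.\<close>
  have "conj_gen T (Y \<union> (\<lambda>y. inv y) ` Y)"
    unfolding conj_gen_def
  proof (intro conjI allI impI ballI)
    show "T \<subseteq> carrier G" by (rule T)
    show "inv t \<in> T" if "t \<in> T" for t using T(3)[OF that] .
    show "Y \<union> (\<lambda>y. inv y) ` Y \<subseteq> N" using YN by (auto simp: in_N)
    fix K assume K: "\<one> \<in> K \<and> Y \<union> (\<lambda>y. inv y) ` Y \<subseteq> K \<and> (\<forall>a\<in>K \<inter> N. \<forall>b\<in>K \<inter> N. a \<otimes> b \<in> K)
      \<and> (\<forall>a\<in>K \<inter> N. \<forall>t\<in>T. inv t \<otimes> a \<otimes> t \<in> K)"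
    have Kt: "inv t \<otimes> a \<otimes> t \<in> K \<inter> N" if "a \<in> K \<inter> N" "t \<in> T" for a t
      using K that T(2) by (auto simp: in_N)
    have conj: "\<forall>a\<in>K \<inter> N. g \<otimes> a \<otimes> inv g \<in> K \<inter> N" if "g \<in> generate G T" for g
      using that
    proof (induction rule: generate.induct)
      case one then show ?case by (auto simp: in_N)
    next
      case (incl t)
      then show ?case using Kt[OF _ T(3)[OF incl]] T(2) by auto
    next
      case (inv t)
      then show ?case using Kt[OF _ inv] T(2) by auto
    next
      case (eng g h)
      have c: "g \<in> carrier G" "h \<in> carrier G" using eng genT by auto
      show ?case
      proof
        fix a assume a: "a \<in> K \<inter> N"
        then have ac: "a \<in> carrier G" by (simp add: in_N)
        have "g \<otimes> (h \<otimes> a \<otimes> inv h) \<otimes> inv g \<in> K \<inter> N" using eng.IH a by blast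
        then show "g \<otimes> h \<otimes> a \<otimes> inv (g \<otimes> h) \<in> K \<inter> N"
          using c ac by (simp add: G.m_assoc G.inv_mult_group)
      qed
    qed
    have YK: "y \<in> K \<inter> N" "inv y \<in> K \<inter> N" if "y \<in> Y" for y
      using that YN K by (auto simp: in_N)
    have "x \<in> K \<inter> N" if "x \<in> ?N" for x
      using that unfolding normal_closure_def
    proof (induction rule: generate.induct)
      case one then show ?case using K by (simp add: in_N)
    next
      case (incl x)
      then show ?case using conj YK genT by auto
    next
      case (inv x)
      then obtain g y where gy: "g \<in> carrier G" "y \<in> Y" "x = g \<otimes> y \<otimes> inv g" by auto
      have "inv x = g \<otimes> inv y \<otimes> inv g"
        using gy Y by (auto simp: G.inv_mult_group G.m_assoc)
      then show ?case using conj YK(2)[OF gy(2)] gy(1) genT by simp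
    next
      case (eng x y)
      then show ?case using K by (auto simp: in_N)
    qed
    then show "N \<subseteq> K" using N by blast
  qed
  then show ?thesis using T Y genT by blast
qed

theorem finitely_presented_imp_kernel_fg:
  assumes fp: "finitely_presented fibre_group" and X: "finite X" "X \<subseteq> carrier G" "generate G X = carrier G"
  shows "\<exists>S. finite S \<and> S \<subseteq> N \<and> generate G S = N"
proof (rule fg_over_one, rule ccontr)
  assume n: "\<not> fg_over {\<one>\<^sub>Q}"
  obtain T Y where TY: "conj_gen T Y" "finite T" "finite Y" "generate G T = carrier G"
    using ex_conj_gen[OF fp X] by blast
  obtain P where "submon P" "\<not> fg_over P" "\<And>a. a \<in> carrier Q \<Longrightarrow> a \<in> P \<or> inv\<^sub>Q a \<in> P"
    using ex_total_not_fg_over[OF TY(1-3) n] by blast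
  then show False using total_fg_over[OF fp _ _ TY] by blast
qed

end

section \<open>Automorphisms of finitely generated covers\<close>

text \<open>An automorphism given together with its inverse: in the application both arise from one
  construction, for \<open>t\<close> and for its inverse.\<close>

locale aut_pair = group E for E (structure) +
  fixes \<alpha> \<beta>
  assumes \<alpha>_hom: "\<alpha> \<in> hom E E" and \<beta>_hom: "\<beta> \<in> hom E E"
    and \<alpha>\<beta>: "e \<in> carrier E \<Longrightarrow> \<alpha> (\<beta> e) = e" and \<beta>\<alpha>: "e \<in> carrier E \<Longrightarrow> \<beta> (\<alpha> e) = e"
begin

sublocale \<alpha>: group_hom E E \<alpha>
  using \<alpha>_hom by (simp add: group_hom_def group_hom_axioms_def is_group)

sublocale \<beta>: group_hom E E \<beta>
  using \<beta>_hom by (simp add: group_hom_def group_hom_axioms_def is_group)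

definition act :: "int \<Rightarrow> 'a \<Rightarrow> 'a" where
  "act i e = (if i \<ge> 0 then (\<alpha> ^^ nat i) e else (\<beta> ^^ nat (- i)) e)"

lemma act_closed [simp]: "e \<in> carrier E \<Longrightarrow> act i e \<in> carrier E"
proof -
  assume e: "e \<in> carrier E"
  have "(\<alpha> ^^ n) e \<in> carrier E" for n by (induction n) (auto simp: e)
  moreover have "(\<beta> ^^ n) e \<in> carrier E" for n by (induction n) (auto simp: e)
  ultimately show ?thesis by (simp add: act_def)
qed

lemma act_0 [simp]: "act 0 e = e"
  by (simp add: act_def)

lemma act_succ: "e \<in> carrier E \<Longrightarrow> act (i + 1) e = \<alpha> (act i e)"
proof (cases "i \<ge> 0")
  case True
  then have "nat (i + 1) = Suc (nat i)" by simp
  then show ?thesis using True by (simp add: act_def)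
next
  case False
  assume e: "e \<in> carrier E"
  obtain n where n: "nat (- i) = Suc n" using False by (metis Suc_pred' neg_0_less_iff_less not_less zero_less_nat_eq)
  then have i: "i = - int n - 1" by linarith
  have n': "nat (- (i + 1)) = n" using i by simp
  have "act i e = \<beta> (act (i + 1) e)"
  proof (cases "i + 1 \<ge> 0")
    case True
    then have "i + 1 = 0" using False by simp
    then show ?thesis using n n' False by (simp add: act_def)
  next
    case i': False
    then show ?thesis using n n' False by (simp add: act_def del: minus_add_distrib)
  qed
  then show ?thesis using \<alpha>\<beta>[OF act_closed[OF e]] by simp
qed

lemma act_pred: "e \<in> carrier E \<Longrightarrow> act (i - 1) e = \<beta> (act i e)"
  using act_succ[of e "i - 1"] \<beta>\<alpha>[of "act (i - 1) e"] by simp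

lemma act_add: "e \<in> carrier E \<Longrightarrow> act (i + j) e = act i (act j e)"
proof (induction i rule: int_induct[where k = 0])
  case (step1 i)
  then show ?case using act_succ[of e "i + j"] act_succ[of "act j e" i] by (simp add: algebra_simps)
next
  case (step2 i)
  then show ?case using act_pred[of e "i + j"] act_pred[of "act j e" i] by (simp add: algebra_simps)
qed simp

lemma act_mult: "e \<in> carrier E \<Longrightarrow> f \<in> carrier E \<Longrightarrow> act i (e \<otimes> f) = act i e \<otimes> act i f"
  by (induction i rule: int_induct[where k = 0]) (simp_all add: act_succ act_pred)

lemma act_one [simp]: "act i \<one> = \<one>"
  by (induction i rule: int_induct[where k = 0]) (simp_all add: act_succ act_pred)

lemma act_1: "e \<in> carrier E \<Longrightarrow> act 1 e = \<alpha> e"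
  using act_succ[of e 0] by simp

text \<open>The semidirect product of \<open>E\<close> with the integers, in which
  \<open>(\<one>, 1)\<close> acts on \<open>E\<close> as \<alpha>.\<close>

definition sd :: "('a \<times> int) monoid" where
  "sd = \<lparr>carrier = carrier E \<times> UNIV, mult = (\<lambda>(e, i) (f, j). (e \<otimes> act i f, i + j)), one = (\<one>, 0)\<rparr>"

abbreviation sd_mult (infixl "\<odot>" 70) where "x \<odot> y \<equiv> x \<otimes>\<^bsub>sd\<^esub> y"
abbreviation sd_inv ("inv\<^sub>s _" [81] 80) where "inv\<^sub>s x \<equiv> inv\<^bsub>sd\<^esub> x"
abbreviation sd_one ("\<one>\<^sub>s") where "\<one>\<^sub>s \<equiv> \<one>\<^bsub>sd\<^esub>"

lemma sd_simps: "x \<in> carrier sd \<longleftrightarrow> fst x \<in> carrier E" "\<one>\<^sub>s = (\<one>, 0)"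
  "(e, i) \<odot> (f, j) = (e \<otimes> act i f, i + j)"
  by (cases x) (auto simp: sd_def)

lemma group_sd: "group sd"
proof (rule groupI)
  fix x y assume x: "x \<in> carrier sd" and y: "y \<in> carrier sd"
  then show "x \<odot> y \<in> carrier sd" by (cases x; cases y) (simp add: sd_simps)
  fix z assume "z \<in> carrier sd"
  then show "x \<odot> y \<odot> z = x \<odot> (y \<odot> z)"
    using x y by (cases x; cases y; cases z) (simp add: sd_simps act_mult act_add m_assoc)
next
  show "\<one>\<^sub>s \<in> carrier sd" by (simp add: sd_simps)
  fix x assume x: "x \<in> carrier sd"
  then show "\<one>\<^sub>s \<odot> x = x" by (cases x) (simp add: sd_simps)
  obtain e i where ei: "x = (e, i)" by fastforce
  have "(act (- i) (inv e), - i) \<odot> x = \<one>\<^sub>s"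
    using x act_mult[of "inv e" e "- i"] by (simp add: ei sd_simps)
  moreover have "(act (- i) (inv e), - i) \<in> carrier sd" using x by (simp add: ei sd_simps)
  ultimately show "\<exists>y\<in>carrier sd. y \<odot> x = \<one>\<^sub>s" by blast
qed

sublocale sd: group sd by (rule group_sd)

lemma embed_hom: "(\<lambda>e. (e, 0)) \<in> hom E sd"
  by (rule homI) (simp_all add: sd_simps)

lemma sd_pow: "(\<one>, 1) [^]\<^bsub>sd\<^esub> (i :: int) = (\<one>, i)"
proof (induction i rule: int_induct[where k = 0])
  case base then show ?case by (simp add: sd_simps)
next
  case (step1 i)
  have "(\<one>, 1) [^]\<^bsub>sd\<^esub> (i + 1) = (\<one>, 1) [^]\<^bsub>sd\<^esub> i \<odot> (\<one>, 1) [^]\<^bsub>sd\<^esub> (1 :: int)"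
    by (intro sd.int_pow_mult) (simp add: sd_simps)
  then show ?case using step1 sd.int_pow_1[of "(\<one>, 1)"] by (simp add: sd_simps)
next
  case (step2 i)
  have inv: "inv\<^sub>s (\<one>, 1) = (\<one>, - 1)" by (rule sd.inv_equality) (simp_all add: sd_simps)
  have "(\<one>, 1) [^]\<^bsub>sd\<^esub> (i + - 1) = (\<one>, 1) [^]\<^bsub>sd\<^esub> i \<odot> (\<one>, 1) [^]\<^bsub>sd\<^esub> (- 1 :: int)"
    by (intro sd.int_pow_mult) (simp add: sd_simps)
  then show ?case using step2 inv sd.int_pow_neg[of "(\<one>, 1)" 1] sd.int_pow_1[of "(\<one>, 1)"] by (simp add: sd_simps)
qed

lemma sd_generate:
  assumes S: "S \<subseteq> carrier E" "generate E S = carrier E"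
  shows "generate sd (insert (\<one>, 1) ((\<lambda>e. (e, 0)) ` S)) = carrier sd"
proof
  let ?S = "insert (\<one>, 1) ((\<lambda>e. (e, 0)) ` S)"
  have sub: "?S \<subseteq> carrier sd" using S by (auto simp: sd_simps)
  then show "generate sd ?S \<subseteq> carrier sd" by (rule sd.generate_incl)
  interpret e: group_hom E sd "\<lambda>e. (e, 0)"
    using embed_hom by (simp add: group_hom_def group_hom_axioms_def is_group sd.is_group)
  show "carrier sd \<subseteq> generate sd ?S"
  proof
    fix x assume x: "x \<in> carrier sd"
    obtain e i where ei: "x = (e, i)" by fastforce
    have "(e, 0) \<in> generate sd ((\<lambda>e. (e, 0)) ` S)"
      using x S e.generate_img[OF S(1)] by (auto simp: ei sd_simps)
    then have "(e, 0) \<in> generate sd ?S" using sd.mono_generate[of "(\<lambda>e. (e, 0)) ` S" ?S] by blast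
    moreover have "(\<one>, i) \<in> generate sd ?S"
      using sd.subgroup_int_pow_closed[OF sd.generate_is_subgroup[OF sub], of "(\<one>, 1)" i]
      by (auto simp: sd_pow intro: generate.incl)
    ultimately have "(e, 0) \<odot> (\<one>, i) \<in> generate sd ?S" by (rule generate.eng)
    then show "x \<in> generate sd ?S" using x by (simp add: ei sd_simps)
  qed
qed

end

section \<open>Integer powers and subgroups of the integers\<close>

lemma (in group) int_pow_succ: "x \<in> carrier G \<Longrightarrow> x [^] (i + 1 :: int) = x \<otimes> x [^] i"
  using int_pow_mult[of x 1 i] by (simp add: add.commute int_pow_1)

lemma (in group) int_pow_pred: "x \<in> carrier G \<Longrightarrow> x [^] (i - 1 :: int) = inv x \<otimes> x [^] i"
  using int_pow_mult[of x "- 1" i] int_pow_neg[of x 1] by (simp add: int_pow_1 algebra_simps)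

lemma ex_int_generator:
  fixes D :: "int set"
  assumes "\<And>a b. a \<in> D \<Longrightarrow> b \<in> D \<Longrightarrow> a - b \<in> D" "0 \<in> D"
  shows "\<exists>d\<in>D. \<forall>a\<in>D. d dvd a"
proof (cases "D = {0}")
  case True then show ?thesis by simp
next
  case False
  have neg: "- a \<in> D" if "a \<in> D" for a using assms(1)[OF assms(2) that] by simp
  have add: "a + b \<in> D" if "a \<in> D" "b \<in> D" for a b using assms(1)[OF that(1) neg[OF that(2)]] by simp
  have mult: "int n * a \<in> D" if "a \<in> D" for a n
    by (induction n) (auto simp: assms(2) algebra_simps intro: add that)
  have multi: "k * a \<in> D" if "a \<in> D" for a k
    using mult[OF that, of "nat k"] neg[OF mult[OF that, of "nat (- k)"]] by (cases "k \<ge> 0") auto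
  obtain a where a: "a \<in> D" "a \<noteq> 0" using False assms(2) by blast
  then have ex: "\<exists>n. 0 < n \<and> int n \<in> D" using neg[OF a(1)]
    by (intro exI[of _ "nat \<bar>a\<bar>"]) (auto simp: abs_if)
  define n where "n = (LEAST n. 0 < n \<and> int n \<in> D)"
  have n: "0 < n" "int n \<in> D" using LeastI_ex[OF ex] by (auto simp: n_def)
  have "int n dvd b" if b: "b \<in> D" for b
  proof -
    have m: "b mod int n \<in> D" using assms(1)[OF b multi[OF n(2), of "b div int n"]]
      by (simp add: minus_div_mult_eq_mod)
    have "b mod int n = 0"
    proof (rule ccontr)
      assume "b mod int n \<noteq> 0"
      then have "0 < b mod int n" "b mod int n < int n"
        using n pos_mod_sign[of "int n" b] pos_mod_bound[of "int n" b] by linarith+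
      then have "0 < nat (b mod int n)" "int (nat (b mod int n)) \<in> D" "nat (b mod int n) < n"
        using m by (auto simp: nat_less_iff)
      then show False using not_less_Least[of "nat (b mod int n)" "\<lambda>n. 0 < n \<and> int n \<in> D"] by (simp add: n_def)
    qed
    then show ?thesis by (simp add: dvd_eq_mod_eq_0)
  qed
  with n show ?thesis by blast
qed

text \<open>\<open>E\<close> approximates the kernel of a map from a finitely presented group onto a cyclic group,
  generated by the image of \<open>\<tau>\<close>. As \<open>\<tau>\<close> lifts to an automorphism of \<open>E\<close>, the semidirect product with
  the integers maps onto the finitely presented group, so the kernel of that map is finitely generated
  as a normal subgroup, and finitely many normal generators of the kernel of \<open>\<pi>\<close> can be read off.\<close>

lemma (in aut_pair) kernel_descends:
  assumes P: "group P" and \<pi>: "\<pi> \<in> hom E P" and \<tau>: "\<tau> \<in> carrier P"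
    and equi: "\<And>e. e \<in> carrier E \<Longrightarrow> \<pi> (\<alpha> e) = \<tau> \<otimes>\<^bsub>P\<^esub> \<pi> e \<otimes>\<^bsub>P\<^esub> inv\<^bsub>P\<^esub> \<tau>"
    and H': "subgroup H' P" "H' = {\<pi> e \<otimes>\<^bsub>P\<^esub> \<tau> [^]\<^bsub>P\<^esub> (i :: int) | e i. e \<in> carrier E}"
    and fp: "finitely_presented (P\<lparr>carrier := H'\<rparr>)"
    and S: "finite S" "S \<subseteq> carrier E" "generate E S = carrier E"
    and A: "A \<lhd> E" and B: "B \<lhd> E"
    and \<alpha>A: "\<And>e. e \<in> carrier E \<Longrightarrow> \<alpha> e \<otimes> inv e \<in> A"
    and \<theta>: "\<theta> \<in> carrier E" "\<And>a. a \<in> A \<Longrightarrow> \<alpha> a = \<theta> \<otimes> a \<otimes> inv \<theta>"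
    and \<alpha>B: "\<And>b. b \<in> B \<Longrightarrow> \<alpha> b = b"
    and comm: "\<And>e f. e \<in> carrier E \<Longrightarrow> f \<in> carrier E \<Longrightarrow> \<exists>a\<in>A. \<exists>b\<in>B. e \<otimes> f \<otimes> inv e \<otimes> inv f = a \<otimes> b"
    and split: "\<And>a b. a \<in> A \<Longrightarrow> b \<in> B \<Longrightarrow> \<pi> (a \<otimes> b) = \<one>\<^bsub>P\<^esub> \<Longrightarrow> \<pi> a = \<one>\<^bsub>P\<^esub>"
  shows "\<exists>J. finite J \<and> J \<subseteq> carrier E \<and> kernel E P \<pi> = normal_closure E J"
proof -
  interpret P: group P by fact
  interpret A: normal A E by fact
  interpret B: normal B E by fact
  interpret \<pi>: group_hom E P \<pi> by (simp add: group_hom_def group_hom_axioms_def is_group P \<pi>)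
  have equi_act: "\<pi> (act i e) = \<tau> [^]\<^bsub>P\<^esub> i \<otimes>\<^bsub>P\<^esub> \<pi> e \<otimes>\<^bsub>P\<^esub> inv\<^bsub>P\<^esub> (\<tau> [^]\<^bsub>P\<^esub> i)" if e: "e \<in> carrier E" for e i
  proof (induction i rule: int_induct[where k = 0])
    case base then show ?case using e by simp
  next
    case (step1 i)
    then show ?case using e \<tau> by (simp add: act_succ equi P.int_pow_succ P.m_assoc P.inv_mult_group)
  next
    case (step2 i)
    have "\<pi> (\<alpha> (\<beta> (act i e))) = \<tau> \<otimes>\<^bsub>P\<^esub> \<pi> (\<beta> (act i e)) \<otimes>\<^bsub>P\<^esub> inv\<^bsub>P\<^esub> \<tau>"
      using e by (intro equi) simp
    then have "\<tau> [^]\<^bsub>P\<^esub> i \<otimes>\<^bsub>P\<^esub> \<pi> e \<otimes>\<^bsub>P\<^esub> inv\<^bsub>P\<^esub> (\<tau> [^]\<^bsub>P\<^esub> i) = \<tau> \<otimes>\<^bsub>P\<^esub> \<pi> (act (i - 1) e) \<otimes>\<^bsub>P\<^esub> inv\<^bsub>P\<^esub> \<tau>"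
      using e step2 by (simp add: act_pred \<alpha>\<beta>)
    then have "inv\<^bsub>P\<^esub> \<tau> \<otimes>\<^bsub>P\<^esub> (\<tau> [^]\<^bsub>P\<^esub> i \<otimes>\<^bsub>P\<^esub> \<pi> e \<otimes>\<^bsub>P\<^esub> inv\<^bsub>P\<^esub> (\<tau> [^]\<^bsub>P\<^esub> i)) \<otimes>\<^bsub>P\<^esub> \<tau> = \<pi> (act (i - 1) e)"
      using e \<tau> by (simp add: P.m_assoc)
    then show ?case using e \<tau> by (simp add: P.int_pow_pred P.m_assoc P.inv_mult_group)
  qed
  define Pi where "Pi x = \<pi> (fst x) \<otimes>\<^bsub>P\<^esub> \<tau> [^]\<^bsub>P\<^esub> (snd x :: int)" for x
  let ?H = "P\<lparr>carrier := H'\<rparr>"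
  have PiH: "Pi ` carrier sd = H'"
  proof
    show "Pi ` carrier sd \<subseteq> H'"
    proof (rule image_subsetI)
      fix x assume "x \<in> carrier sd"
      then have "fst x \<in> carrier E" by (simp add: sd_simps)
      then show "Pi x \<in> H'" unfolding H'(2) Pi_def by blast
    qed
    show "H' \<subseteq> Pi ` carrier sd"
    proof
      fix y assume "y \<in> H'"
      then obtain e i where "e \<in> carrier E" "y = \<pi> e \<otimes>\<^bsub>P\<^esub> \<tau> [^]\<^bsub>P\<^esub> (i :: int)" unfolding H'(2) by blast
      then show "y \<in> Pi ` carrier sd"
        by (intro image_eqI[of _ _ "(e, i)"]) (simp_all add: Pi_def sd_simps)
    qed
  qed
  interpret H: group ?H using P.subgroup_imp_group[OF H'(1)] .
  have Pi_hom: "Pi \<in> hom sd ?H"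
  proof (rule homI)
    show "Pi x \<in> carrier ?H" if "x \<in> carrier sd" for x using PiH that by auto
    fix x y assume xy: "x \<in> carrier sd" "y \<in> carrier sd"
    obtain e i where e: "x = (e, i)" by fastforce
    obtain f j where f: "y = (f, j)" by fastforce
    have c: "e \<in> carrier E" "f \<in> carrier E" using xy by (auto simp: e f sd_simps)
    show "Pi (x \<odot> y) = Pi x \<otimes>\<^bsub>?H\<^esub> Pi y"
      using c \<tau> by (simp add: e f sd_simps Pi_def equi_act P.int_pow_mult P.m_assoc)
  qed
  interpret Pi: group_hom sd ?H Pi
    by (simp add: group_hom_def group_hom_axioms_def group_sd H.is_group Pi_hom)
  let ?S = "insert (\<one>, 1) ((\<lambda>e. (e, 0)) ` S)"
  have S': "finite ?S" "?S \<subseteq> carrier sd" "generate sd ?S = carrier sd"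
    using S sd_generate[OF S(2,3)] by (auto simp: sd_simps)
  obtain L where L: "finite L" "L \<subseteq> kernel sd ?H Pi" "kernel sd ?H Pi = normal_closure sd L"
    using kernel_finitely_normally_generated[OF Pi.group_hom_axioms _ S' fp] PiH by auto
  define K where "K = kernel sd ?H Pi"
  have inK: "x \<in> K \<longleftrightarrow> fst x \<in> carrier E \<and> Pi x = \<one>\<^bsub>P\<^esub>" for x
    by (simp add: K_def kernel_def sd_simps)
  have nK: "K \<lhd> sd" unfolding K_def by (rule Pi.normal_kernel)
  have sK: "subgroup K sd" by (rule normal_imp_subgroup[OF nK])
  note K_carrier = subgroup.mem_carrier[OF sK]
  have K0: "(e, 0) \<in> K \<longleftrightarrow> e \<in> kernel E P \<pi>" for e
    by (auto simp: inK Pi_def kernel_def)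
  define deg :: "'a \<times> int \<Rightarrow> int" where "deg = snd"
  have deg_mult: "deg (x \<odot> y) = deg x + deg y" for x y
    by (cases x; cases y) (simp add: deg_def sd_simps)
  have deg_inv: "deg (inv\<^sub>s x) = - deg x" if "x \<in> carrier sd" for x
    using deg_mult[of "inv\<^sub>s x" x] that by (simp add: sd_simps deg_def)
  have deg_pow: "deg (x [^]\<^bsub>sd\<^esub> (i :: int)) = i * deg x" if "x \<in> carrier sd" for x i
  proof (induction i rule: int_induct[where k = 0])
    case base then show ?case by (simp add: deg_def sd_simps)
  next
    case (step1 i) then show ?case using that by (simp add: sd.int_pow_succ deg_mult distrib_right)
  next
    case (step2 i) then show ?case using that by (simp add: sd.int_pow_pred deg_mult deg_inv left_diff_distrib)
  qed
  \<comment> \<open>The degree of \<open>l0\<close> generates all degrees in \<open>K\<close>. If it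
    is 0, the unit is taken, so that in every case a power of \<open>l0\<close> of degree 0 is
    trivial.\<close>
  obtain l0 where l0: "l0 \<in> K" "\<And>l. l \<in> K \<Longrightarrow> deg l0 dvd deg l" "deg l0 = 0 \<Longrightarrow> l0 = \<one>\<^sub>s"
  proof -
    have "\<exists>d\<in>deg ` K. \<forall>a\<in>deg ` K. d dvd a"
    proof (rule ex_int_generator)
      show "0 \<in> deg ` K" using subgroup.one_closed[OF sK] by (force simp: sd_simps deg_def image_iff)
      fix a b assume "a \<in> deg ` K" "b \<in> deg ` K"
      then obtain x y where xy: "x \<in> K" "a = deg x" "y \<in> K" "b = deg y" by blast
      have "deg (x \<odot> inv\<^sub>s y) = a - b"
        using deg_mult[of x "inv\<^sub>s y"] deg_inv[of y] K_carrier[OF xy(3)] xy by simp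
      moreover have "x \<odot> inv\<^sub>s y \<in> K"
        using xy subgroup.m_closed[OF sK] subgroup.m_inv_closed[OF sK] by simp
      ultimately show "a - b \<in> deg ` K" by (metis imageI)
    qed
    then obtain l where l: "l \<in> K" "\<And>k. k \<in> K \<Longrightarrow> deg l dvd deg k" by blast
    show ?thesis
    proof (cases "deg l = 0")
      case True
      then show ?thesis using l subgroup.one_closed[OF sK] by (intro that[of "\<one>\<^sub>s"]) (auto simp: deg_def sd_simps)
    next
      case False
      then show ?thesis using l by (intro that[of l]) auto
    qed
  qed
  have l0c: "l0 \<in> carrier sd" by (rule K_carrier[OF l0(1)])
  define e0 d where "e0 = fst l0" and "d = snd l0"
  have l0e: "l0 = (e0, d)" by (simp add: e0_def d_def)
  have e0: "e0 \<in> carrier E" using l0c by (simp add: l0e sd_simps)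
  define J where "J = kernel E P \<pi>"
  have nJ: "J \<lhd> E" unfolding J_def by (rule \<pi>.normal_kernel)
  have sJ: "subgroup J E" by (rule normal_imp_subgroup[OF nJ])
  have inJ: "e \<in> J \<longleftrightarrow> e \<in> carrier E \<and> \<pi> e = \<one>\<^bsub>P\<^esub>" for e by (simp add: J_def kernel_def)
  have \<alpha>J: "\<alpha> e \<in> J" if "e \<in> J" for e using that \<tau> by (simp add: inJ equi)
  have \<beta>J: "\<beta> e \<in> J" if "e \<in> J" for e
  proof -
    have e: "e \<in> carrier E" "\<pi> e = \<one>\<^bsub>P\<^esub>" using that by (auto simp: inJ)
    have "\<pi> (act (- 1) e) = \<one>\<^bsub>P\<^esub>" using e \<tau> by (simp add: equi_act)
    moreover have "act (- 1) e = \<beta> e" using act_pred[of e 0] e by simp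
    ultimately show ?thesis using e by (simp add: inJ)
  qed
  have \<beta>A: "\<beta> e \<otimes> inv e \<in> A" if e: "e \<in> carrier E" for e
  proof -
    have "inv (\<alpha> (\<beta> e) \<otimes> inv (\<beta> e)) \<in> A" using \<alpha>A[of "\<beta> e"] e A.m_inv_closed by simp
    then show ?thesis using e by (simp add: \<alpha>\<beta> inv_mult_group)
  qed
  have actA: "act i e \<otimes> inv e \<in> A" if e: "e \<in> carrier E" for e i
  proof (induction i rule: int_induct[where k = 0])
    case base then show ?case using e by simp
  next
    case (step1 i)
    have "\<alpha> (act i e) \<otimes> inv (act i e) \<otimes> (act i e \<otimes> inv e) \<in> A"
      using step1 \<alpha>A[of "act i e"] e by simp
    then show ?case using e by (simp add: act_succ m_assoc)
  next
    case (step2 i)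
    have "\<beta> (act i e) \<otimes> inv (act i e) \<otimes> (act i e \<otimes> inv e) \<in> A"
      using step2 \<beta>A[of "act i e"] e by simp
    then show ?case using e by (simp add: act_pred m_assoc)
  qed
  have \<beta>a: "\<beta> a = inv \<theta> \<otimes> a \<otimes> \<theta>" if a: "a \<in> A" for a
  proof -
    have ac: "a \<in> carrier E" by (rule A.mem_carrier[OF a])
    have "inv \<theta> \<otimes> a \<otimes> \<theta> \<in> A" by (rule A.inv_op_closed1[OF \<theta>(1) a])
    from \<theta>(2)[OF this] have "\<alpha> (inv \<theta> \<otimes> a \<otimes> \<theta>) = a" using ac \<theta>(1) by (simp add: m_assoc)
    then show ?thesis using \<beta>\<alpha>[of "inv \<theta> \<otimes> a \<otimes> \<theta>"] ac \<theta>(1) by simp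
  qed
  have \<beta>b: "\<beta> b = b" if "b \<in> B" for b
    using \<beta>\<alpha>[of b] \<alpha>B[OF that] B.mem_carrier[OF that] by simp
  \<comment> \<open>A power of \<open>l0\<close> corrects \<open>l\<close> to degree 0. For
    \<open>deg l0 = 0\<close> the quotient is 0 by convention, which is right because
    \<open>deg l\<close> is 0 as well.\<close>
  define rest where "rest l = l \<odot> inv\<^sub>s (l0 [^]\<^bsub>sd\<^esub> (deg l div deg l0))" for l
  have rest: "rest l = (fst (rest l), 0)" "fst (rest l) \<in> J" "l = rest l \<odot> l0 [^]\<^bsub>sd\<^esub> (deg l div deg l0)"
    if l: "l \<in> K" for l
  proof -
    have lc: "l \<in> carrier sd" by (rule K_carrier[OF l])
    have "deg (rest l) = 0"
      using l0(2)[OF l] l0c lc by (simp add: rest_def deg_mult deg_inv deg_pow)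
    then show e: "rest l = (fst (rest l), 0)" by (simp add: deg_def prod_eq_iff)
    have "l0 [^]\<^bsub>sd\<^esub> (deg l div deg l0) \<in> K" by (rule sd.subgroup_int_pow_closed[OF sK l0(1)])
    then have "rest l \<in> K" unfolding rest_def
      using l subgroup.m_closed[OF sK] subgroup.m_inv_closed[OF sK] by simp
    then show "fst (rest l) \<in> J" using e K0 unfolding J_def by metis
    show "l = rest l \<odot> l0 [^]\<^bsub>sd\<^esub> (deg l div deg l0)"
      using lc l0c by (simp add: rest_def sd.m_assoc)
  qed
  \<comment> \<open>\<open>(k, 0)\<close> is the commutator of \<open>(e, 0)\<close> and
    \<open>l0\<close>; dividing by these makes \<open>l0\<close> commute with the image of
    \<open>E\<close>.\<close>
  define C where "C = (\<lambda>e. e \<otimes> e0 \<otimes> inv (act d e) \<otimes> inv e0) ` S"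
  \<comment> \<open>The two factors go into the kernel separately. As \<alpha> acts on
    \<open>A\<close> by conjugation with \<theta> and fixes \<open>B\<close>, the images of the
    factors then stay in any normal subgroup that contains the factors.\<close>
  have Csplit: "\<exists>a\<in>A \<inter> J. \<exists>b\<in>B \<inter> J. k = a \<otimes> b" if k: "k \<in> C" for k
  proof -
    obtain e where e: "e \<in> carrier E" "k = e \<otimes> e0 \<otimes> inv (act d e) \<otimes> inv e0" using k S(2) by (auto simp: C_def)
    obtain a b where ab: "a \<in> A" "b \<in> B" "e \<otimes> e0 \<otimes> inv e \<otimes> inv e0 = a \<otimes> b" using comm[OF e(1) e0] by blast
    have abc: "a \<in> carrier E" "b \<in> carrier E" using ab by auto
    \<comment> \<open>The discrepancy between \<open>act d e\<close> and \<open>e\<close> lies in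
      \<open>A\<close>; it is moved to the left of \<open>b\<close> by conjugation.\<close>
    define a' where "a' = e0 \<otimes> (e \<otimes> inv (act d e)) \<otimes> inv e0"
    have "e \<otimes> inv (act d e) \<in> A" using A.m_inv_closed[OF actA[OF e(1), of d]] e(1) by (simp add: inv_mult_group)
    then have a': "a' \<in> A" unfolding a'_def using A.inv_op_closed2[OF e0] by blast
    have a'c: "a' \<in> carrier E" using a' by auto
    have "k = (e \<otimes> e0 \<otimes> inv e \<otimes> inv e0) \<otimes> a'"
      using e e0 by (simp add: a'_def m_assoc)
    also have "\<dots> = (a \<otimes> (b \<otimes> a' \<otimes> inv b)) \<otimes> b" using ab abc a'c by (simp add: m_assoc)
    finally have k2: "k = (a \<otimes> (b \<otimes> a' \<otimes> inv b)) \<otimes> b" .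
    have aa: "a \<otimes> (b \<otimes> a' \<otimes> inv b) \<in> A" using A.inv_op_closed2[OF abc(2) a'] ab(1) by blast
    have "\<pi> k = \<one>\<^bsub>P\<^esub>"
    proof -
      have "\<pi> e0 \<otimes>\<^bsub>P\<^esub> \<tau> [^]\<^bsub>P\<^esub> d = \<one>\<^bsub>P\<^esub>" using l0(1) by (simp add: inK Pi_def l0e)
      then have "\<pi> e0 = inv\<^bsub>P\<^esub> (\<tau> [^]\<^bsub>P\<^esub> d)" using P.inv_equality[of "\<pi> e0" "\<tau> [^]\<^bsub>P\<^esub> d"] e0 \<tau> by simp
      then show ?thesis using e e0 \<tau> by (simp add: equi_act P.m_assoc P.inv_mult_group)
    qed
    then have "\<pi> (a \<otimes> (b \<otimes> a' \<otimes> inv b)) = \<one>\<^bsub>P\<^esub>" using split[OF aa ab(2)] k2 by simp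
    moreover from this have "\<pi> b = \<one>\<^bsub>P\<^esub>" using \<open>\<pi> k = \<one>\<^bsub>P\<^esub>\<close> k2 aa abc A.mem_carrier[OF aa] \<pi>.hom_mult by simp
    ultimately have "a \<otimes> (b \<otimes> a' \<otimes> inv b) \<in> A \<inter> J" "b \<in> B \<inter> J"
      using aa ab(2) abc A.mem_carrier[OF aa] by (auto simp: inJ)
    then show ?thesis using k2 by blast
  qed
  then obtain fa fb where f: "\<And>k. k \<in> C \<Longrightarrow> fa k \<in> A \<inter> J \<and> fb k \<in> B \<inter> J \<and> k = fa k \<otimes> fb k" by metis
  define M where "M = (\<lambda>l. fst (rest l)) ` L"
  have MJ: "M \<subseteq> J" using rest(2) L(2) by (auto simp: M_def K_def)
  \<comment> \<open>With \<open>m\<close> its quotients \<open>\<alpha> m \<otimes> inv m\<close>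
    and \<open>\<beta> m \<otimes> inv m\<close> are included. They lie in \<open>A\<close>, so the
    process of adding images stops here. The last element makes \<open>l0\<close> commute with
    \<open>(\<one>, 1)\<close>.\<close>
  define J1 where "J1 = M \<union> (\<lambda>m. \<alpha> m \<otimes> inv m) ` M \<union> (\<lambda>m. \<beta> m \<otimes> inv m) ` M \<union> fa ` C \<union> fb ` C \<union> {\<alpha> e0 \<otimes> inv e0}"
  have finJ1: "finite J1" using L(1) S(1) by (simp add: J1_def M_def C_def)
  have e0J: "\<alpha> e0 \<otimes> inv e0 \<in> J"
  proof -
    have "\<pi> e0 \<otimes>\<^bsub>P\<^esub> \<tau> [^]\<^bsub>P\<^esub> d = \<one>\<^bsub>P\<^esub>" using l0(1) by (simp add: inK Pi_def l0e)
    then have "\<pi> e0 = inv\<^bsub>P\<^esub> (\<tau> [^]\<^bsub>P\<^esub> d)" using P.inv_equality[of "\<pi> e0" "\<tau> [^]\<^bsub>P\<^esub> d"] e0 \<tau> by simp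
    then have "\<pi> e0 = \<tau> [^]\<^bsub>P\<^esub> (- d)" using \<tau> by (simp add: P.int_pow_neg)
    moreover have "\<tau> \<otimes>\<^bsub>P\<^esub> \<tau> [^]\<^bsub>P\<^esub> (- d) = \<tau> [^]\<^bsub>P\<^esub> (- d) \<otimes>\<^bsub>P\<^esub> \<tau>"
      using P.int_pow_mult[OF \<tau>, of 1 "- d"] P.int_pow_mult[OF \<tau>, of "- d" 1] \<tau>
      by (simp add: P.int_pow_1 add.commute)
    ultimately show ?thesis using e0 \<tau> by (simp add: inJ equi P.m_assoc)
  qed
  have J1J: "J1 \<subseteq> J"
    using MJ f e0J \<alpha>J \<beta>J subgroup.m_closed[OF sJ] subgroup.m_inv_closed[OF sJ]
    by (auto simp: J1_def subset_iff)
  have J1c: "J1 \<subseteq> carrier E" using J1J by (auto simp: inJ)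
  define W where "W = normal_closure E J1"
  have nW: "W \<lhd> E" unfolding W_def by (rule normal_closure_normal[OF J1c])
  interpret W: normal W E by (rule nW)
  have J1W: "J1 \<subseteq> W" unfolding W_def by (rule normal_closure_incl[OF J1c])
  have WJ: "W \<subseteq> J" unfolding W_def by (rule normal_closure_least[OF nJ J1J])
  have AB: "j \<in> M \<or> j \<in> A \<or> j \<in> B" if "j \<in> J1" for j
    using that \<alpha>A[OF e0] \<alpha>A \<beta>A f MJ by (auto simp: J1_def subset_iff inJ)
  have pre: "W \<subseteq> {w \<in> carrier E. \<gamma> w \<in> W}"
    if \<gamma>: "\<gamma> \<in> hom E E" and g: "\<And>j. j \<in> J1 \<Longrightarrow> \<gamma> j \<in> W" for \<gamma>
  proof -
    interpret \<gamma>: group_hom E E \<gamma> by (simp add: group_hom_def group_hom_axioms_def is_group \<gamma>)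
    have "{w \<in> carrier E. \<gamma> w \<in> W} \<lhd> E"
    proof (rule normal_invI)
      show "subgroup {w \<in> carrier E. \<gamma> w \<in> W} E"
        by (rule subgroupI) (auto intro: exI[of _ \<one>])
      show "h \<otimes> w \<otimes> inv h \<in> {w \<in> carrier E. \<gamma> w \<in> W}"
        if "h \<in> carrier E" "w \<in> {w \<in> carrier E. \<gamma> w \<in> W}" for h w
        using that W.inv_op_closed2[of "\<gamma> h" "\<gamma> w"] by simp
    qed
    moreover have "J1 \<subseteq> {w \<in> carrier E. \<gamma> w \<in> W}" using g J1c by auto
    ultimately show ?thesis unfolding W_def[symmetric] using normal_closure_least unfolding W_def by blast
  qed
  have \<alpha>W: "\<alpha> w \<in> W" if "w \<in> W" for w
  proof -
    have "\<alpha> j \<in> W" if j: "j \<in> J1" for j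
    proof -
      have jW: "j \<in> W" "j \<in> carrier E" using j J1W J1c by auto
      consider "j \<in> M" | "j \<in> A" | "j \<in> B" using AB[OF j] by blast
      then show ?thesis
      proof cases
        case 1
        then have "\<alpha> j \<otimes> inv j \<in> W" using J1W by (auto simp: J1_def)
        then have "\<alpha> j \<otimes> inv j \<otimes> j \<in> W" using jW by blast
        then show ?thesis using jW by (simp add: m_assoc)
      next
        case 2 then show ?thesis using \<theta> W.inv_op_closed2[OF \<theta>(1) jW(1)] by simp
      next
        case 3 then show ?thesis using \<alpha>B jW by simp
      qed
    qed
    then show ?thesis using pre[OF \<alpha>_hom] that by blast
  qed
  have \<beta>W: "\<beta> w \<in> W" if "w \<in> W" for w
  proof -
    have "\<beta> j \<in> W" if j: "j \<in> J1" for j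
    proof -
      have jW: "j \<in> W" "j \<in> carrier E" using j J1W J1c by auto
      consider "j \<in> M" | "j \<in> A" | "j \<in> B" using AB[OF j] by blast
      then show ?thesis
      proof cases
        case 1
        then have "\<beta> j \<otimes> inv j \<in> W" using J1W by (auto simp: J1_def)
        then have "\<beta> j \<otimes> inv j \<otimes> j \<in> W" using jW by blast
        then show ?thesis using jW by (simp add: m_assoc)
      next
        case 2 then show ?thesis using \<beta>a W.inv_op_closed1[OF \<theta>(1) jW(1)] by simp
      next
        case 3 then show ?thesis using \<beta>b jW by simp
      qed
    qed
    then show ?thesis using pre[OF \<beta>_hom] that by blast
  qed
  have actW: "act i w \<in> W" if "w \<in> W" for w i
    using that W.subset
    by (induction i rule: int_induct[where k = 0]) (auto simp: act_succ act_pred \<alpha>W \<beta>W)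
  define W' where "W' = {(w, 0 :: int) | w. w \<in> W}"
  have nW': "W' \<lhd> sd"
  proof (rule sd.normal_invI)
    have inv0: "inv\<^sub>s (w, 0) = (inv w, 0)" if "w \<in> carrier E" for w
      by (rule sd.inv_equality) (use that in \<open>simp_all add: sd_simps\<close>)
    show "subgroup W' sd"
    proof (rule sd.subgroupI)
      show "W' \<subseteq> carrier sd" using W.subset by (auto simp: W'_def sd_simps)
      show "W' \<noteq> {}" unfolding W'_def using W.one_closed by blast
      show "inv\<^sub>s a \<in> W'" if "a \<in> W'" for a using that W.subset by (auto simp: W'_def inv0)
      show "a \<odot> b \<in> W'" if "a \<in> W'" "b \<in> W'" for a b using that by (auto simp: W'_def sd_simps)
    qed
    fix x w assume x: "x \<in> carrier sd" and "w \<in> W'"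
    then obtain u where u: "u \<in> W" "w = (u, 0)" by (auto simp: W'_def)
    obtain e i where ei: "x = (e, i)" by fastforce
    have ec: "e \<in> carrier E" "u \<in> carrier E" using x u by (auto simp: ei sd_simps)
    have "x \<odot> w = (e \<otimes> act i u \<otimes> inv e, 0) \<odot> x"
      using ec by (simp add: ei u sd_simps m_assoc)
    moreover have "(e \<otimes> act i u \<otimes> inv e, 0) \<in> W'"
      using W.inv_op_closed2[OF ec(1) actW[OF u(1)]] by (simp add: W'_def)
    ultimately show "x \<odot> w \<odot> inv\<^sub>s x \<in> W'"
      using x sd.m_assoc[of "(e \<otimes> act i u \<otimes> inv e, 0)" x "inv\<^sub>s x"] ec
      by (simp add: sd_simps(1)[of "(_, _)"] del: sd_simps(3))
  qed
  let ?q = "\<lambda>x. W' #>\<^bsub>sd\<^esub> x"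
  note qq = normal_Mod_hom[OF nW']
  interpret q: group_hom sd "sd Mod W'" ?q
    by (simp add: group_hom_def group_hom_axioms_def qq sd.is_group)
  have q1: "?q x = \<one>\<^bsub>sd Mod W'\<^esub>" if "x \<in> W'" for x
  proof -
    have "x \<in> kernel sd (sd Mod W') ?q" unfolding qq(4) by (rule that)
    then show ?thesis unfolding kernel_def by blast
  qed
  have qcomm: "?q s \<otimes>\<^bsub>sd Mod W'\<^esub> ?q l0 = ?q l0 \<otimes>\<^bsub>sd Mod W'\<^esub> ?q s"
    if s: "s \<in> carrier sd" and k: "s \<odot> l0 = k \<odot> (l0 \<odot> s)" "k \<in> W'" for s k
  proof -
    have kc: "k \<in> carrier sd" using k(2) W.subset by (auto simp: W'_def sd_simps)
    have "?q (s \<odot> l0) = ?q k \<otimes>\<^bsub>sd Mod W'\<^esub> ?q (l0 \<odot> s)"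
      unfolding k(1) using kc s l0c by (intro q.hom_mult) auto
    also have "\<dots> = ?q (l0 \<odot> s)"
      unfolding q1[OF k(2)] using s l0c by (intro q.H.l_one q.hom_closed) auto
    finally show ?thesis using s l0c by (simp only: q.hom_mult)
  qed
  have gens: "?q s \<otimes>\<^bsub>sd Mod W'\<^esub> ?q l0 = ?q l0 \<otimes>\<^bsub>sd Mod W'\<^esub> ?q s" if s: "s \<in> ?S" for s
  proof (cases "s = (\<one>, 1)")
    case True
    have "(\<alpha> e0 \<otimes> inv e0, 0) \<in> W'" using J1W by (auto simp: W'_def J1_def)
    moreover have "(\<one>, 1) \<odot> l0 = (\<alpha> e0 \<otimes> inv e0, 0) \<odot> (l0 \<odot> (\<one>, 1))"
      using e0 by (simp add: l0e sd_simps act_1 m_assoc)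
    ultimately show ?thesis using qcomm[of s] True by (simp add: sd_simps)
  next
    case False
    then obtain e where e: "e \<in> S" "s = (e, 0)" using s by auto
    have ec: "e \<in> carrier E" using e S by auto
    define k where "k = e \<otimes> e0 \<otimes> inv (act d e) \<otimes> inv e0"
    have kC: "k \<in> C" using e by (auto simp: C_def k_def)
    have "fa k \<in> W" "fb k \<in> W" using J1W kC by (auto simp: J1_def)
    then have "fa k \<otimes> fb k \<in> W" by blast
    then have "(k, 0) \<in> W'" using f[OF kC] by (simp add: W'_def)
    moreover have "s \<odot> l0 = (k, 0) \<odot> (l0 \<odot> s)"
      using ec e0 by (simp add: e l0e sd_simps k_def m_assoc)
    ultimately show ?thesis using qcomm[of s] ec e by (simp add: sd_simps)
  qed
  have central: "?q g \<otimes>\<^bsub>sd Mod W'\<^esub> ?q l0 = ?q l0 \<otimes>\<^bsub>sd Mod W'\<^esub> ?q g" if g: "g \<in> carrier sd" for g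
  proof (rule q.H.generate_commute)
    show "?q ` ?S \<subseteq> carrier (sd Mod W')" using S'(2) q.hom_closed by blast
    show "?q l0 \<in> carrier (sd Mod W')" using l0c by (rule q.hom_closed)
    show "?q g \<in> generate (sd Mod W') (?q ` ?S)"
      unfolding q.generate_img[OF S'(2)] S'(3) using g by (rule imageI)
    show "a \<otimes>\<^bsub>sd Mod W'\<^esub> ?q l0 = ?q l0 \<otimes>\<^bsub>sd Mod W'\<^esub> a" if "a \<in> ?q ` ?S" for a
      using that gens by blast
  qed
  \<comment> \<open>The preimage of the cyclic subgroup generated by the image of \<open>l0\<close>.
    It is normal because that image is central, and it contains \<open>L\<close>, hence all of
    \<open>K\<close>.\<close>
  define V where "V = {g \<in> carrier sd. \<exists>m :: int. ?q g = ?q (l0 [^]\<^bsub>sd\<^esub> m)}"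
  have powc: "l0 [^]\<^bsub>sd\<^esub> (m :: int) \<in> carrier sd" for m using l0c by simp
  have nV: "V \<lhd> sd"
  proof (rule sd.normal_invI)
    show "subgroup V sd"
    proof (rule sd.subgroupI)
      show "V \<subseteq> carrier sd" by (auto simp: V_def)
      have "l0 [^]\<^bsub>sd\<^esub> (0 :: int) \<in> V" unfolding V_def using powc[of 0] by blast
      then show "V \<noteq> {}" by blast
    next
      fix a assume "a \<in> V"
      then obtain m where a: "a \<in> carrier sd" "?q a = ?q (l0 [^]\<^bsub>sd\<^esub> (m :: int))" by (auto simp: V_def)
      have "?q (inv\<^sub>s a) = ?q (inv\<^sub>s (l0 [^]\<^bsub>sd\<^esub> m))"
        unfolding q.hom_inv[OF a(1)] q.hom_inv[OF powc] a(2) ..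
      also have "inv\<^sub>s (l0 [^]\<^bsub>sd\<^esub> m) = l0 [^]\<^bsub>sd\<^esub> (- m)" using sd.int_pow_neg[OF l0c] by simp
      finally show "inv\<^sub>s a \<in> V" unfolding V_def using a(1) by blast
    next
      fix a b assume "a \<in> V" "b \<in> V"
      then obtain m n where a: "a \<in> carrier sd" "?q a = ?q (l0 [^]\<^bsub>sd\<^esub> (m :: int))"
        and b: "b \<in> carrier sd" "?q b = ?q (l0 [^]\<^bsub>sd\<^esub> (n :: int))" by (auto simp: V_def)
      have "?q (a \<odot> b) = ?q (l0 [^]\<^bsub>sd\<^esub> m \<odot> l0 [^]\<^bsub>sd\<^esub> n)"
        unfolding q.hom_mult[OF a(1) b(1)] q.hom_mult[OF powc powc] a(2) b(2) ..
      also have "l0 [^]\<^bsub>sd\<^esub> m \<odot> l0 [^]\<^bsub>sd\<^esub> n = l0 [^]\<^bsub>sd\<^esub> (m + n)" using sd.int_pow_mult[OF l0c] by simp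
      finally show "a \<odot> b \<in> V" unfolding V_def using a(1) b(1) by blast
    qed
    fix g v assume g: "g \<in> carrier sd" and "v \<in> V"
    then obtain m where v: "v \<in> carrier sd" "?q v = ?q (l0 [^]\<^bsub>sd\<^esub> (m :: int))" by (auto simp: V_def)
    have cm: "?q (l0 [^]\<^bsub>sd\<^esub> m) \<otimes>\<^bsub>sd Mod W'\<^esub> ?q g = ?q g \<otimes>\<^bsub>sd Mod W'\<^esub> ?q (l0 [^]\<^bsub>sd\<^esub> m)"
    proof (rule q.H.generate_commute)
      show "?q ` {l0} \<subseteq> carrier (sd Mod W')" using l0c q.hom_closed by blast
      show "?q g \<in> carrier (sd Mod W')" using g by (rule q.hom_closed)
      have "l0 [^]\<^bsub>sd\<^esub> m \<in> generate sd {l0}"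
        using l0c by (intro sd.subgroup_int_pow_closed[OF sd.generate_is_subgroup] generate.incl) auto
      then show "?q (l0 [^]\<^bsub>sd\<^esub> m) \<in> generate (sd Mod W') (?q ` {l0})"
        using q.generate_img[of "{l0}"] l0c by blast
      show "a \<otimes>\<^bsub>sd Mod W'\<^esub> ?q g = ?q g \<otimes>\<^bsub>sd Mod W'\<^esub> a" if "a \<in> ?q ` {l0}" for a
        using that central[OF g] by auto
    qed
    have "?q (g \<odot> v \<odot> inv\<^sub>s g) = ?q (l0 [^]\<^bsub>sd\<^esub> m) \<otimes>\<^bsub>sd Mod W'\<^esub> ?q g \<otimes>\<^bsub>sd Mod W'\<^esub> ?q (inv\<^sub>s g)"
      using g v cm by (simp only: q.hom_mult sd.m_closed sd.inv_closed)
    also have "\<dots> = ?q (l0 [^]\<^bsub>sd\<^esub> m \<odot> g \<odot> inv\<^sub>s g)"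
      using g powc by (simp only: q.hom_mult sd.m_closed sd.inv_closed)
    also have "l0 [^]\<^bsub>sd\<^esub> m \<odot> g \<odot> inv\<^sub>s g = l0 [^]\<^bsub>sd\<^esub> m"
      using g powc[of m] by (simp add: sd.m_assoc)
    finally show "g \<odot> v \<odot> inv\<^sub>s g \<in> V" unfolding V_def using g v by blast
  qed
  have LV: "L \<subseteq> V"
  proof
    fix l assume l: "l \<in> L"
    then have lK: "l \<in> K" using L(2) by (auto simp: K_def)
    have "fst (rest l) \<in> W" using l J1W by (auto simp: J1_def M_def)
    then have r: "rest l \<in> W'" using rest(1)[OF lK] by (force simp: W'_def)
    then have rc: "rest l \<in> carrier sd" using W.subset by (auto simp: W'_def sd_simps)
    have "?q l = ?q (rest l \<odot> l0 [^]\<^bsub>sd\<^esub> (deg l div deg l0))" using rest(3)[OF lK] by simp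
    also have "\<dots> = \<one>\<^bsub>sd Mod W'\<^esub> \<otimes>\<^bsub>sd Mod W'\<^esub> ?q (l0 [^]\<^bsub>sd\<^esub> (deg l div deg l0))"
      unfolding q.hom_mult[OF rc powc] q1[OF r] ..
    also have "\<dots> = ?q (l0 [^]\<^bsub>sd\<^esub> (deg l div deg l0))" by (rule q.H.l_one[OF q.hom_closed[OF powc]])
    finally show "l \<in> V" unfolding V_def using K_carrier[OF lK] by blast
  qed
  have "J \<subseteq> W"
  proof
    fix j assume j: "j \<in> J"
    then have jK: "(j, 0) \<in> K" using K0 by (simp add: J_def)
    then have jc: "(j, 0) \<in> carrier sd" by (rule K_carrier)
    have "(j, 0) \<in> V" using jK L(3) sd.normal_closure_least[OF nV LV] by (auto simp: K_def)
    then obtain m where m: "?q (j, 0) = ?q (l0 [^]\<^bsub>sd\<^esub> (m :: int))" by (auto simp: V_def)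
    let ?x = "(j, 0) \<odot> inv\<^sub>s (l0 [^]\<^bsub>sd\<^esub> m)"
    have xc: "?x \<in> carrier sd" using jc powc[of m] by blast
    have "?q ?x = \<one>\<^bsub>sd Mod W'\<^esub>"
      unfolding q.hom_mult[OF jc sd.inv_closed[OF powc]] q.hom_inv[OF powc] m
      by (rule q.H.r_inv[OF q.hom_closed[OF powc]])
    then have "?x \<in> kernel sd (sd Mod W') ?q" unfolding kernel_def using xc by blast
    then have xW: "?x \<in> W'" unfolding qq(4) .
    then have "deg ?x = 0" by (auto simp: W'_def deg_def)
    then have "m * deg l0 = 0"
      using deg_mult[of "(j, 0)" "inv\<^sub>s (l0 [^]\<^bsub>sd\<^esub> m)"] deg_inv[OF powc] deg_pow[OF l0c] by (simp add: deg_def)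
    \<comment> \<open>Either \<open>m = 0\<close>, or \<open>deg l0 = 0\<close> and
      \<open>l0\<close> was chosen trivial.\<close>
    then have "l0 [^]\<^bsub>sd\<^esub> m = \<one>\<^sub>s" using l0(3) by auto
    then have "(j, 0) \<in> W'" using xW jc by simp
    then show "j \<in> W" by (auto simp: W'_def)
  qed
  then have "kernel E P \<pi> = normal_closure E J1" using WJ by (auto simp: J_def W_def)
  then show ?thesis using finJ1 J1c by blast
qed

section \<open>A finitely presented cover of the fibre product\<close>

text \<open>Tagged letters: \<open>X\<close> and \<open>Y\<close> may overlap, and each element of
  \<open>Y\<close> is used on both sides.\<close>

datatype 'a gen = Hat 'a | Lft 'a | Rgt 'a

abbreviation sgn_elt :: "('a, 'm) monoid_scheme \<Rightarrow> bool \<Rightarrow> 'a \<Rightarrow> 'a" where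
  "sgn_elt G b x \<equiv> (if b then x else inv\<^bsub>G\<^esub> x)"

definition comt :: "('a, 'm) monoid_scheme \<Rightarrow> 'a \<Rightarrow> 'a \<Rightarrow> 'a" where
  "comt G x y = x \<otimes>\<^bsub>G\<^esub> y \<otimes>\<^bsub>G\<^esub> inv\<^bsub>G\<^esub> x \<otimes>\<^bsub>G\<^esub> inv\<^bsub>G\<^esub> y"

lemma (in group) ex_word_generate:
  assumes Y: "Y \<subseteq> carrier G" and n: "n \<in> generate G Y"
  shows "\<exists>w\<in>words Y. word_val G (\<lambda>y. y) w = n"
  using n
proof (induction rule: generate.induct)
  case one then show ?case by (intro bexI[of _ "[]"]) auto
next
  case (incl y) then show ?case using Y by (intro bexI[of _ "[(y, True)]"]) auto
next
  case (inv y) then show ?case using Y by (intro bexI[of _ "[(y, False)]"]) auto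
next
  case (eng g h)
  then obtain u v where "u \<in> words Y" "word_val G (\<lambda>y. y) u = g" "v \<in> words Y" "word_val G (\<lambda>y. y) v = h" by blast
  then show ?case using word_val_append[of "\<lambda>y. y" Y u v] Y by (intro bexI[of _ "u @ v"]) auto
qed

text \<open>Conjugation is tested with each generator and its inverse, since one sign alone might
  map the subgroup properly into itself.\<close>

lemma (in group) generate_normalI:
  assumes S: "S \<subseteq> carrier G" "generate G S = carrier G" and W: "W \<subseteq> carrier G"
    and conj: "\<And>s w. s \<in> S \<Longrightarrow> w \<in> W \<Longrightarrow> s \<otimes> w \<otimes> inv s \<in> generate G W \<and> inv s \<otimes> w \<otimes> s \<in> generate G W"
  shows "generate G W \<lhd> G"
proof -
  have sub: "subgroup (generate G W) G" by (rule generate_is_subgroup[OF W])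
  have Wc: "w \<in> carrier G" if "w \<in> generate G W" for w using generate_in_carrier[OF W that] .
  have one: "s \<otimes> w \<otimes> inv s \<in> generate G W"
    if s: "s \<in> carrier G" and c: "\<And>w. w \<in> W \<Longrightarrow> s \<otimes> w \<otimes> inv s \<in> generate G W" and w: "w \<in> generate G W" for s w
    using w
  proof (induction rule: generate.induct)
    case one then show ?case using s by (simp add: generate.one)
  next
    case (incl w) then show ?case by (rule c)
  next
    case (inv w)
    have wc: "w \<in> carrier G" using inv W by auto
    have "inv (s \<otimes> w \<otimes> inv s) \<in> generate G W" using subgroup.m_inv_closed[OF sub c[OF inv]] .
    then show ?case using s wc by (simp add: inv_mult_group m_assoc)
  next
    case (eng u v)
    have uv: "u \<in> carrier G" "v \<in> carrier G" using eng Wc by auto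
    have "(s \<otimes> u \<otimes> inv s) \<otimes> (s \<otimes> v \<otimes> inv s) \<in> generate G W" using eng.IH by (rule generate.eng)
    then show ?case using s uv by (simp add: m_assoc)
  qed
  show ?thesis
  proof (rule normal_invI[OF sub])
    fix g w assume "g \<in> carrier G" and w: "w \<in> generate G W"
    then have "g \<in> generate G S" using S by simp
    then have "\<forall>w\<in>generate G W. g \<otimes> w \<otimes> inv g \<in> generate G W"
    proof (induction rule: generate.induct)
      case one then show ?case using Wc by auto
    next
      case (incl s) then show ?case using one[of s] conj S by blast
    next
      case (inv s)
      have "s \<in> carrier G" using inv S by auto
      then show ?case using one[of "inv s"] conj[OF inv] by simp
    next
      case (eng g h)
      have c: "g \<in> carrier G" "h \<in> carrier G" using eng S(2) by auto
      show ?case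
      proof
        fix w assume w: "w \<in> generate G W"
        have "g \<otimes> (h \<otimes> w \<otimes> inv h) \<otimes> inv g \<in> generate G W" using eng.IH w by blast
        then show "g \<otimes> h \<otimes> w \<otimes> inv (g \<otimes> h) \<in> generate G W"
          using c Wc[OF w] by (simp add: m_assoc inv_mult_group)
      qed
    qed
    then show "g \<otimes> w \<otimes> inv g \<in> generate G W" using w by blast
  qed
qed

section \<open>The relations of the cover\<close>

locale cover_data = group G for G :: "('a, 'm) monoid_scheme" (structure) +
  fixes X Y :: "'a set" and t :: 'a
  assumes X: "finite X" "X \<subseteq> carrier G" "generate G X = carrier G" and t: "t \<in> X"
    and Y: "finite Y" "Y \<subseteq> carrier G" and derived_sub: "derived G (carrier G) \<subseteq> generate G Y"
begin

definition N where "N = generate G Y"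

text \<open>The word for \<open>\<one>\<close> is fixed to be empty. A trivial commutator then
  contributes no letters, and twisting fixes the letter of \<open>t\<close> in
  \<open>hat'_t\<close>.\<close>

definition wd where "wd n = (if n = \<one> then [] else SOME w. w \<in> words Y \<and> word_val G (\<lambda>y. y) w = n)"

lemma wd: "n \<in> N \<Longrightarrow> wd n \<in> words Y" "n \<in> N \<Longrightarrow> word_val G (\<lambda>y. y) (wd n) = n" "wd \<one> = []"
  using ex_word_generate[OF Y(2), of n] someI_ex[of "\<lambda>w. w \<in> words Y \<and> word_val G (\<lambda>y. y) w = n"]
  by (auto simp: wd_def N_def)

lemma subgroup_N: "subgroup N G"
  unfolding N_def by (rule generate_is_subgroup[OF Y(2)])

lemma normal_N: "N \<lhd> G"
  using normal_if_derived_subset[OF subgroup_N] derived_sub by (simp add: N_def)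

lemma comt_N: "x \<in> carrier G \<Longrightarrow> y \<in> carrier G \<Longrightarrow> comt G x y \<in> N"
  using derived_sub unfolding N_def derived_def comt_def by (blast intro: generate.incl)

lemma Y_N: "Y \<subseteq> N"
  unfolding N_def by (blast intro: generate.incl)

text \<open>Relations for a cover \<open>K\<close> of the fibre product, where \<open>h x\<close>, \<open>l y\<close>, \<open>r y\<close> lift \<open>(x, x\<inverse>)\<close>,
  \<open>(y, 1)\<close>, \<open>(1, y)\<close>. The first four families make the two factors normal and commuting with
  abelian quotient. The other three are what is needed to lift the conjugation by \<open>(t, 1)\<close>: they
  say how \<open>h t\<close> acts on \<open>h x\<close>, that this action respects the relations between \<open>h x\<close> and \<open>h y\<close>
  (a Hall-Witt type identity in the first factor), and that it is invertible.\<close>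

definition rels :: "('k, 'n) monoid_scheme \<Rightarrow> ('a \<Rightarrow> 'k) \<Rightarrow> ('a \<Rightarrow> 'k) \<Rightarrow> ('a \<Rightarrow> 'k) \<Rightarrow> bool" where
  "rels K h l r \<longleftrightarrow>
    (\<forall>x\<in>X. \<forall>b. \<forall>y\<in>Y. sgn_elt K b (h x) \<otimes>\<^bsub>K\<^esub> (l y \<otimes>\<^bsub>K\<^esub> sgn_elt K (\<not> b) (h x))
       = word_val K l (wd (sgn_elt G b x \<otimes> y \<otimes> inv (sgn_elt G b x)))) \<and>
    (\<forall>x\<in>X. \<forall>b. \<forall>y\<in>Y. sgn_elt K b (h x) \<otimes>\<^bsub>K\<^esub> (r y \<otimes>\<^bsub>K\<^esub> sgn_elt K (\<not> b) (h x))
       = word_val K r (wd (inv (sgn_elt G b x) \<otimes> y \<otimes> sgn_elt G b x))) \<and>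
    (\<forall>y\<in>Y. \<forall>z\<in>Y. l y \<otimes>\<^bsub>K\<^esub> r z = r z \<otimes>\<^bsub>K\<^esub> l y) \<and>
    (\<forall>x\<in>X. \<forall>y\<in>X. h x \<otimes>\<^bsub>K\<^esub> h y
       = word_val K l (wd (comt G x y)) \<otimes>\<^bsub>K\<^esub> (word_val K r (wd (comt G (inv x) (inv y))) \<otimes>\<^bsub>K\<^esub> (h y \<otimes>\<^bsub>K\<^esub> h x))) \<and>
    (\<forall>b. \<forall>x\<in>X. sgn_elt K b (h t) \<otimes>\<^bsub>K\<^esub> h x
       = word_val K l (wd (comt G (sgn_elt G b t) x)) \<otimes>\<^bsub>K\<^esub> (h x \<otimes>\<^bsub>K\<^esub>
         (word_val K r (wd (comt G x (inv (sgn_elt G b t)))) \<otimes>\<^bsub>K\<^esub> sgn_elt K b (h t)))) \<and>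
    (\<forall>b. \<forall>x\<in>X. \<forall>y\<in>X. word_val K l (wd (comt G (sgn_elt G b t) x)) \<otimes>\<^bsub>K\<^esub> (h x \<otimes>\<^bsub>K\<^esub>
         (word_val K l (wd (comt G (sgn_elt G b t) y)) \<otimes>\<^bsub>K\<^esub> (sgn_elt K False (h x) \<otimes>\<^bsub>K\<^esub> word_val K l (wd (comt G x y)))))
       = sgn_elt K b (h t) \<otimes>\<^bsub>K\<^esub> (word_val K l (wd (comt G x y)) \<otimes>\<^bsub>K\<^esub> (sgn_elt K (\<not> b) (h t) \<otimes>\<^bsub>K\<^esub>
         (word_val K l (wd (comt G (sgn_elt G b t) y)) \<otimes>\<^bsub>K\<^esub> (h y \<otimes>\<^bsub>K\<^esub>
           (word_val K l (wd (comt G (sgn_elt G b t) x)) \<otimes>\<^bsub>K\<^esub> sgn_elt K False (h y))))))) \<and>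
    (\<forall>b. \<forall>x\<in>X. sgn_elt K b (h t) \<otimes>\<^bsub>K\<^esub> (word_val K l (wd (comt G (sgn_elt G (\<not> b) t) x)) \<otimes>\<^bsub>K\<^esub>
        (sgn_elt K (\<not> b) (h t) \<otimes>\<^bsub>K\<^esub> word_val K l (wd (comt G (sgn_elt G b t) x)))) = \<one>\<^bsub>K\<^esub>)"

abbreviation gens :: "'a gen set" where
  "gens \<equiv> Hat ` X \<union> Lft ` Y \<union> Rgt ` Y"

abbreviation hw :: "bool \<Rightarrow> 'a \<Rightarrow> 'a gen word" where "hw b x \<equiv> [(Hat x, b)]"
abbreviation lw :: "'a \<Rightarrow> 'a gen word" where "lw n \<equiv> map (apfst Lft) (wd n)"
abbreviation rw :: "'a \<Rightarrow> 'a gen word" where "rw n \<equiv> map (apfst Rgt) (wd n)"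

abbreviation eqn :: "'a gen word \<Rightarrow> 'a gen word \<Rightarrow> 'a gen word" where "eqn u v \<equiv> u @ word_inv v"

text \<open>The families of \<open>rels\<close> as words. The predicate is kept apart from the words
  because it is evaluated for several triples of maps: the generators of the cover, their twisted
  versions, and the pairs in \<open>G \<times>\<times> G\<close>.\<close>

definition relators :: "'a gen word set" where
  "relators =
    (\<lambda>(x, b, y). eqn (hw b x @ [(Lft y, True)] @ hw (\<not> b) x)
       (lw (sgn_elt G b x \<otimes> y \<otimes> inv (sgn_elt G b x)))) ` (X \<times> UNIV \<times> Y) \<union>
    (\<lambda>(x, b, y). eqn (hw b x @ [(Rgt y, True)] @ hw (\<not> b) x)
       (rw (inv (sgn_elt G b x) \<otimes> y \<otimes> sgn_elt G b x))) ` (X \<times> UNIV \<times> Y) \<union>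
    (\<lambda>(y, z). eqn ([(Lft y, True)] @ [(Rgt z, True)]) ([(Rgt z, True)] @ [(Lft y, True)])) ` (Y \<times> Y) \<union>
    (\<lambda>(x, y). eqn (hw True x @ hw True y)
       (lw (comt G x y) @ rw (comt G (inv x) (inv y)) @ hw True y @ hw True x)) ` (X \<times> X) \<union>
    (\<lambda>(b, x). eqn (hw b t @ hw True x)
       (lw (comt G (sgn_elt G b t) x) @ hw True x @ rw (comt G x (inv (sgn_elt G b t))) @ hw b t)) ` (UNIV \<times> X) \<union>
    (\<lambda>(b, x, y). eqn (lw (comt G (sgn_elt G b t) x) @ hw True x @ lw (comt G (sgn_elt G b t) y) @ hw False x @ lw (comt G x y))
       (hw b t @ lw (comt G x y) @ hw (\<not> b) t @ lw (comt G (sgn_elt G b t) y) @ hw True y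
         @ lw (comt G (sgn_elt G b t) x) @ hw False y)) ` (UNIV \<times> X \<times> X) \<union>
    (\<lambda>(b, x). eqn (hw b t @ lw (comt G (sgn_elt G (\<not> b) t) x) @ hw (\<not> b) t @ lw (comt G (sgn_elt G b t) x)) []) ` (UNIV \<times> X)"

lemma finite_relators: "finite relators"
  unfolding relators_def using X(1) Y(1) by (intro finite_UnI finite_imageI finite_cartesian_product) auto

lemma wd_in_gens:
  "n \<in> N \<Longrightarrow> lw n \<in> words gens" "n \<in> N \<Longrightarrow> rw n \<in> words gens"
proof -
  have "map (apfst Lft) w \<in> words gens" "map (apfst Rgt) w \<in> words gens" if "w \<in> words Y" for w
    using that by (induction w) (auto simp: Cons_in_words)
  then show "n \<in> N \<Longrightarrow> lw n \<in> words gens" "n \<in> N \<Longrightarrow> rw n \<in> words gens" using wd(1) by auto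
qed

lemma conj_N: "x \<in> X \<Longrightarrow> y \<in> Y \<Longrightarrow> sgn_elt G b x \<otimes> y \<otimes> inv (sgn_elt G b x) \<in> N"
  "x \<in> X \<Longrightarrow> y \<in> Y \<Longrightarrow> inv (sgn_elt G b x) \<otimes> y \<otimes> sgn_elt G b x \<in> N"
proof -
  assume xy: "x \<in> X" "y \<in> Y"
  have c: "sgn_elt G b x \<in> carrier G" "y \<in> N" using xy X Y_N by auto
  show "sgn_elt G b x \<otimes> y \<otimes> inv (sgn_elt G b x) \<in> N" using normal.inv_op_closed2[OF normal_N c] .
  show "inv (sgn_elt G b x) \<otimes> y \<otimes> sgn_elt G b x \<in> N" using normal.inv_op_closed1[OF normal_N c] .
qed

lemma comts_N:
  "x \<in> X \<Longrightarrow> y \<in> X \<Longrightarrow> comt G x y \<in> N"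
  "x \<in> X \<Longrightarrow> y \<in> X \<Longrightarrow> comt G (inv x) (inv y) \<in> N"
  "x \<in> X \<Longrightarrow> comt G (sgn_elt G b t) x \<in> N"
  "x \<in> X \<Longrightarrow> comt G x (inv (sgn_elt G b t)) \<in> N"
  using X t by (auto intro!: comt_N)

lemma hw_in_gens: "x \<in> X \<Longrightarrow> hw b x \<in> words gens"
  "y \<in> Y \<Longrightarrow> [(Lft y, b)] \<in> words gens" "y \<in> Y \<Longrightarrow> [(Rgt y, b)] \<in> words gens"
  by auto

lemma relators_in_words: "relators \<subseteq> words gens"
  unfolding relators_def
  by (intro Un_least image_subsetI; clarsimp simp del: if_split simp: hw_in_gens comts_N conj_N wd_in_gens word_inv_in_words t)

lemma eqn_iff:
  assumes K: "group K" and f: "f \<in> gens \<rightarrow> carrier K" and u: "u \<in> words gens" and v: "v \<in> words gens"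
  shows "word_val K f (eqn u v) = \<one>\<^bsub>K\<^esub> \<longleftrightarrow> word_val K f u = word_val K f v"
proof -
  interpret K: group K by fact
  have c: "word_val K f u \<in> carrier K" "word_val K f v \<in> carrier K" using u v K.word_val_closed[OF f] by auto
  have "word_val K f (eqn u v) = word_val K f u \<otimes>\<^bsub>K\<^esub> inv\<^bsub>K\<^esub> word_val K f v"
    using u v by (simp add: K.word_val_append[OF f] K.word_val_word_inv[OF f] word_inv_in_words)
  then show ?thesis using c K.inv_equality[of "word_val K f u" "inv\<^bsub>K\<^esub> word_val K f v"] by auto
qed

lemma relators_iff:
  assumes K: "group K" and f: "f \<in> gens \<rightarrow> carrier K"
  shows "(\<forall>\<rho>\<in>relators. word_val K f \<rho> = \<one>\<^bsub>K\<^esub>) \<longleftrightarrow> rels K (f \<circ> Hat) (f \<circ> Lft) (f \<circ> Rgt)"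
proof -
  interpret K: group K by fact
  have e: "word_val K f (hw b x) = sgn_elt K b ((f \<circ> Hat) x)" if "x \<in> X" for b x
    using that f by (auto simp: Pi_iff)
  have el: "word_val K f [(Lft y, True)] = (f \<circ> Lft) y" "word_val K f [(Rgt y, True)] = (f \<circ> Rgt) y" if "y \<in> Y" for y
    using that f by (auto simp: Pi_iff)
  note app = K.word_val_append[OF f]
  note facts = hw_in_gens comts_N conj_N wd_in_gens t words_simps(1,3)
  show ?thesis
    unfolding relators_def rels_def ball_Un conj_assoc
    apply (intro arg_cong2[where f = "(\<and>)"]; simp only: ball_simps(9) split_paired_Ball_Sigma prod.case ball_UNIV)
          apply (intro ball_cong all_cong1 HOL.refl; subst eqn_iff[OF K f]; simp only: facts app e el word_val_map_apfst if_True if_False word_val.simps(1) simp_thms)+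
    done
qed

end

lemma (in group) word_val_conj:
  assumes f: "f \<in> Y \<rightarrow> carrier G" and w: "w \<in> words Y" and g: "g \<in> carrier G"
  shows "word_val G (\<lambda>y. g \<otimes> f y \<otimes> inv g) w = g \<otimes> word_val G f w \<otimes> inv g"
  using w
proof (induction w)
  case (Cons a w)
  have "f (fst a) \<in> carrier G" "word_val G f w \<in> carrier G"
    using Cons.prems f word_val_closed[OF f] by (auto simp: Cons_in_words)
  with Cons g show ?case by (simp add: Cons_in_words m_assoc inv_mult_group)
qed (use g in simp)

section \<open>Twisting in a group that satisfies the relations\<close>

locale cover_group = cover_data G X Y t + K: group K
  for G :: "('a, 'm) monoid_scheme" (structure) and X Y t and K :: "('k, 'n) monoid_scheme" (structure) +
  fixes h l r :: "'a \<Rightarrow> 'k"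
  assumes hX: "h \<in> X \<rightarrow> carrier K" and lY: "l \<in> Y \<rightarrow> carrier K" and rY: "r \<in> Y \<rightarrow> carrier K"
    and rels: "rels K h l r" and gen: "generate K (h ` X \<union> l ` Y \<union> r ` Y) = carrier K"
begin

abbreviation K_mult (infixl "\<cdot>" 70) where "a \<cdot> b \<equiv> a \<otimes>\<^bsub>K\<^esub> b"
abbreviation K_inv ("inv\<^sub>K _" [81] 80) where "inv\<^sub>K a \<equiv> inv\<^bsub>K\<^esub> a"

abbreviation L where "L n \<equiv> word_val K l (wd n)"
abbreviation R where "R n \<equiv> word_val K r (wd n)"
abbreviation tw where "tw b \<equiv> sgn_elt K b (h t)"
abbreviation cc where "cc b x \<equiv> L (comt G (sgn_elt G b t) x)"

definition A where "A = generate K (l ` Y)"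
definition B where "B = generate K (r ` Y)"

lemma closed:
  "x \<in> X \<Longrightarrow> h x \<in> carrier K" "y \<in> Y \<Longrightarrow> l y \<in> carrier K" "y \<in> Y \<Longrightarrow> r y \<in> carrier K"
  "tw b \<in> carrier K"
  using hX lY rY t by auto

lemma sgn_not: "x \<in> carrier K \<Longrightarrow> sgn_elt K (\<not> b) x = inv\<^sub>K (sgn_elt K b x)"
  by auto

lemma lsub: "l ` Y \<subseteq> carrier K" and rsub: "r ` Y \<subseteq> carrier K" and hsub: "h ` X \<subseteq> carrier K"
  using hX lY rY by auto

lemma subgroup_A: "subgroup A K" and subgroup_B: "subgroup B K"
  unfolding A_def B_def by (rule K.generate_is_subgroup[OF lsub], rule K.generate_is_subgroup[OF rsub])

lemma A_closed: "a \<in> A \<Longrightarrow> a \<in> carrier K" and B_closed: "b \<in> B \<Longrightarrow> b \<in> carrier K"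
  using subgroup.mem_carrier[OF subgroup_A] subgroup.mem_carrier[OF subgroup_B] by auto

lemma L_in_A: "n \<in> N \<Longrightarrow> L n \<in> A" and R_in_B: "n \<in> N \<Longrightarrow> R n \<in> B"
  unfolding A_def B_def using K.word_val_in_generate[OF lY] K.word_val_in_generate[OF rY] wd(1) by auto

lemma cc_in_A: "x \<in> X \<Longrightarrow> cc b x \<in> A"
  by (intro L_in_A comts_N)

lemmas rels' = rels[unfolded rels_def]

lemma rel_l: "x \<in> X \<Longrightarrow> y \<in> Y \<Longrightarrow> sgn_elt K b (h x) \<cdot> l y \<cdot> inv\<^sub>K (sgn_elt K b (h x))
    = L (sgn_elt G b x \<otimes> y \<otimes> inv (sgn_elt G b x))"
  using rels'[THEN conjunct1, THEN bspec, THEN spec[of _ b], THEN bspec, of x y] closed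
  by (cases b) (simp_all add: K.m_assoc)

lemma rel_r: "x \<in> X \<Longrightarrow> y \<in> Y \<Longrightarrow> sgn_elt K b (h x) \<cdot> r y \<cdot> inv\<^sub>K (sgn_elt K b (h x))
    = R (inv (sgn_elt G b x) \<otimes> y \<otimes> sgn_elt G b x)"
  using rels'[THEN conjunct2, THEN conjunct1, THEN bspec, THEN spec[of _ b], THEN bspec, of x y] closed
  by (cases b) (simp_all add: K.m_assoc)

lemma rel_lr: "y \<in> Y \<Longrightarrow> z \<in> Y \<Longrightarrow> l y \<cdot> r z = r z \<cdot> l y"
  using rels'[THEN conjunct2, THEN conjunct2, THEN conjunct1] by blast

lemma rel_hh: "x \<in> X \<Longrightarrow> y \<in> X \<Longrightarrow> h x \<cdot> h y
    = L (comt G x y) \<cdot> (R (comt G (inv x) (inv y)) \<cdot> (h y \<cdot> h x))"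
  using rels'[THEN conjunct2, THEN conjunct2, THEN conjunct2, THEN conjunct1] by blast

lemma rel_th: "x \<in> X \<Longrightarrow> tw b \<cdot> h x
    = cc b x \<cdot> (h x \<cdot> (R (comt G x (inv (sgn_elt G b t))) \<cdot> tw b))"
  using rels'[THEN conjunct2, THEN conjunct2, THEN conjunct2, THEN conjunct2, THEN conjunct1] by blast

text \<open>With the conjugations made visible, this is the identity in \<open>A\<close> that
  remains when the relation between \<open>h x\<close> and \<open>h y\<close> is required of their
  twisted versions.\<close>

lemma rel_cube: "x \<in> X \<Longrightarrow> y \<in> X \<Longrightarrow>
    cc b x \<cdot> (h x \<cdot> cc b y \<cdot> inv\<^sub>K h x) \<cdot> L (comt G x y)
    = (tw b \<cdot> L (comt G x y) \<cdot> inv\<^sub>K (tw b)) \<cdot> (cc b y \<cdot> (h y \<cdot> cc b x \<cdot> inv\<^sub>K h y))"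
  using rels'[THEN conjunct2, THEN conjunct2, THEN conjunct2, THEN conjunct2, THEN conjunct2, THEN conjunct1,
      rule_format, of x y b] closed A_closed[OF cc_in_A] A_closed[OF L_in_A[OF comts_N(1)]] t
  by (simp add: K.m_assoc)

lemma rel_inv: "x \<in> X \<Longrightarrow> tw b \<cdot> cc (\<not> b) x \<cdot> inv\<^sub>K (tw b) \<cdot> cc b x = \<one>\<^bsub>K\<^esub>"
  using rels'[THEN conjunct2, THEN conjunct2, THEN conjunct2, THEN conjunct2, THEN conjunct2, THEN conjunct2,
      THEN spec[of _ b], THEN bspec, of x] closed A_closed[OF cc_in_A[of x True]] A_closed[OF cc_in_A[of x False]] t
  by (cases b) (simp_all add: K.m_assoc)

lemma comm_AB:
  assumes a: "a \<in> A" and b: "b \<in> B"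
  shows "a \<cdot> b = b \<cdot> a"
proof (rule K.generate_commute[OF lsub B_closed[OF b] _ a[unfolded A_def]])
  fix u assume "u \<in> l ` Y"
  then obtain y where y: "y \<in> Y" "u = l y" by blast
  have "b \<cdot> u = u \<cdot> b"
    by (rule K.generate_commute[OF rsub _ _ b[unfolded B_def]]) (use y closed rel_lr in auto)
  then show "u \<cdot> b = b \<cdot> u" ..
qed

lemma conj_AB: "a \<in> A \<Longrightarrow> b \<in> B \<Longrightarrow> b \<cdot> a \<cdot> inv\<^sub>K b = a" "a \<in> A \<Longrightarrow> b \<in> B \<Longrightarrow> a \<cdot> b \<cdot> inv\<^sub>K a = b"
  using comm_AB[of a b] A_closed[of a] B_closed[of b] K.m_assoc K.r_inv K.r_one K.inv_closed by metis+

text \<open>Conjugates of generators by \<open>h x\<close> are prescribed by the relations, those by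
  elements of \<open>A\<close> stay in \<open>A\<close>, and elements of \<open>B\<close> act
  trivially.\<close>

lemma normal_A: "A \<lhd> K" unfolding A_def
proof (rule K.generate_normalI[OF _ gen lsub])
  show "h ` X \<union> l ` Y \<union> r ` Y \<subseteq> carrier K" using hsub lsub rsub by blast
  fix s w assume "s \<in> h ` X \<union> l ` Y \<union> r ` Y" and "w \<in> l ` Y"
  then obtain y where y: "y \<in> Y" "w = l y" by blast
  have wA: "w \<in> A" unfolding A_def by (rule generate.incl) fact
  consider x where "x \<in> X" "s = h x" | "s \<in> A" | "s \<in> B"
    using \<open>s \<in> _\<close> unfolding A_def B_def by (blast intro: generate.incl)
  then show "s \<cdot> w \<cdot> inv\<^sub>K s \<in> generate K (l ` Y) \<and> inv\<^sub>K s \<cdot> w \<cdot> s \<in> generate K (l ` Y)"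
  proof cases
    case 1
    show ?thesis unfolding A_def[symmetric]
      using rel_l[OF 1(1) y(1), of True] rel_l[OF 1(1) y(1), of False] L_in_A[OF conj_N(1)[OF 1(1) y(1)], of True]
        L_in_A[OF conj_N(1)[OF 1(1) y(1)], of False] 1 y closed by simp
  next
    case 2
    then show ?thesis unfolding A_def[symmetric]
      using wA subgroup.m_closed[OF subgroup_A] subgroup.m_inv_closed[OF subgroup_A] by simp
  next
    case 3
    then show ?thesis unfolding A_def[symmetric]
      using wA conj_AB(1)[OF wA 3] conj_AB(1)[OF wA subgroup.m_inv_closed[OF subgroup_B 3]] B_closed[OF 3] by simp
  qed
qed

lemma normal_B: "B \<lhd> K" unfolding B_def
proof (rule K.generate_normalI[OF _ gen rsub])
  show "h ` X \<union> l ` Y \<union> r ` Y \<subseteq> carrier K" using hsub lsub rsub by blast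
  fix s w assume "s \<in> h ` X \<union> l ` Y \<union> r ` Y" and "w \<in> r ` Y"
  then obtain y where y: "y \<in> Y" "w = r y" by blast
  have wB: "w \<in> B" unfolding B_def by (rule generate.incl) fact
  consider x where "x \<in> X" "s = h x" | "s \<in> A" | "s \<in> B"
    using \<open>s \<in> _\<close> unfolding A_def B_def by (blast intro: generate.incl)
  then show "s \<cdot> w \<cdot> inv\<^sub>K s \<in> generate K (r ` Y) \<and> inv\<^sub>K s \<cdot> w \<cdot> s \<in> generate K (r ` Y)"
  proof cases
    case 1
    show ?thesis unfolding B_def[symmetric]
      using rel_r[OF 1(1) y(1), of True] rel_r[OF 1(1) y(1), of False] R_in_B[OF conj_N(2)[OF 1(1) y(1)], of True]
        R_in_B[OF conj_N(2)[OF 1(1) y(1)], of False] 1 y closed by simp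
  next
    case 2
    then show ?thesis unfolding B_def[symmetric]
      using wB conj_AB(2)[OF 2 wB] conj_AB(2)[OF subgroup.m_inv_closed[OF subgroup_A 2] wB] A_closed[OF 2] by simp
  next
    case 3
    then show ?thesis unfolding B_def[symmetric]
      using wB subgroup.m_closed[OF subgroup_B] subgroup.m_inv_closed[OF subgroup_B] by simp
  qed
qed

lemma A_conj: "g \<in> carrier K \<Longrightarrow> a \<in> A \<Longrightarrow> g \<cdot> a \<cdot> inv\<^sub>K g \<in> A"
  "g \<in> carrier K \<Longrightarrow> a \<in> A \<Longrightarrow> inv\<^sub>K g \<cdot> a \<cdot> g \<in> A"
  using normal.inv_op_closed2[OF normal_A] normal.inv_op_closed1[OF normal_A] by auto

lemma B_conj: "g \<in> carrier K \<Longrightarrow> b \<in> B \<Longrightarrow> g \<cdot> b \<cdot> inv\<^sub>K g \<in> B"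
  "g \<in> carrier K \<Longrightarrow> b \<in> B \<Longrightarrow> inv\<^sub>K g \<cdot> b \<cdot> g \<in> B"
  using normal.inv_op_closed2[OF normal_B] normal.inv_op_closed1[OF normal_B] by auto

text \<open>The lift to \<open>K\<close> of the conjugation by \<open>(t, 1)\<close> or its inverse: \<open>tw b\<close> lifts \<open>(t, t\<inverse>)\<close>,
  whose second component acts trivially on \<open>A\<close>.\<close>

definition hat' where "hat' b x = cc b x \<cdot> h x"
definition lft' where "lft' b y = tw b \<cdot> l y \<cdot> inv\<^sub>K (tw b)"

lemma hat'_closed: "x \<in> X \<Longrightarrow> hat' b x \<in> carrier K"
  using A_closed[OF cc_in_A] closed by (simp add: hat'_def)

lemma L': "n \<in> N \<Longrightarrow> word_val K (lft' b) (wd n) = tw b \<cdot> L n \<cdot> inv\<^sub>K (tw b)"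
  unfolding lft'_def using K.word_val_conj[OF lY wd(1) closed(4)] by simp

lemma hat'_t: "hat' b t = h t"
proof -
  have "comt G (sgn_elt G b t) t = \<one>" using t X by (auto simp: comt_def m_assoc)
  then show ?thesis using wd(3) closed(1)[OF t] by (simp add: hat'_def)
qed

text \<open>By \<open>rel_th\<close>, \<open>tw b \<cdot> h x\<close> equals
  \<open>hat' b x\<close>, times an element of \<open>B\<close>, times \<open>tw b\<close>, and the
  element of \<open>B\<close> centralizes \<open>A\<close>.\<close>

lemma hat'_conj_True:
  assumes a: "a \<in> A" and x: "x \<in> X"
  shows "hat' b x \<cdot> (tw b \<cdot> a \<cdot> inv\<^sub>K (tw b)) \<cdot> inv\<^sub>K (hat' b x)
    = tw b \<cdot> (h x \<cdot> a \<cdot> inv\<^sub>K h x) \<cdot> inv\<^sub>K (tw b)"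
proof -
  define g where "g = tw b"
  define s where "s = R (comt G x (inv (sgn_elt G b t)))"
  have s: "s \<in> B" unfolding s_def by (intro R_in_B comts_N x)
  have c: "g \<in> carrier K" "h x \<in> carrier K" "hat' b x \<in> carrier K" "s \<in> carrier K" "a \<in> carrier K"
    using closed x hat'_closed B_closed[OF s] A_closed[OF a] by (simp_all only: g_def)
  define m where "m = g \<cdot> a \<cdot> inv\<^sub>K g"
  have m: "m \<in> A" "m \<in> carrier K" unfolding m_def using A_conj(1)[OF c(1) a] A_closed by auto
  have e: "g \<cdot> h x = hat' b x \<cdot> s \<cdot> g"
    using rel_th[OF x, of b] c A_closed[OF cc_in_A[OF x]] by (simp only: g_def[symmetric] s_def[symmetric] hat'_def K.m_assoc K.m_closed)
  have "g \<cdot> (h x \<cdot> a \<cdot> inv\<^sub>K h x) \<cdot> inv\<^sub>K g = (g \<cdot> h x) \<cdot> a \<cdot> inv\<^sub>K (g \<cdot> h x)"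
    using c by (simp add: K.m_assoc K.inv_mult_group)
  also have "\<dots> = hat' b x \<cdot> (s \<cdot> m \<cdot> inv\<^sub>K s) \<cdot> inv\<^sub>K (hat' b x)"
    unfolding e m_def using c by (simp add: K.m_assoc K.inv_mult_group)
  also have "s \<cdot> m \<cdot> inv\<^sub>K s = m" by (rule conj_AB(1)[OF m(1) s])
  finally show ?thesis by (simp only: m_def g_def)
qed

lemma hat'_conj:
  assumes a: "a \<in> A" and x: "x \<in> X"
  shows "sgn_elt K b' (hat' b x) \<cdot> (tw b \<cdot> a \<cdot> inv\<^sub>K (tw b)) \<cdot> inv\<^sub>K (sgn_elt K b' (hat' b x))
    = tw b \<cdot> (sgn_elt K b' (h x) \<cdot> a \<cdot> inv\<^sub>K (sgn_elt K b' (h x))) \<cdot> inv\<^sub>K (tw b)"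
proof (cases b')
  case True
  then show ?thesis using hat'_conj_True[OF assms] by simp
next
  case False
  define g where "g = tw b"
  have c: "g \<in> carrier K" "h x \<in> carrier K" "hat' b x \<in> carrier K" "a \<in> carrier K"
    using closed x hat'_closed A_closed[OF a] by (simp_all only: g_def)
  define m where "m = inv\<^sub>K h x \<cdot> a \<cdot> h x"
  have m: "m \<in> A" "m \<in> carrier K" unfolding m_def using A_conj(2)[OF c(2) a] A_closed by auto
  have "h x \<cdot> m \<cdot> inv\<^sub>K h x = a" using c by (simp add: m_def K.m_assoc)
  then have "hat' b x \<cdot> (g \<cdot> m \<cdot> inv\<^sub>K g) \<cdot> inv\<^sub>K (hat' b x) = g \<cdot> a \<cdot> inv\<^sub>K g"
    using hat'_conj_True[OF m(1) x, of b] by (simp only: g_def)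
  from this[symmetric] have "inv\<^sub>K (hat' b x) \<cdot> (g \<cdot> a \<cdot> inv\<^sub>K g) \<cdot> hat' b x = g \<cdot> m \<cdot> inv\<^sub>K g"
    using c m by (simp add: K.m_assoc)
  then show ?thesis using False c by (simp add: g_def[symmetric] m_def)
qed

text \<open>Together with \<open>presentation_hom_ext\<close> this extends the twisting to an
  endomorphism of the cover. Relations inside \<open>A\<close> are carried along by conjugation with
  \<open>tw b\<close>; the relation between \<open>h x\<close> and \<open>h y\<close> uses
  \<open>rel_cube\<close>, and the one between \<open>t\<close> and \<open>h x\<close> uses
  \<open>rel_inv\<close>.\<close>

lemma twisted_rels: "rels K (hat' b) (lft' b) r"
proof -
  define g where "g = tw b"
  have g: "g \<in> carrier K" unfolding g_def by (rule closed)
  note hc = closed(1) and H = hat'_closed[of _ b]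
  have Lc: "L n \<in> carrier K" if "n \<in> N" for n using A_closed[OF L_in_A[OF that]] .
  have Ag: "g \<cdot> a \<cdot> inv\<^sub>K g \<in> A" if "a \<in> A" for a by (rule A_conj(1)[OF g that])
  note L'g = L'[of _ b, folded g_def]
  have tw_comm: "g \<cdot> tw b' = tw b' \<cdot> g" for b'
    using closed(1)[OF t] by (cases b; cases b') (auto simp: g_def)
  have expand: "x \<cdot> (y \<cdot> sgn_elt K (\<not> b') z) = x \<cdot> y \<cdot> inv\<^sub>K (sgn_elt K b' z)"
    if "x \<in> carrier K" "y \<in> carrier K" "z \<in> carrier K" for x y z b'
    using that by (simp add: K.m_assoc)
  have rel1: "sgn_elt K b' (hat' b x) \<cdot> (lft' b y \<cdot> sgn_elt K (\<not> b') (hat' b x))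
       = word_val K (lft' b) (wd (sgn_elt G b' x \<otimes> y \<otimes> inv (sgn_elt G b' x)))"
    if xy: "x \<in> X" "y \<in> Y" for x b' y
  proof -
    have lA: "l y \<in> A" unfolding A_def using xy by (intro generate.incl) blast
    have c: "sgn_elt K b' (hat' b x) \<in> carrier K" "lft' b y \<in> carrier K"
      using H[OF xy(1)] closed(2)[OF xy(2)] closed(4)[of b] by (simp_all add: lft'_def)
    show ?thesis
      unfolding expand[OF c H[OF xy(1)]] L'[OF conj_N(1)[OF xy]] rel_l[OF xy, symmetric]
      unfolding lft'_def by (rule hat'_conj[OF lA xy(1)])
  qed
  have rel2: "sgn_elt K b' (hat' b x) \<cdot> (r y \<cdot> sgn_elt K (\<not> b') (hat' b x))
       = R (inv (sgn_elt G b' x) \<otimes> y \<otimes> sgn_elt G b' x)"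
    if xy: "x \<in> X" "y \<in> Y" for x b' y
  proof -
    have rB: "r y \<in> B" unfolding B_def using xy by (intro generate.incl) blast
    have c: "h x \<in> carrier K" "r y \<in> carrier K" "cc b x \<in> carrier K"
      using closed xy A_closed[OF cc_in_A] by auto
    have "sgn_elt K b' (hat' b x) \<cdot> r y \<cdot> inv\<^sub>K (sgn_elt K b' (hat' b x))
      = sgn_elt K b' (h x) \<cdot> r y \<cdot> inv\<^sub>K (sgn_elt K b' (h x))"
    proof (cases b')
      case True
      have "cc b x \<cdot> (h x \<cdot> r y \<cdot> inv\<^sub>K h x) \<cdot> inv\<^sub>K cc b x = h x \<cdot> r y \<cdot> inv\<^sub>K h x"
        by (rule conj_AB(2)[OF cc_in_A[OF xy(1)] B_conj(1)[OF c(1) rB]])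
      then show ?thesis using True c by (simp add: hat'_def K.m_assoc K.inv_mult_group)
    next
      case False
      have "inv\<^sub>K cc b x \<cdot> r y \<cdot> inv\<^sub>K (inv\<^sub>K cc b x) = r y"
        by (rule conj_AB(2)[OF subgroup.m_inv_closed[OF subgroup_A cc_in_A[OF xy(1)]] rB])
      then have "inv\<^sub>K h x \<cdot> (inv\<^sub>K cc b x \<cdot> r y \<cdot> cc b x) \<cdot> h x = inv\<^sub>K h x \<cdot> r y \<cdot> h x"
        using c by simp
      then show ?thesis using False c by (simp add: hat'_def K.m_assoc K.inv_mult_group)
    qed
    also have "\<dots> = R (inv (sgn_elt G b' x) \<otimes> y \<otimes> sgn_elt G b' x)" by (rule rel_r[OF xy])
    finally show ?thesis using expand[of "sgn_elt K b' (hat' b x)" "r y" "hat' b x"] H[OF xy(1)] c(2) by simp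
  qed
  have rel3: "lft' b y \<cdot> r z = r z \<cdot> lft' b y" if yz: "y \<in> Y" "z \<in> Y" for y z
  proof (rule comm_AB)
    show "lft' b y \<in> A" unfolding lft'_def
      by (rule A_conj(1)[OF closed(4)]) (unfold A_def, intro generate.incl imageI yz)
    show "r z \<in> B" unfolding B_def by (intro generate.incl imageI yz)
  qed
  have rel4: "hat' b x \<cdot> hat' b y
       = word_val K (lft' b) (wd (comt G x y)) \<cdot> (R (comt G (inv x) (inv y)) \<cdot> (hat' b y \<cdot> hat' b x))"
    if xy: "x \<in> X" "y \<in> X" for x y
  proof -
    define u where "u = L (comt G x y)"
    define v where "v = R (comt G (inv x) (inv y))"
    define m where "m = cc b y \<cdot> (h y \<cdot> cc b x \<cdot> inv\<^sub>K h y)"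
    have u: "u \<in> carrier K" unfolding u_def by (rule Lc[OF comts_N(1)[OF xy]])
    have v: "v \<in> B" unfolding v_def by (rule R_in_B[OF comts_N(2)[OF xy]])
    have m: "m \<in> A" unfolding m_def
      by (intro subgroup.m_closed[OF subgroup_A] cc_in_A xy A_conj(1) hc)
    have c: "h x \<in> carrier K" "h y \<in> carrier K" "cc b x \<in> carrier K" "cc b y \<in> carrier K" "v \<in> carrier K" "m \<in> carrier K"
      using hc xy A_closed[OF cc_in_A] B_closed[OF v] A_closed[OF m] by auto
    have "hat' b x \<cdot> hat' b y = cc b x \<cdot> (h x \<cdot> cc b y \<cdot> inv\<^sub>K h x) \<cdot> (h x \<cdot> h y)"
      using c by (simp add: hat'_def K.m_assoc)
    also have "h x \<cdot> h y = u \<cdot> (v \<cdot> (h y \<cdot> h x))" unfolding u_def v_def by (rule rel_hh[OF xy])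
    also have "cc b x \<cdot> (h x \<cdot> cc b y \<cdot> inv\<^sub>K h x) \<cdot> (u \<cdot> (v \<cdot> (h y \<cdot> h x)))
      = cc b x \<cdot> (h x \<cdot> cc b y \<cdot> inv\<^sub>K h x) \<cdot> u \<cdot> (v \<cdot> (h y \<cdot> h x))"
      using c u by (simp add: K.m_assoc)
    also have "cc b x \<cdot> (h x \<cdot> cc b y \<cdot> inv\<^sub>K h x) \<cdot> u = (g \<cdot> u \<cdot> inv\<^sub>K g) \<cdot> m"
      unfolding u_def m_def g_def by (rule rel_cube[OF xy])
    also have "(g \<cdot> u \<cdot> inv\<^sub>K g) \<cdot> m \<cdot> (v \<cdot> (h y \<cdot> h x))
      = (g \<cdot> u \<cdot> inv\<^sub>K g) \<cdot> ((m \<cdot> v) \<cdot> (h y \<cdot> h x))"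
      using c u g by (simp add: K.m_assoc)
    also have "m \<cdot> v = v \<cdot> m" by (rule comm_AB[OF m v])
    also have "v \<cdot> m \<cdot> (h y \<cdot> h x) = v \<cdot> (hat' b y \<cdot> hat' b x)"
      using c by (simp add: m_def hat'_def K.m_assoc)
    finally show ?thesis unfolding L'g[OF comts_N(1)[OF xy]] u_def v_def .
  qed
  \<comment> \<open>For equal signs both sides coincide literally; for opposite signs both are
    trivial by \<open>rel_inv\<close>.\<close>
  have swap: "(tw b' \<cdot> cc b x \<cdot> inv\<^sub>K (tw b')) \<cdot> cc b' x = (g \<cdot> cc b' x \<cdot> inv\<^sub>K g) \<cdot> cc b x"
    if x: "x \<in> X" for x b'
  proof (cases "b' = b")
    case True then show ?thesis by (simp add: g_def)
  next
    case False
    then have b': "b' = (\<not> b)" by simp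
    show ?thesis unfolding b' g_def using rel_inv[OF x, of b] rel_inv[OF x, of "\<not> b"] by simp
  qed
  have sgn_t: "sgn_elt K b' (hat' b t) = tw b'" for b' by (simp add: hat'_t)
  have rel5: "sgn_elt K b' (hat' b t) \<cdot> hat' b x
       = word_val K (lft' b) (wd (comt G (sgn_elt G b' t) x)) \<cdot> (hat' b x \<cdot>
         (R (comt G x (inv (sgn_elt G b' t))) \<cdot> sgn_elt K b' (hat' b t)))"
    if x: "x \<in> X" for x b'
  proof -
    define p where "p = tw b'"
    define s where "s = R (comt G x (inv (sgn_elt G b' t)))"
    have c: "p \<in> carrier K" "s \<in> carrier K" "h x \<in> carrier K" "cc b x \<in> carrier K" "cc b' x \<in> carrier K"
      using closed(1)[OF t] closed(1)[OF x] B_closed[OF R_in_B[OF comts_N(4)[OF x]]] A_closed[OF cc_in_A[OF x]]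
      by (simp_all add: p_def s_def)
    have "p \<cdot> hat' b x = (p \<cdot> cc b x \<cdot> inv\<^sub>K p) \<cdot> (p \<cdot> h x)"
      using c by (simp add: hat'_def K.m_assoc)
    also have "p \<cdot> h x = cc b' x \<cdot> (h x \<cdot> (s \<cdot> p))" unfolding p_def s_def by (rule rel_th[OF x])
    also have "(p \<cdot> cc b x \<cdot> inv\<^sub>K p) \<cdot> (cc b' x \<cdot> (h x \<cdot> (s \<cdot> p)))
      = (p \<cdot> cc b x \<cdot> inv\<^sub>K p) \<cdot> cc b' x \<cdot> (h x \<cdot> (s \<cdot> p))"
      using c by (simp add: K.m_assoc)
    also have "(p \<cdot> cc b x \<cdot> inv\<^sub>K p) \<cdot> cc b' x = (g \<cdot> cc b' x \<cdot> inv\<^sub>K g) \<cdot> cc b x"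
      unfolding p_def by (rule swap[OF x])
    also have "\<dots> \<cdot> (h x \<cdot> (s \<cdot> p)) = (g \<cdot> cc b' x \<cdot> inv\<^sub>K g) \<cdot> (hat' b x \<cdot> (s \<cdot> p))"
      using c g by (simp add: hat'_def K.m_assoc)
    finally show ?thesis unfolding sgn_t L'g[OF comts_N(3)[OF x]] p_def s_def .
  qed
  have gA: "(g \<cdot> a \<cdot> inv\<^sub>K g) \<cdot> (g \<cdot> a' \<cdot> inv\<^sub>K g) = g \<cdot> (a \<cdot> a') \<cdot> inv\<^sub>K g"
    if "a \<in> carrier K" "a' \<in> carrier K" for a a' using that g by (simp add: K.m_assoc)
  have gtw: "tw b' \<cdot> (g \<cdot> a \<cdot> inv\<^sub>K g) \<cdot> inv\<^sub>K (tw b') = g \<cdot> (tw b' \<cdot> a \<cdot> inv\<^sub>K (tw b')) \<cdot> inv\<^sub>K g"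
    if a: "a \<in> carrier K" for a b'
  proof -
    define p where "p = tw b'"
    have p: "p \<in> carrier K" unfolding p_def by (rule closed)
    have "p \<cdot> (g \<cdot> a \<cdot> inv\<^sub>K g) \<cdot> inv\<^sub>K p = (p \<cdot> g) \<cdot> a \<cdot> inv\<^sub>K (p \<cdot> g)"
      using p g a by (simp add: K.m_assoc K.inv_mult_group)
    also have "\<dots> = (g \<cdot> p) \<cdot> a \<cdot> inv\<^sub>K (g \<cdot> p)"
      using tw_comm[of b'] by (simp only: p_def)
    also have "\<dots> = g \<cdot> (p \<cdot> a \<cdot> inv\<^sub>K p) \<cdot> inv\<^sub>K g"
      using p g a by (simp add: K.m_assoc K.inv_mult_group)
    finally show ?thesis unfolding p_def .
  qed
  have rel6: "word_val K (lft' b) (wd (comt G (sgn_elt G b' t) x)) \<cdot> (hat' b x \<cdot>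
         (word_val K (lft' b) (wd (comt G (sgn_elt G b' t) y)) \<cdot> (sgn_elt K False (hat' b x) \<cdot> word_val K (lft' b) (wd (comt G x y)))))
       = sgn_elt K b' (hat' b t) \<cdot> (word_val K (lft' b) (wd (comt G x y)) \<cdot> (sgn_elt K (\<not> b') (hat' b t) \<cdot>
         (word_val K (lft' b) (wd (comt G (sgn_elt G b' t) y)) \<cdot> (hat' b y \<cdot>
           (word_val K (lft' b) (wd (comt G (sgn_elt G b' t) x)) \<cdot> sgn_elt K False (hat' b y))))))"
    if xy: "x \<in> X" "y \<in> X" for x y b'
  proof -
    define u where "u = L (comt G x y)"
    define p where "p = tw b'"
    define cx where "cx = cc b' x"
    define cy where "cy = cc b' y"
    have A: "u \<in> A" "cx \<in> A" "cy \<in> A"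
      unfolding u_def cx_def cy_def by (intro L_in_A comts_N xy)+
    have c: "u \<in> carrier K" "p \<in> carrier K" "cx \<in> carrier K" "cy \<in> carrier K" "h x \<in> carrier K" "h y \<in> carrier K"
      "hat' b x \<in> carrier K" "hat' b y \<in> carrier K"
      using A A_closed closed(4)[of b'] hc H xy by (simp_all only: p_def)
    let ?g = "\<lambda>a. g \<cdot> a \<cdot> inv\<^sub>K g"
    have gc: "?g a \<in> carrier K" if "a \<in> carrier K" for a using that g by simp
    have "?g cx \<cdot> (hat' b x \<cdot> (?g cy \<cdot> (inv\<^sub>K (hat' b x) \<cdot> ?g u)))
      = ?g cx \<cdot> (hat' b x \<cdot> ?g cy \<cdot> inv\<^sub>K (hat' b x)) \<cdot> ?g u"
      using c gc by (simp only: K.m_assoc K.m_closed K.inv_closed)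
    also have "hat' b x \<cdot> ?g cy \<cdot> inv\<^sub>K (hat' b x) = ?g (h x \<cdot> cy \<cdot> inv\<^sub>K h x)"
      using hat'_conj_True[OF A(3) xy(1), of b] by (simp only: g_def)
    also have "?g cx \<cdot> ?g (h x \<cdot> cy \<cdot> inv\<^sub>K h x) \<cdot> ?g u = ?g (cx \<cdot> (h x \<cdot> cy \<cdot> inv\<^sub>K h x) \<cdot> u)"
      using c by (simp only: gA K.m_closed K.inv_closed)
    also have "cx \<cdot> (h x \<cdot> cy \<cdot> inv\<^sub>K h x) \<cdot> u
      = (p \<cdot> u \<cdot> inv\<^sub>K p) \<cdot> (cy \<cdot> (h y \<cdot> cx \<cdot> inv\<^sub>K h y))"
      unfolding u_def p_def cx_def cy_def by (rule rel_cube[OF xy])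
    also have "?g ((p \<cdot> u \<cdot> inv\<^sub>K p) \<cdot> (cy \<cdot> (h y \<cdot> cx \<cdot> inv\<^sub>K h y)))
      = ?g (p \<cdot> u \<cdot> inv\<^sub>K p) \<cdot> (?g cy \<cdot> ?g (h y \<cdot> cx \<cdot> inv\<^sub>K h y))"
      using c by (simp only: gA K.m_closed K.inv_closed)
    also have "?g (p \<cdot> u \<cdot> inv\<^sub>K p) = p \<cdot> ?g u \<cdot> inv\<^sub>K p"
      unfolding p_def by (rule gtw[OF c(1), symmetric])
    also have "?g (h y \<cdot> cx \<cdot> inv\<^sub>K h y) = hat' b y \<cdot> ?g cx \<cdot> inv\<^sub>K (hat' b y)"
      using hat'_conj_True[OF A(2) xy(2), of b] by (simp only: g_def)
    also have "p \<cdot> ?g u \<cdot> inv\<^sub>K p \<cdot> (?g cy \<cdot> (hat' b y \<cdot> ?g cx \<cdot> inv\<^sub>K (hat' b y)))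
      = p \<cdot> (?g u \<cdot> (inv\<^sub>K p \<cdot> (?g cy \<cdot> (hat' b y \<cdot> (?g cx \<cdot> inv\<^sub>K (hat' b y))))))"
      using c gc by (simp only: K.m_assoc K.m_closed K.inv_closed)
    finally show ?thesis
      unfolding sgn_t L'g[OF comts_N(3)[OF xy(1)]] L'g[OF comts_N(3)[OF xy(2)]] L'g[OF comts_N(1)[OF xy]]
        sgn_not[OF closed(1)[OF t]] u_def p_def cx_def cy_def if_False .
  qed
  have rel7: "sgn_elt K b' (hat' b t) \<cdot> (word_val K (lft' b) (wd (comt G (sgn_elt G (\<not> b') t) x)) \<cdot>
        (sgn_elt K (\<not> b') (hat' b t) \<cdot> word_val K (lft' b) (wd (comt G (sgn_elt G b' t) x)))) = \<one>\<^bsub>K\<^esub>"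
    if x: "x \<in> X" for x b'
  proof -
    define p where "p = tw b'"
    define c1 where "c1 = cc (\<not> b') x"
    define c2 where "c2 = cc b' x"
    have c: "p \<in> carrier K" "c1 \<in> carrier K" "c2 \<in> carrier K"
      using closed(4)[of b'] A_closed[OF cc_in_A[OF x]] by (simp_all only: p_def c1_def c2_def)
    let ?g = "\<lambda>a. g \<cdot> a \<cdot> inv\<^sub>K g"
    have gc: "?g a \<in> carrier K" if "a \<in> carrier K" for a using that g by simp
    have "p \<cdot> (?g c1 \<cdot> (inv\<^sub>K p \<cdot> ?g c2)) = (p \<cdot> ?g c1 \<cdot> inv\<^sub>K p) \<cdot> ?g c2"
      using c gc by (simp only: K.m_assoc K.m_closed K.inv_closed)
    also have "p \<cdot> ?g c1 \<cdot> inv\<^sub>K p = ?g (p \<cdot> c1 \<cdot> inv\<^sub>K p)"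
      unfolding p_def by (rule gtw[OF c(2)])
    also have "?g (p \<cdot> c1 \<cdot> inv\<^sub>K p) \<cdot> ?g c2 = ?g (p \<cdot> c1 \<cdot> inv\<^sub>K p \<cdot> c2)"
      using c by (simp only: gA K.m_closed K.inv_closed)
    also have "p \<cdot> c1 \<cdot> inv\<^sub>K p \<cdot> c2 = \<one>\<^bsub>K\<^esub>" unfolding p_def c1_def c2_def by (rule rel_inv[OF x])
    finally show ?thesis
      using g unfolding sgn_t L'g[OF comts_N(3)[OF x]] sgn_not[OF closed(1)[OF t]] p_def c1_def c2_def by simp
  qed
  show ?thesis unfolding rels_def
    by (intro conjI allI ballI rel1 rel2 rel3 rel4 rel5 rel6 rel7)
qed

end

lemma (in group) conj_group_hom: "g \<in> carrier G \<Longrightarrow> group_hom G G (\<lambda>x. g \<otimes> x \<otimes> inv g)"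
  unfolding group_hom_def group_hom_axioms_def
  by (auto intro!: homI simp: m_assoc is_group)

lemma (in group) group_hom_id: "group_hom G G (\<lambda>x. x)"
  unfolding group_hom_def group_hom_axioms_def by (auto intro!: homI simp: is_group)

lemma group_hom_compose:
  "group_hom G H f \<Longrightarrow> group_hom H K g \<Longrightarrow> group_hom G K (\<lambda>x. g (f x))"
  unfolding group_hom_def group_hom_axioms_def hom_def by (auto simp: Pi_iff)

section \<open>Commutators in the cover\<close>

context cover_group
begin

text \<open>Modulo the subgroup \<open>M\<close> generated by \<open>A\<close> and \<open>B\<close>,
  the letters \<open>h x\<close> commute by \<open>rel_hh\<close>, so the quotient is abelian. As
  \<open>A\<close> and \<open>B\<close> commute, each element of \<open>M\<close> is a product of
  one factor from each.\<close>

lemma commutator_split: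
  assumes ef: "e \<in> carrier K" "f \<in> carrier K"
  shows "\<exists>a\<in>A. \<exists>b\<in>B. e \<cdot> f \<cdot> inv\<^sub>K e \<cdot> inv\<^sub>K f = a \<cdot> b"
proof -
  let ?S = "h ` X \<union> l ` Y \<union> r ` Y"
  define M where "M = generate K (l ` Y \<union> r ` Y)"
  have S: "?S \<subseteq> carrier K" using hsub lsub rsub by blast
  have W: "l ` Y \<union> r ` Y \<subseteq> carrier K" using lsub rsub by blast
  have AM: "A \<subseteq> M" and BM: "B \<subseteq> M" unfolding A_def B_def M_def by (intro K.mono_generate Un_upper1 Un_upper2)+
  have sM: "subgroup M K" unfolding M_def by (rule K.generate_is_subgroup[OF W])
  have nM: "M \<lhd> K" unfolding M_def
  proof (rule K.generate_normalI[OF S gen W])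
    fix s w assume s: "s \<in> ?S" and w: "w \<in> l ` Y \<union> r ` Y"
    have sc: "s \<in> carrier K" using s S by blast
    have "w \<in> A \<or> w \<in> B" using w unfolding A_def B_def by (blast intro: generate.incl)
    then show "s \<cdot> w \<cdot> inv\<^sub>K s \<in> generate K (l ` Y \<union> r ` Y) \<and>
        inv\<^sub>K s \<cdot> w \<cdot> s \<in> generate K (l ` Y \<union> r ` Y)"
      unfolding M_def[symmetric] using A_conj[OF sc] B_conj[OF sc] AM BM by blast
  qed
  have split: "\<exists>a\<in>A. \<exists>b\<in>B. m = a \<cdot> b" if "m \<in> M" for m
    using that unfolding M_def
  proof (induction rule: generate.induct)
    case one
    then show ?case using subgroup.one_closed[OF subgroup_A] subgroup.one_closed[OF subgroup_B] by force
  next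
    case (incl m)
    then have "m \<in> A \<or> m \<in> B" unfolding A_def B_def by (blast intro: generate.incl)
    then show ?case
      using subgroup.one_closed[OF subgroup_A] subgroup.one_closed[OF subgroup_B] A_closed B_closed
      by (metis K.l_one K.r_one)
  next
    case (inv m)
    then have "inv\<^sub>K m \<in> A \<or> inv\<^sub>K m \<in> B" unfolding A_def B_def by (blast intro: generate.inv)
    then show ?case
      using subgroup.one_closed[OF subgroup_A] subgroup.one_closed[OF subgroup_B] A_closed B_closed
      by (metis K.l_one K.r_one)
  next
    case (eng m n)
    then obtain a b a' b' where ab: "a \<in> A" "b \<in> B" "m = a \<cdot> b" "a' \<in> A" "b' \<in> B" "n = a' \<cdot> b'" by blast
    have c: "a \<in> carrier K" "b \<in> carrier K" "a' \<in> carrier K" "b' \<in> carrier K" using ab A_closed B_closed by auto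
    have "m \<cdot> n = a \<cdot> ((b \<cdot> a') \<cdot> b')" using c by (simp add: ab K.m_assoc)
    also have "b \<cdot> a' = a' \<cdot> b" using comm_AB[OF ab(4,2)] ..
    also have "a \<cdot> ((a' \<cdot> b) \<cdot> b') = (a \<cdot> a') \<cdot> (b \<cdot> b')" using c by (simp add: K.m_assoc)
    finally show ?case using subgroup.m_closed[OF subgroup_A ab(1,4)] subgroup.m_closed[OF subgroup_B ab(2,5)] by blast
  qed
  let ?q = "\<lambda>x. M #>\<^bsub>K\<^esub> x"
  note qq = normal_Mod_hom[OF nM]
  interpret q: group_hom K "K Mod M" ?q
    by (simp add: group_hom_def group_hom_axioms_def qq K.is_group)
  have q1: "?q m = \<one>\<^bsub>K Mod M\<^esub>" if "m \<in> M" for m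
  proof -
    have "m \<in> kernel K (K Mod M) ?q" unfolding qq(4) by (rule that)
    then show ?thesis unfolding kernel_def by blast
  qed
  have q1_comm: "?q m \<otimes>\<^bsub>K Mod M\<^esub> ?q x = ?q x \<otimes>\<^bsub>K Mod M\<^esub> ?q m" if "m \<in> M" "x \<in> carrier K" for m x
    unfolding q1[OF that(1)] q.H.l_one[OF q.hom_closed[OF that(2)]] q.H.r_one[OF q.hom_closed[OF that(2)]] ..
  have "comm_group (K Mod M)"
  proof (rule group.generate_comm_group[OF qq(1)])
    show "?q ` ?S \<subseteq> carrier (K Mod M)" using S q.hom_closed by blast
    show "generate (K Mod M) (?q ` ?S) = carrier (K Mod M)"
      unfolding q.generate_img[OF S] gen by (rule qq(3))
    fix u v assume uv: "u \<in> ?q ` ?S" "v \<in> ?q ` ?S"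
    obtain x where x: "x \<in> ?S" "u = ?q x" using uv(1) by (rule imageE)
    obtain y where y: "y \<in> ?S" "v = ?q y" using uv(2) by (rule imageE)
    have c: "x \<in> carrier K" "y \<in> carrier K" using x y S by auto
    have M: "s \<in> h ` X \<or> s \<in> M" if "s \<in> ?S" for s
      using that unfolding M_def by (blast intro: generate.incl)
    show "u \<otimes>\<^bsub>K Mod M\<^esub> v = v \<otimes>\<^bsub>K Mod M\<^esub> u"
    proof (cases "x \<in> M \<or> y \<in> M")
      case True
      then show ?thesis using q1_comm[OF _ c(2)] q1_comm[OF _ c(1)] x(2) y(2) by metis
    next
      case False
      then have "x \<in> h ` X" "y \<in> h ` X" using M[OF x(1)] M[OF y(1)] by simp_all
      then obtain x' y' where xy: "x' \<in> X" "x = h x'" "y' \<in> X" "y = h y'" by (elim imageE) simp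
      let ?m = "L (comt G x' y') \<cdot> R (comt G (inv x') (inv y'))"
      have m: "?m \<in> M" using AM BM L_in_A[OF comts_N(1)[OF xy(1,3)]] R_in_B[OF comts_N(2)[OF xy(1,3)]]
        by (intro subgroup.m_closed[OF sM]) auto
      have "x \<cdot> y = ?m \<cdot> (y \<cdot> x)"
        unfolding xy(2,4) using rel_hh[OF xy(1,3)] closed(1)[OF xy(1)] closed(1)[OF xy(3)]
          A_closed[OF L_in_A[OF comts_N(1)[OF xy(1,3)]]] B_closed[OF R_in_B[OF comts_N(2)[OF xy(1,3)]]]
        by (simp add: K.m_assoc)
      then have "?q (x \<cdot> y) = ?q (?m \<cdot> (y \<cdot> x))" by simp
      also have "\<dots> = \<one>\<^bsub>K Mod M\<^esub> \<otimes>\<^bsub>K Mod M\<^esub> ?q (y \<cdot> x)"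
        unfolding q.hom_mult[OF subgroup.mem_carrier[OF sM m] K.m_closed[OF c(2,1)]] q1[OF m] ..
      also have "\<dots> = ?q (y \<cdot> x)" by (rule q.H.l_one[OF q.hom_closed[OF K.m_closed[OF c(2,1)]]])
      finally show ?thesis unfolding x(2) y(2) q.hom_mult[OF c] q.hom_mult[OF c(2,1)] .
    qed
  qed
  then interpret Q: comm_group "K Mod M" .
  have c: "e \<cdot> f \<in> carrier K" "f \<cdot> e \<in> carrier K" using ef by auto
  have "?q (e \<cdot> f) = ?q (f \<cdot> e)"
    unfolding q.hom_mult[OF ef] q.hom_mult[OF ef(2,1)]
    by (rule Q.m_comm[OF q.hom_closed[OF ef(1)] q.hom_closed[OF ef(2)]])
  then have "?q ((e \<cdot> f) \<cdot> inv\<^sub>K (f \<cdot> e)) = \<one>\<^bsub>K Mod M\<^esub>"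
    unfolding q.hom_mult[OF c(1) K.inv_closed[OF c(2)]] q.hom_inv[OF c(2)]
    using q.H.r_inv[OF q.hom_closed[OF c(2)]] by (simp only:)
  then have "(e \<cdot> f) \<cdot> inv\<^sub>K (f \<cdot> e) \<in> kernel K (K Mod M) ?q"
    unfolding kernel_def using c by blast
  then have "(e \<cdot> f) \<cdot> inv\<^sub>K (f \<cdot> e) \<in> M" unfolding qq(4) .
  from split[OF this] show ?thesis using ef by (simp add: K.inv_mult_group K.m_assoc)
qed

end

section \<open>The fibre product inside the square of the group\<close>

context cover_data
begin

abbreviation GG where "GG \<equiv> G \<times>\<times> G"

lemma group_GG: "group GG"
  using DirProd_group is_group by blast

lemma inv_GG: "x \<in> carrier G \<Longrightarrow> y \<in> carrier G \<Longrightarrow> inv\<^bsub>GG\<^esub> (x, y) = (inv x, inv y)"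
  by (rule inv_DirProd[OF is_group is_group])

lemma word_val_GG: "w \<in> words Y \<Longrightarrow> word_val GG (\<lambda>y. (y, \<one>)) w = (word_val G (\<lambda>y. y) w, \<one>)"
  "w \<in> words Y \<Longrightarrow> word_val GG (\<lambda>y. (\<one>, y)) w = (\<one>, word_val G (\<lambda>y. y) w)"
  using Y(2) by (induction w) (auto simp: Cons_in_words inv_GG subset_iff)

text \<open>The right coordinate of \<open>(x, inv x)\<close> conjugates by the inverse of
  \<open>x\<close>, which explains the inverted signs in the relations for \<open>r\<close>.\<close>

lemma rels_GG: "rels GG (\<lambda>x. (x, inv x)) (\<lambda>y. (y, \<one>)) (\<lambda>y. (\<one>, y))"
proof -
  have L: "word_val GG (\<lambda>y. (y, \<one>)) (wd n) = (n, \<one>)" and R: "word_val GG (\<lambda>y. (\<one>, y)) (wd n) = (\<one>, n)" if "n \<in> N" for n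
    using word_val_GG[OF wd(1)[OF that]] wd(2)[OF that] by auto
  have Xc: "x \<in> carrier G" if "x \<in> X" for x using that X by auto
  have Yc: "y \<in> carrier G" if "y \<in> Y" for y using that Y by auto
  have tc: "t \<in> carrier G" using t Xc by auto
  show ?thesis unfolding rels_def
  proof (intro conjI ballI allI, goal_cases)
    case (1 x b y)
    then show ?case unfolding L[OF conj_N(1)[OF 1(1,2)]] using Xc[OF 1(1)] Yc[OF 1(2)]
      by (cases b) (simp_all add: inv_GG m_assoc)
  next
    case (2 x b y)
    then show ?case unfolding R[OF conj_N(2)[OF 2(1,2)]] using Xc[OF 2(1)] Yc[OF 2(2)]
      by (cases b) (simp_all add: inv_GG m_assoc)
  next
    case (3 y z)
    then show ?case using Yc by simp
  next
    case (4 x y)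
    then show ?case unfolding L[OF comts_N(1)[OF 4]] R[OF comts_N(2)[OF 4]] using Xc
      by (simp add: comt_def m_assoc)
  next
    case (5 b x)
    then show ?case unfolding L[OF comts_N(3)[OF 5]] R[OF comts_N(4)[OF 5]] using Xc tc
      by (cases b) (simp_all add: inv_GG comt_def m_assoc)
  next
    case (6 b x y)
    then show ?case unfolding L[OF comts_N(3)[OF 6(1)]] L[OF comts_N(3)[OF 6(2)]] L[OF comts_N(1)[OF 6]]
      using Xc tc by (cases b) (simp_all add: inv_GG comt_def m_assoc inv_mult_group)
  next
    case (7 b x)
    then show ?case unfolding L[OF comts_N(3)[OF 7]] using Xc tc
      by (cases b) (simp_all add: inv_GG comt_def m_assoc)
  qed
qed

abbreviation fibre where "fibre M \<equiv> fibre_product_neg_id G M"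

lemma in_fibre: "subgroup M G \<Longrightarrow> (g, k) \<in> fibre M \<longleftrightarrow> g \<in> carrier G \<and> k \<in> carrier G \<and> g \<otimes> k \<in> M"
  using fibre_product_neg_id_iff[of M g k] by (auto simp: fibre_product_neg_id_def)

text \<open>Given \<open>(g, k)\<close>, some \<open>(k', k)\<close> in \<open>I\<close> has the
  same second coordinate, and the two differ by a pair \<open>(n, \<one>)\<close> with
  \<open>n\<close> in \<open>N\<close>.\<close>

lemma fibre_eqI:
  assumes I: "subgroup I GG" "I \<subseteq> fibre N"
    and hat: "\<And>x. x \<in> X \<Longrightarrow> (x, inv x) \<in> I" and left: "\<And>n. n \<in> N \<Longrightarrow> (n, \<one>) \<in> I"
  shows "I = fibre N"
proof
  have ex: "\<exists>g'. (g', g) \<in> I" if "g \<in> generate G X" for g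
    using that
  proof (induction rule: generate.induct)
    case one then show ?case using subgroup.one_closed[OF I(1)] by auto
  next
    case (incl x)
    then have "inv\<^bsub>GG\<^esub> (x, inv x) \<in> I" using subgroup.m_inv_closed[OF I(1) hat] by blast
    moreover have "x \<in> carrier G" using incl X by auto
    ultimately show ?case by (auto simp: inv_GG)
  next
    case (inv x) then show ?case using hat by blast
  next
    case (eng g k)
    then obtain g' k' where "(g', g) \<in> I" "(k', k) \<in> I" by blast
    then show ?case using subgroup.m_closed[OF I(1)] by force
  qed
  show "fibre N \<subseteq> I"
  proof
    fix p assume "p \<in> fibre N"
    then obtain g k where p: "p = (g, k)" and gk: "g \<in> carrier G" "k \<in> carrier G" "g \<otimes> k \<in> N"
      using in_fibre[OF subgroup_N] by (cases p) auto
    have "k \<in> generate G X" using gk X(3) by simp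
    then obtain k' where k': "(k', k) \<in> I" using ex by blast
    then have kk: "k' \<in> carrier G" "k' \<otimes> k \<in> N" using I(2) in_fibre[OF subgroup_N] by auto
    have "(g \<otimes> k) \<otimes> inv (k' \<otimes> k) \<in> N"
      using subgroup.m_closed[OF subgroup_N gk(3) subgroup.m_inv_closed[OF subgroup_N kk(2)]] .
    then have "g \<otimes> inv k' \<in> N" using gk kk by (simp add: inv_mult_group m_assoc)
    from subgroup.m_closed[OF I(1) left[OF this] k'] show "p \<in> I" using gk kk by (simp add: p m_assoc)
  qed
qed fact

text \<open>As \<open>N\<close> is normal, adjoining \<open>t\<close> only adds powers of
  \<open>t\<close> modulo \<open>N\<close>.\<close>

lemma insert_coset:
  assumes "g \<in> generate G (insert t Y)"
  shows "\<exists>i :: int. g \<otimes> inv (t [^] i) \<in> N"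
proof -
  have tc: "t \<in> carrier G" using t X by auto
  have sub: "insert t Y \<subseteq> carrier G" using tc Y by auto
  note N = subgroup_N
  show ?thesis using assms
  proof (induction rule: generate.induct)
    case one then show ?case using subgroup.one_closed[OF N] by (intro exI[of _ 0]) simp
  next
    case (incl y)
    show ?case
    proof (cases "y = t")
      case True then show ?thesis using subgroup.one_closed[OF N] tc by (intro exI[of _ 1]) (simp add: int_pow_1)
    next
      case False
      then have "y \<in> N" "y \<in> carrier G" using incl Y_N Y by auto
      then show ?thesis by (intro exI[of _ 0]) simp
    qed
  next
    case (inv y)
    show ?case
    proof (cases "y = t")
      case True then show ?thesis using subgroup.one_closed[OF N] tc
        by (intro exI[of _ "- 1"]) (simp add: int_pow_1 int_pow_neg)
    next
      case False
      then have "y \<in> N" "y \<in> carrier G" using inv Y_N Y by auto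
      then show ?thesis using subgroup.m_inv_closed[OF N] by (intro exI[of _ 0]) simp
    qed
  next
    case (eng g h)
    then obtain i j where ij: "g \<otimes> inv (t [^] (i :: int)) \<in> N" "h \<otimes> inv (t [^] (j :: int)) \<in> N" by blast
    have c: "g \<in> carrier G" "h \<in> carrier G" using eng generate_in_carrier[OF sub] by auto
    have tp: "t [^] i \<in> carrier G" "t [^] j \<in> carrier G" using tc by auto
    have "t [^] i \<otimes> (h \<otimes> inv (t [^] j)) \<otimes> inv (t [^] i) \<in> N"
      using normal.inv_op_closed2[OF normal_N tp(1) ij(2)] .
    from subgroup.m_closed[OF N ij(1) this]
    have "g \<otimes> h \<otimes> inv (t [^] i \<otimes> t [^] j) \<in> N" using c tp by (simp add: m_assoc inv_mult_group)
    then show ?case using int_pow_mult[OF tc, of i j] by metis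
  qed
qed

lemma int_pow_GG: "(t, \<one>) [^]\<^bsub>GG\<^esub> (i :: int) = (t [^] i, \<one>)"
proof -
  have tc: "t \<in> carrier G" using t X by auto
  interpret GG: group GG by (rule group_GG)
  show ?thesis
  proof (induction i rule: int_induct[where k = 0])
    case base then show ?case by simp
  next
    case (step1 i) then show ?case using tc by (simp add: GG.int_pow_succ int_pow_succ)
  next
    case (step2 i) then show ?case using tc by (simp add: GG.int_pow_pred int_pow_pred inv_GG)
  qed
qed

text \<open>This is the shape that \<open>kernel_descends\<close> asks for. A power of
  \<open>t\<close> behind \<open>g \<otimes> k\<close> can be moved next to \<open>g\<close>, since
  commutators lie in \<open>N\<close>.\<close>

lemma fibre_insert:
  "fibre (generate G (insert t Y)) = {e \<otimes>\<^bsub>GG\<^esub> (t, \<one>) [^]\<^bsub>GG\<^esub> (i :: int) | e i. e \<in> fibre N}"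
proof -
  interpret GG: group GG by (rule group_GG)
  have tc: "t \<in> carrier G" using t X by auto
  let ?N' = "generate G (insert t Y)"
  have N': "subgroup ?N' G" by (rule generate_is_subgroup) (use tc Y in auto)
  have NN': "N \<subseteq> ?N'" unfolding N_def by (rule mono_generate) auto
  have der: "derived G (carrier G) \<subseteq> ?N'" using derived_sub NN' by (auto simp: N_def)
  have sf: "subgroup (fibre ?N') GG" by (rule subgroup_fibre_product_neg_id[OF N' der])
  show ?thesis
  proof (intro equalityI subsetI)
    fix p assume "p \<in> fibre ?N'"
    then obtain g k where p: "p = (g, k)" and gk: "g \<in> carrier G" "k \<in> carrier G" "g \<otimes> k \<in> ?N'"
      using in_fibre[OF N'] by (cases p) auto
    obtain i :: int where i: "g \<otimes> k \<otimes> inv (t [^] i) \<in> N" using insert_coset[OF gk(3)] by blast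
    have ti: "t [^] i \<in> carrier G" using tc by simp
    have "g \<otimes> k \<otimes> inv (t [^] i) \<otimes> comt G (t [^] i) (inv k) \<in> N"
      by (rule subgroup.m_closed[OF subgroup_N i comt_N[OF ti inv_closed[OF gk(2)]]])
    then have "g \<otimes> inv (t [^] i) \<otimes> k \<in> N" using gk ti by (simp add: comt_def m_assoc)
    then have "(g \<otimes> inv (t [^] i), k) \<in> fibre N" using in_fibre[OF subgroup_N] gk ti by simp
    moreover have "p = (g \<otimes> inv (t [^] i), k) \<otimes>\<^bsub>GG\<^esub> (t, \<one>) [^]\<^bsub>GG\<^esub> i"
      using gk ti by (simp add: p int_pow_GG m_assoc)
    ultimately show "p \<in> {e \<otimes>\<^bsub>GG\<^esub> (t, \<one>) [^]\<^bsub>GG\<^esub> (i :: int) | e i. e \<in> fibre N}" by blast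
  next
    fix p assume "p \<in> {e \<otimes>\<^bsub>GG\<^esub> (t, \<one>) [^]\<^bsub>GG\<^esub> (i :: int) | e i. e \<in> fibre N}"
    then obtain e i where p: "p = e \<otimes>\<^bsub>GG\<^esub> (t, \<one>) [^]\<^bsub>GG\<^esub> (i :: int)" "e \<in> fibre N" by blast
    have "e \<in> fibre ?N'" using p(2) in_fibre[OF N'] in_fibre[OF subgroup_N] NN' by (cases e) auto
    moreover have "t \<in> ?N'" by (simp add: generate.incl)
    then have "(t, \<one>) \<in> fibre ?N'" using in_fibre[OF N'] tc by simp
    then have "(t, \<one>) [^]\<^bsub>GG\<^esub> i \<in> fibre ?N'" by (rule GG.subgroup_int_pow_closed[OF sf])
    ultimately show "p \<in> fibre ?N'" unfolding p(1) by (rule subgroup.m_closed[OF sf])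
  qed
qed

text \<open>\<open>E\<close> is presented by \<open>relators\<close>, and its twists lift
  conjugation by \<open>(t, \<one>)\<close> and its inverse. \<open>kernel_descends\<close> yields
  finitely many normal generators of the kernel; words for them, added to the relators, present the
  smaller fibre product.\<close>

lemma finitely_presented_fibre_descends:
  assumes fp: "finitely_presented (GG\<lparr>carrier := fibre (generate G (insert t Y))\<rparr>)"
  shows "finitely_presented (GG\<lparr>carrier := fibre N\<rparr>)"
proof -
  interpret GG: group GG by (rule group_GG)
  have tc: "t \<in> carrier G" using t X by auto
  have Xc: "x \<in> carrier G" if "x \<in> X" for x using that X by auto
  have Yc: "y \<in> carrier G" if "y \<in> Y" for y using that Y by auto
  define E where "E = presented_group gens (word_val (free_group gens) (\<lambda>x. free_rel gens `` {[(x, True)]}) ` relators)"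
  have gE: "group E" unfolding E_def by (rule presentation_presented_group(2)[OF relators_in_words])
  interpret E: group E by (rule gE)
  obtain f where pE: "presentation E gens f relators"
    unfolding E_def using presentation_presented_group(1)[OF relators_in_words] by blast
  have f: "f \<in> gens \<rightarrow> carrier E" by (rule presentationD(1)[OF pE])
  have relsE: "rels E (f \<circ> Hat) (f \<circ> Lft) (f \<circ> Rgt)"
    using relators_iff[OF gE f] presentationD(3)[OF pE] by blast
  have genE: "generate E (f ` gens) = carrier E" by (rule E.presentation_generators[OF pE])
  have fgens: "f ` gens = (f \<circ> Hat) ` X \<union> (f \<circ> Lft) ` Y \<union> (f \<circ> Rgt) ` Y"
    by (simp add: image_Un image_comp)
  interpret C: cover_group G X Y t E "f \<circ> Hat" "f \<circ> Lft" "f \<circ> Rgt"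
    by unfold_locales (use f relsE genE fgens in \<open>auto simp: Pi_iff\<close>)
  have fin: "finite (f ` gens)" "f ` gens \<subseteq> carrier E" using X Y f by auto
  have homE: "\<exists>k. group_hom E K k \<and> (\<forall>x\<in>X. k (f (Hat x)) = h' x) \<and> (\<forall>y\<in>Y. k (f (Lft y)) = l' y) \<and> (\<forall>y\<in>Y. k (f (Rgt y)) = r' y)"
    if K: "group K" and c: "h' \<in> X \<rightarrow> carrier K" "l' \<in> Y \<rightarrow> carrier K" "r' \<in> Y \<rightarrow> carrier K"
      and rl: "rels K h' l' r'" for K :: "('k, 'n) monoid_scheme" and h' l' r'
  proof -
    have cK: "case_gen h' l' r' \<in> gens \<rightarrow> carrier K" using c by (auto simp: Pi_iff)
    have "(case_gen h' l' r' \<circ> Hat) = h'" "(case_gen h' l' r' \<circ> Lft) = l'" "(case_gen h' l' r' \<circ> Rgt) = r'"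
      by (auto simp: fun_eq_iff)
    then have "\<forall>\<rho>\<in>relators. word_val K (case_gen h' l' r') \<rho> = \<one>\<^bsub>K\<^esub>" using relators_iff[OF K cK] rl by simp
    then obtain k where "k \<in> hom E K" "\<And>x. x \<in> gens \<Longrightarrow> k (f x) = case_gen h' l' r' x"
      using presentation_hom_ext[OF gE K pE cK] by metis
    then show ?thesis by (intro exI[of _ k]) (auto simp: group_hom_def group_hom_axioms_def gE K)
  qed
  have "\<forall>b. \<exists>k. group_hom E E k \<and> (\<forall>x\<in>X. k (f (Hat x)) = C.hat' b x) \<and> (\<forall>y\<in>Y. k (f (Lft y)) = C.lft' b y)
      \<and> (\<forall>y\<in>Y. k (f (Rgt y)) = f (Rgt y))"
  proof
    fix b
    show "\<exists>k. group_hom E E k \<and> (\<forall>x\<in>X. k (f (Hat x)) = C.hat' b x) \<and> (\<forall>y\<in>Y. k (f (Lft y)) = C.lft' b y)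
      \<and> (\<forall>y\<in>Y. k (f (Rgt y)) = f (Rgt y))"
    proof (rule homE[OF gE])
      show "C.hat' b \<in> X \<rightarrow> carrier E" using C.hat'_closed by auto
      show "C.lft' b \<in> Y \<rightarrow> carrier E" using C.closed(2) C.closed(4)[of b] by (auto simp: C.lft'_def)
      show "(\<lambda>y. f (Rgt y)) \<in> Y \<rightarrow> carrier E" using f by auto
      show "rels E (C.hat' b) (C.lft' b) (\<lambda>y. f (Rgt y))" using C.twisted_rels[of b] by (simp add: comp_def)
    qed
  qed
  then obtain \<alpha> where \<alpha>: "\<And>b. group_hom E E (\<alpha> b)" and \<alpha>h: "\<And>b x. x \<in> X \<Longrightarrow> \<alpha> b (f (Hat x)) = C.hat' b x"
    and \<alpha>l: "\<And>b y. y \<in> Y \<Longrightarrow> \<alpha> b (f (Lft y)) = C.lft' b y" and \<alpha>r: "\<And>b y. y \<in> Y \<Longrightarrow> \<alpha> b (f (Rgt y)) = f (Rgt y)"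
    by metis
  have "\<exists>k. group_hom E GG k \<and> (\<forall>x\<in>X. k (f (Hat x)) = (x, inv x)) \<and> (\<forall>y\<in>Y. k (f (Lft y)) = (y, \<one>))
      \<and> (\<forall>y\<in>Y. k (f (Rgt y)) = (\<one>, y))"
    by (rule homE[OF group_GG _ _ _ rels_GG]) (use Xc Yc in auto)
  then obtain \<pi> where \<pi>: "group_hom E GG \<pi>" and \<pi>h: "\<And>x. x \<in> X \<Longrightarrow> \<pi> (f (Hat x)) = (x, inv x)"
    and \<pi>l: "\<And>y. y \<in> Y \<Longrightarrow> \<pi> (f (Lft y)) = (y, \<one>)" and \<pi>r: "\<And>y. y \<in> Y \<Longrightarrow> \<pi> (f (Rgt y)) = (\<one>, y)"
    by blast
  interpret \<pi>: group_hom E GG \<pi> by (rule \<pi>)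
  have gens_cases: "P s" if "s \<in> f ` gens" "\<And>x. x \<in> X \<Longrightarrow> P (f (Hat x))" "\<And>y. y \<in> Y \<Longrightarrow> P (f (Lft y))"
    "\<And>y. y \<in> Y \<Longrightarrow> P (f (Rgt y))" for P s using that by blast
  have \<alpha>A: "\<alpha> b a = C.tw b \<otimes>\<^bsub>E\<^esub> a \<otimes>\<^bsub>E\<^esub> inv\<^bsub>E\<^esub> (C.tw b)" if "a \<in> C.A" for a b
    by (rule hom_eq_on_generate[OF \<alpha> E.conj_group_hom[OF C.closed(4)] C.lsub _ that[unfolded C.A_def]])
      (auto simp: \<alpha>l C.lft'_def)
  have \<alpha>B: "\<alpha> b z = z" if "z \<in> C.B" for z b
    by (rule hom_eq_on_generate[OF \<alpha> E.group_hom_id C.rsub _ that[unfolded C.B_def]]) (auto simp: \<alpha>r)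
  \<comment> \<open>On \<open>Hat\<close> letters the two twisting factors cancel by
    \<open>rel_inv\<close>; on \<open>A\<close> two inverse conjugations cancel; \<open>Rgt\<close>
    letters are fixed.\<close>
  have inverse: "\<alpha> b (\<alpha> (\<not> b) e) = e" if e: "e \<in> carrier E" for e b
  proof (rule hom_eq_on_generate[OF group_hom_compose[OF \<alpha> \<alpha>] E.group_hom_id fin(2) _ e[folded genE]])
    interpret a: group_hom E E "\<alpha> b" by (rule \<alpha>)
    fix s assume "s \<in> f ` gens"
    then show "\<alpha> b (\<alpha> (\<not> b) s) = s"
    proof (rule gens_cases)
      fix x assume x: "x \<in> X"
      have c: "f (Hat x) \<in> carrier E" "C.cc (\<not> b) x \<in> carrier E" "C.cc b x \<in> carrier E"
        using C.closed(1)[OF x] C.A_closed[OF C.cc_in_A[OF x]] by simp_all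
      have "\<alpha> b (\<alpha> (\<not> b) (f (Hat x))) = \<alpha> b (C.cc (\<not> b) x) \<otimes>\<^bsub>E\<^esub> \<alpha> b (f (Hat x))"
        using a.hom_mult[OF c(2,1)] \<alpha>h[OF x, of "\<not> b"] unfolding C.hat'_def by (simp only: comp_apply)
      also have "\<dots> = (C.tw b \<otimes>\<^bsub>E\<^esub> C.cc (\<not> b) x \<otimes>\<^bsub>E\<^esub> inv\<^bsub>E\<^esub> (C.tw b)) \<otimes>\<^bsub>E\<^esub> (C.cc b x \<otimes>\<^bsub>E\<^esub> f (Hat x))"
        unfolding \<alpha>A[OF C.cc_in_A[OF x]] \<alpha>h[OF x] by (simp add: C.hat'_def)
      also have "\<dots> = (C.tw b \<otimes>\<^bsub>E\<^esub> C.cc (\<not> b) x \<otimes>\<^bsub>E\<^esub> inv\<^bsub>E\<^esub> (C.tw b)) \<otimes>\<^bsub>E\<^esub> C.cc b x \<otimes>\<^bsub>E\<^esub> f (Hat x)"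
        using c C.closed(4)[of b] by (simp only: E.m_assoc E.m_closed E.inv_closed)
      also have "\<dots> = f (Hat x)" unfolding C.rel_inv[OF x] using c by simp
      finally show "\<alpha> b (\<alpha> (\<not> b) (f (Hat x))) = f (Hat x)" .
    next
      fix y assume y: "y \<in> Y"
      have lA: "f (Lft y) \<in> C.A" unfolding C.A_def using y by (auto intro: generate.incl)
      have A': "C.lft' (\<not> b) y \<in> C.A" unfolding C.lft'_def using C.A_conj(1)[OF C.closed(4) lA] by simp
      show "\<alpha> b (\<alpha> (\<not> b) (f (Lft y))) = f (Lft y)"
        unfolding \<alpha>l[OF y] \<alpha>A[OF A'] unfolding C.lft'_def using C.closed(1)[OF t] C.A_closed[OF lA]
        by (cases b) (simp_all add: E.m_assoc)
    next
      fix y assume y: "y \<in> Y"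
      show "\<alpha> b (\<alpha> (\<not> b) (f (Rgt y))) = f (Rgt y)" using \<alpha>r[OF y] by simp
    qed
  qed
  interpret ap: aut_pair E "\<alpha> True" "\<alpha> False"
  proof
    show "\<alpha> True \<in> hom E E" "\<alpha> False \<in> hom E E" using \<alpha> by (auto simp: group_hom_def group_hom_axioms_def)
    show "\<alpha> True (\<alpha> False e) = e" "\<alpha> False (\<alpha> True e) = e" if "e \<in> carrier E" for e
      using inverse[OF that, of True] inverse[OF that, of False] by simp_all
  qed
  have \<pi>L: "\<pi> (C.L n) = (n, \<one>)" if n: "n \<in> N" for n
  proof -
    have "\<pi> (C.L n) = word_val GG (\<pi> \<circ> (f \<circ> Lft)) (wd n)"
      by (rule word_val_hom[OF gE group_GG \<pi>.homh C.lY wd(1)[OF n]])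
    also have "\<dots> = word_val GG (\<lambda>y. (y, \<one>)) (wd n)" by (rule word_val_cong[OF _ wd(1)[OF n]]) (simp add: \<pi>l)
    finally show ?thesis using word_val_GG(1)[OF wd(1)[OF n]] wd(2)[OF n] by simp
  qed
  let ?\<tau> = "(t, \<one>)"
  have \<tau>: "?\<tau> \<in> carrier GG" using tc by simp
  have equi: "\<pi> (\<alpha> True e) = ?\<tau> \<otimes>\<^bsub>GG\<^esub> \<pi> e \<otimes>\<^bsub>GG\<^esub> inv\<^bsub>GG\<^esub> ?\<tau>" if e: "e \<in> carrier E" for e
  proof (rule hom_eq_on_generate[OF group_hom_compose[OF \<alpha> \<pi>] group_hom_compose[OF \<pi> GG.conj_group_hom[OF \<tau>]] fin(2) _ e[folded genE]])
    fix s assume "s \<in> f ` gens"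
    then show "\<pi> (\<alpha> True s) = ?\<tau> \<otimes>\<^bsub>GG\<^esub> \<pi> s \<otimes>\<^bsub>GG\<^esub> inv\<^bsub>GG\<^esub> ?\<tau>"
    proof (rule gens_cases)
      fix x assume x: "x \<in> X"
      have "\<pi> (\<alpha> True (f (Hat x))) = \<pi> (C.cc True x) \<otimes>\<^bsub>GG\<^esub> \<pi> (f (Hat x))"
        unfolding \<alpha>h[OF x] C.hat'_def
        using \<pi>.hom_mult[OF C.A_closed[OF C.cc_in_A[OF x, of True]] C.closed(1)[OF x]] by simp
      then show "\<pi> (\<alpha> True (f (Hat x))) = ?\<tau> \<otimes>\<^bsub>GG\<^esub> \<pi> (f (Hat x)) \<otimes>\<^bsub>GG\<^esub> inv\<^bsub>GG\<^esub> ?\<tau>"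
        unfolding \<pi>L[OF comts_N(3)[OF x]] \<pi>h[OF x] using tc Xc[OF x] by (simp add: inv_GG comt_def m_assoc)
    next
      fix y assume y: "y \<in> Y"
      have "\<pi> (\<alpha> True (f (Lft y))) = \<pi> (f (Hat t)) \<otimes>\<^bsub>GG\<^esub> \<pi> (f (Lft y)) \<otimes>\<^bsub>GG\<^esub> inv\<^bsub>GG\<^esub> \<pi> (f (Hat t))"
        unfolding \<alpha>l[OF y] C.lft'_def using C.closed(1)[OF t] C.closed(2)[OF y] by simp
      then show "\<pi> (\<alpha> True (f (Lft y))) = ?\<tau> \<otimes>\<^bsub>GG\<^esub> \<pi> (f (Lft y)) \<otimes>\<^bsub>GG\<^esub> inv\<^bsub>GG\<^esub> ?\<tau>"
        unfolding \<pi>h[OF t] \<pi>l[OF y] using tc Yc[OF y] by (simp add: inv_GG)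
    next
      fix y assume y: "y \<in> Y"
      show "\<pi> (\<alpha> True (f (Rgt y))) = ?\<tau> \<otimes>\<^bsub>GG\<^esub> \<pi> (f (Rgt y)) \<otimes>\<^bsub>GG\<^esub> inv\<^bsub>GG\<^esub> ?\<tau>"
        unfolding \<alpha>r[OF y] \<pi>r[OF y] using tc Yc[OF y] by (simp add: inv_GG)
    qed
  qed
  have sF: "subgroup (fibre N) GG"
    by (rule subgroup_fibre_product_neg_id[OF subgroup_N]) (use derived_sub in \<open>simp add: N_def\<close>)
  have img: "\<pi> ` carrier E = fibre N"
  proof (rule fibre_eqI)
    show "subgroup (\<pi> ` carrier E) GG" by (rule \<pi>.img_is_subgroup)
    have "\<pi> ` (f ` gens) \<subseteq> fibre N"
      using in_fibre[OF subgroup_N] Xc Yc Y_N subgroup.one_closed[OF subgroup_N] by (auto simp: \<pi>h \<pi>l \<pi>r)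
    then have "generate GG (\<pi> ` (f ` gens)) \<subseteq> fibre N" by (rule GG.generate_subgroup_incl[OF _ sF])
    then show "\<pi> ` carrier E \<subseteq> fibre N" unfolding \<pi>.generate_img[OF fin(2)] genE .
    show "(x, inv x) \<in> \<pi> ` carrier E" if "x \<in> X" for x
      using \<pi>h[OF that] C.closed(1)[OF that] by (metis comp_apply imageI)
    show "(n, \<one>) \<in> \<pi> ` carrier E" if "n \<in> N" for n
      using \<pi>L[OF that] C.A_closed[OF C.L_in_A[OF that]] by (metis imageI)
  qed
  let ?N' = "generate G (insert t Y)"
  have N': "subgroup ?N' G" by (rule generate_is_subgroup) (use tc Y in auto)
  have "N \<subseteq> ?N'" unfolding N_def by (rule mono_generate) auto
  then have der: "derived G (carrier G) \<subseteq> ?N'" using derived_sub by (auto simp: N_def)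
  have H': "subgroup (fibre ?N') GG" by (rule subgroup_fibre_product_neg_id[OF N' der])
  have H'eq: "fibre ?N' = {\<pi> e \<otimes>\<^bsub>GG\<^esub> ?\<tau> [^]\<^bsub>GG\<^esub> (i :: int) | e i. e \<in> carrier E}"
    unfolding fibre_insert img[symmetric] by blast
  \<comment> \<open>\<open>A\<close> and \<open>B\<close> map to different coordinate axes, so a
    product of elements of \<open>A\<close> and \<open>B\<close> is killed only if both factors
    are.\<close>
  have \<pi>A: "snd (\<pi> a) = \<one>" if "a \<in> C.A" for a
    using that unfolding C.A_def
  proof (induction rule: generate.induct)
    case (incl a) then show ?case using \<pi>l by auto
  next
    case (inv a)
    then obtain y where y: "y \<in> Y" "a = f (Lft y)" by auto
    then show ?case using C.closed(2)[OF y(1)] \<pi>l[OF y(1)] Yc[OF y(1)] by (simp add: inv_GG)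
  next
    case (eng a b)
    then have "a \<in> carrier E" "b \<in> carrier E" using C.A_closed by (auto simp: C.A_def)
    then show ?case using eng by (simp add: mult_DirProd')
  qed simp
  have \<pi>B: "fst (\<pi> a) = \<one>" if "a \<in> C.B" for a
    using that unfolding C.B_def
  proof (induction rule: generate.induct)
    case (incl a) then show ?case using \<pi>r by auto
  next
    case (inv a)
    then obtain y where y: "y \<in> Y" "a = f (Rgt y)" by auto
    then show ?case using C.closed(3)[OF y(1)] \<pi>r[OF y(1)] Yc[OF y(1)] by (simp add: inv_GG)
  next
    case (eng a b)
    then have "a \<in> carrier E" "b \<in> carrier E" using C.B_closed by (auto simp: C.B_def)
    then show ?case using eng by (simp add: mult_DirProd')
  qed simp
  have "\<alpha> True e \<otimes>\<^bsub>E\<^esub> inv\<^bsub>E\<^esub> e \<in> C.A" if e: "e \<in> carrier E" for e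
  proof -
    interpret a: group_hom E E "\<alpha> True" by (rule \<alpha>)
    note sA = C.subgroup_A
    have g: "\<alpha> True s \<otimes>\<^bsub>E\<^esub> inv\<^bsub>E\<^esub> s \<in> C.A" if "s \<in> f ` gens" for s
      using that
    proof (rule gens_cases)
      fix x assume x: "x \<in> X"
      have "\<alpha> True (f (Hat x)) \<otimes>\<^bsub>E\<^esub> inv\<^bsub>E\<^esub> f (Hat x) = C.cc True x"
        unfolding \<alpha>h[OF x] C.hat'_def using C.closed(1)[OF x] C.A_closed[OF C.cc_in_A[OF x, of True]] by (simp add: E.m_assoc)
      then show "\<alpha> True (f (Hat x)) \<otimes>\<^bsub>E\<^esub> inv\<^bsub>E\<^esub> f (Hat x) \<in> C.A" using C.cc_in_A[OF x, of True] by simp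
    next
      fix y assume y: "y \<in> Y"
      have lA: "f (Lft y) \<in> C.A" unfolding C.A_def using y by (auto intro: generate.incl)
      show "\<alpha> True (f (Lft y)) \<otimes>\<^bsub>E\<^esub> inv\<^bsub>E\<^esub> f (Lft y) \<in> C.A"
        unfolding \<alpha>A[OF lA] by (intro subgroup.m_closed[OF sA] subgroup.m_inv_closed[OF sA] C.A_conj(1) C.closed(4) lA)
    next
      fix y assume y: "y \<in> Y"
      have e: "f (Rgt y) \<otimes>\<^bsub>E\<^esub> inv\<^bsub>E\<^esub> f (Rgt y) = \<one>\<^bsub>E\<^esub>" using C.closed(3)[OF y] by simp
      show "\<alpha> True (f (Rgt y)) \<otimes>\<^bsub>E\<^esub> inv\<^bsub>E\<^esub> f (Rgt y) \<in> C.A"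
        unfolding \<alpha>r[OF y] e by (rule subgroup.one_closed[OF sA])
    qed
    define M where "M = C.A"
    note sM = sA[folded M_def] and gM = g[folded M_def] and conj = C.A_conj[folded M_def]
    have "e \<in> generate E (f ` gens)" using e genE by simp
    then have "\<alpha> True e \<otimes>\<^bsub>E\<^esub> inv\<^bsub>E\<^esub> e \<in> M"
    proof (induction rule: generate.induct)
      case one
      have "\<alpha> True \<one>\<^bsub>E\<^esub> \<otimes>\<^bsub>E\<^esub> inv\<^bsub>E\<^esub> \<one>\<^bsub>E\<^esub> = \<one>\<^bsub>E\<^esub>" by simp
      then show ?case using subgroup.one_closed[OF sM] by (simp only:)
    next
      case (incl s) then show ?case by (rule gM)
    next
      case (inv s)
      have "s \<in> carrier E" using fin(2) inv by (rule subsetD)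
      then have c: "s \<in> carrier E" "\<alpha> True s \<in> carrier E" by simp_all
      have "inv\<^bsub>E\<^esub> s \<otimes>\<^bsub>E\<^esub> inv\<^bsub>E\<^esub> (\<alpha> True s \<otimes>\<^bsub>E\<^esub> inv\<^bsub>E\<^esub> s) \<otimes>\<^bsub>E\<^esub> s \<in> M"
        by (rule conj(2)[OF c(1) subgroup.m_inv_closed[OF sM gM[OF inv]]])
      then show ?case using c by (simp add: E.inv_mult_group E.m_assoc)
    next
      case (eng u v)
      have c: "u \<in> carrier E" "v \<in> carrier E" using eng genE by auto
      have "(\<alpha> True u \<otimes>\<^bsub>E\<^esub> inv\<^bsub>E\<^esub> u) \<otimes>\<^bsub>E\<^esub> (u \<otimes>\<^bsub>E\<^esub> (\<alpha> True v \<otimes>\<^bsub>E\<^esub> inv\<^bsub>E\<^esub> v) \<otimes>\<^bsub>E\<^esub> inv\<^bsub>E\<^esub> u) \<in> M"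
        by (intro subgroup.m_closed[OF sM] eng.IH conj(1) c)
      then show ?case using c by (simp add: E.inv_mult_group E.m_assoc)
    qed
    then show ?thesis unfolding M_def .
  qed
  note \<alpha>1 = this
  have split: "\<pi> a = \<one>\<^bsub>GG\<^esub>" if "a \<in> C.A" "b \<in> C.B" "\<pi> (a \<otimes>\<^bsub>E\<^esub> b) = \<one>\<^bsub>GG\<^esub>" for a b
  proof -
    have c: "a \<in> carrier E" "b \<in> carrier E" using that C.A_closed C.B_closed by auto
    then have "fst (\<pi> a) \<in> carrier G" using \<pi>.hom_closed[of a] by (cases "\<pi> a") auto
    moreover have "fst (\<pi> a) \<otimes> fst (\<pi> b) = \<one>" using that(3) c by (simp add: mult_DirProd')
    ultimately show ?thesis using \<pi>A[OF that(1)] \<pi>B[OF that(2)] by (simp add: prod_eq_iff)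
  qed
  have "\<exists>J. finite J \<and> J \<subseteq> carrier E \<and> kernel E GG \<pi> = normal_closure E J"
    by (rule ap.kernel_descends[OF group_GG \<pi>.homh \<tau> equi H' H'eq fp fin genE C.normal_A C.normal_B
        \<alpha>1 C.closed(4)[of True] \<alpha>A \<alpha>B C.commutator_split split])
  then obtain J where J: "finite J" "J \<subseteq> carrier E" "kernel E GG \<pi> = normal_closure E J" by blast
  have "\<forall>j\<in>J. \<exists>w\<in>words gens. word_val E f w = j" using presentationD(4)[OF pE] J(2) by blast
  then obtain w where w: "\<And>j. j \<in> J \<Longrightarrow> w j \<in> words gens \<and> word_val E f (w j) = j" by metis
  have J': "w ` J \<subseteq> words gens" "word_val E f ` w ` J = J" using w by (auto simp: image_image)
  let ?H = "GG\<lparr>carrier := fibre N\<rparr>"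
  have gH: "group ?H" by (rule GG.subgroup_imp_group[OF sF])
  have hH: "\<pi> \<in> hom E ?H" using \<pi>.homh img by (auto simp: hom_def)
  have "kernel E ?H \<pi> = normal_closure E (word_val E f ` w ` J)" using J(3) J'(2) by (simp add: kernel_def)
  from presentation_quotient[OF gE gH pE hH _ J'(1) this] img
  have "presentation ?H gens (\<pi> \<circ> f) (relators \<union> w ` J)" by simp
  from presentation_finitely_presented[OF gH _ _ this] show ?thesis
    using X(1) Y(1) finite_relators J(1) by simp
qed

end

section \<open>The equivalence\<close>

text \<open>The relators of both factors are joined by commutators across. Both factors map to the
  presented group \<open>E\<close> with commuting images, so each element of \<open>E\<close> is
  \<open>\<phi> a\<close> times \<open>\<psi> b\<close>; its image \<open>(a, b)\<close> determines
  it.\<close>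

lemma finitely_presented_DirProd:
  fixes G :: "('a, 'm) monoid_scheme" and H :: "('b, 'n) monoid_scheme"
  assumes fpG: "finitely_presented G" and fpH: "finitely_presented H"
  shows "finitely_presented (G \<times>\<times> H)"
proof -
  have gG: "group G" and gH: "group H" using fpG fpH by (auto simp: finitely_presented_def)
  interpret G: group G by (rule gG)
  interpret H: group H by (rule gH)
  have gP: "group (G \<times>\<times> H)" by (rule DirProd_group[OF gG gH])
  interpret P: group "G \<times>\<times> H" by (rule gP)
  obtain X :: "nat set" and f R where X: "finite X" "finite R" and pG: "presentation G X f R"
    using finitely_presented_presentation[OF fpG] by blast
  obtain Z :: "nat set" and g S where Z: "finite Z" "finite S" and pH: "presentation H Z g S"
    using finitely_presented_presentation[OF fpH] by blast
  note f = presentationD(1)[OF pG] and g = presentationD(1)[OF pH]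
  define I where "I = Inl ` X \<union> Inr ` Z"
  define T where "T = map (apfst Inl) ` R \<union> map (apfst Inr) ` S \<union>
    (\<lambda>(x, z). [(Inl x, True), (Inr z, True), (Inl x, False), (Inr z, False)]) ` (X \<times> Z)"
  have T: "finite T" using X Z by (simp add: T_def)
  have wI: "map (apfst Inl) w \<in> words I" if "w \<in> words X" for w
    using map_in_words[OF that, of Inl] words_mono[of "Inl ` X" I] by (auto simp: I_def)
  have wJ: "map (apfst Inr) w \<in> words I" if "w \<in> words Z" for w
    using map_in_words[OF that, of Inr] words_mono[of "Inr ` Z" I] by (auto simp: I_def)
  have TI: "T \<subseteq> words I"
    unfolding T_def
  proof (intro Un_least image_subsetI)
    show "map (apfst Inl) r \<in> words I" if "r \<in> R" for r using wI presentationD(2)[OF pG] that by blast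
    show "map (apfst Inr) r \<in> words I" if "r \<in> S" for r using wJ presentationD(2)[OF pH] that by blast
  qed (auto simp: I_def)
  define E where "E = presented_group I (word_val (free_group I) (\<lambda>x. free_rel I `` {[(x, True)]}) ` T)"
  have gE: "group E" unfolding E_def by (rule presentation_presented_group(2)[OF TI])
  interpret E: group E by (rule gE)
  obtain k where pE: "presentation E I k T"
    unfolding E_def using presentation_presented_group(1)[OF TI] by blast
  have k: "k \<in> I \<rightarrow> carrier E" by (rule presentationD(1)[OF pE])
  have kc: "k (Inl x) \<in> carrier E" if "x \<in> X" for x using k that by (auto simp: I_def)
  have kd: "k (Inr z) \<in> carrier E" if "z \<in> Z" for z using k that by (auto simp: I_def)
  have relE: "word_val E k r = \<one>\<^bsub>E\<^esub>" if "r \<in> T" for r by (rule presentationD(3)[OF pE that])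
  obtain \<phi> where \<phi>: "\<phi> \<in> hom G E" "\<And>x. x \<in> X \<Longrightarrow> \<phi> (f x) = k (Inl x)"
  proof (rule presentation_hom_ext[OF gG gE pG, of "k \<circ> Inl"])
    show "word_val E (k \<circ> Inl) r = \<one>\<^bsub>E\<^esub>" if "r \<in> R" for r
      using relE[of "map (apfst Inl) r"] that by (auto simp: T_def word_val_map_apfst)
  qed (use kc in auto)
  obtain \<psi> where \<psi>: "\<psi> \<in> hom H E" "\<And>z. z \<in> Z \<Longrightarrow> \<psi> (g z) = k (Inr z)"
  proof (rule presentation_hom_ext[OF gH gE pH, of "k \<circ> Inr"])
    show "word_val E (k \<circ> Inr) r = \<one>\<^bsub>E\<^esub>" if "r \<in> S" for r
      using relE[of "map (apfst Inr) r"] that by (auto simp: T_def word_val_map_apfst)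
  qed (use kd in auto)
  interpret \<phi>: group_hom G E \<phi> by (simp add: group_hom_def group_hom_axioms_def gG gE \<phi>)
  interpret \<psi>: group_hom H E \<psi> by (simp add: group_hom_def group_hom_axioms_def gH gE \<psi>)
  have genG: "generate G (f ` X) = carrier G" by (rule G.presentation_generators[OF pG])
  have genH: "generate H (g ` Z) = carrier H" by (rule H.presentation_generators[OF pH])
  have genE: "generate E (k ` I) = carrier E" by (rule E.presentation_generators[OF pE])
  have fX: "f ` X \<subseteq> carrier G" and gZ: "g ` Z \<subseteq> carrier H" using f g by auto
  have kX: "k ` Inl ` X \<subseteq> carrier E" and kZ: "k ` Inr ` Z \<subseteq> carrier E" using kc kd by auto
  have im\<phi>: "\<phi> a \<in> generate E (k ` Inl ` X)" if "a \<in> carrier G" for a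
  proof -
    have "\<phi> ` (f ` X) = k ` Inl ` X" using \<phi>(2) by (auto simp: image_iff)
    then show ?thesis using \<phi>.generate_img[OF fX] genG that by auto
  qed
  have im\<psi>: "\<psi> b \<in> generate E (k ` Inr ` Z)" if "b \<in> carrier H" for b
  proof -
    have "\<psi> ` (g ` Z) = k ` Inr ` Z" using \<psi>(2) by (auto simp: image_iff)
    then show ?thesis using \<psi>.generate_img[OF gZ] genH that by auto
  qed
  have kk: "k (Inl x) \<otimes>\<^bsub>E\<^esub> k (Inr z) = k (Inr z) \<otimes>\<^bsub>E\<^esub> k (Inl x)" if xz: "x \<in> X" "z \<in> Z" for x z
  proof -
    have c: "k (Inl x) \<in> carrier E" "k (Inr z) \<in> carrier E" using kc kd xz by auto
    have "word_val E k [(Inl x, True), (Inr z, True), (Inl x, False), (Inr z, False)] = \<one>\<^bsub>E\<^esub>"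
      by (rule relE) (use xz in \<open>auto simp: T_def\<close>)
    then have "(k (Inl x) \<otimes>\<^bsub>E\<^esub> k (Inr z)) \<otimes>\<^bsub>E\<^esub> inv\<^bsub>E\<^esub> (k (Inr z) \<otimes>\<^bsub>E\<^esub> k (Inl x)) = \<one>\<^bsub>E\<^esub>"
      using c by (simp add: E.m_assoc E.inv_mult_group)
    then show ?thesis
      using c E.inv_equality[of "k (Inl x) \<otimes>\<^bsub>E\<^esub> k (Inr z)" "inv\<^bsub>E\<^esub> (k (Inr z) \<otimes>\<^bsub>E\<^esub> k (Inl x))"] by simp
  qed
  have comm: "\<phi> a \<otimes>\<^bsub>E\<^esub> \<psi> b = \<psi> b \<otimes>\<^bsub>E\<^esub> \<phi> a" if ab: "a \<in> carrier G" "b \<in> carrier H" for a b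
  proof (rule E.generate_commute[OF kX \<psi>.hom_closed[OF ab(2)] _ im\<phi>[OF ab(1)]])
    fix u assume "u \<in> k ` Inl ` X"
    then obtain x where x: "x \<in> X" "u = k (Inl x)" by blast
    have "\<psi> b \<otimes>\<^bsub>E\<^esub> u = u \<otimes>\<^bsub>E\<^esub> \<psi> b"
      by (rule E.generate_commute[OF kZ _ _ im\<psi>[OF ab(2)]]) (use x kc kk in auto)
    then show "u \<otimes>\<^bsub>E\<^esub> \<psi> b = \<psi> b \<otimes>\<^bsub>E\<^esub> u" ..
  qed
  have decomp: "\<exists>a\<in>carrier G. \<exists>b\<in>carrier H. e = \<phi> a \<otimes>\<^bsub>E\<^esub> \<psi> b" if "e \<in> generate E (k ` I)" for e
    using that
  proof (induction rule: generate.induct)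
    case one
    have "\<one>\<^bsub>E\<^esub> = \<phi> \<one>\<^bsub>G\<^esub> \<otimes>\<^bsub>E\<^esub> \<psi> \<one>\<^bsub>H\<^esub>" by simp
    then show ?case by blast
  next
    case (incl e)
    then consider x where "x \<in> X" "e = \<phi> (f x)" | z where "z \<in> Z" "e = \<psi> (g z)"
      unfolding I_def using \<phi>(2) \<psi>(2) by force
    then show ?case
    proof cases
      case 1
      then have "f x \<in> carrier G" "e = \<phi> (f x) \<otimes>\<^bsub>E\<^esub> \<psi> \<one>\<^bsub>H\<^esub>" using fX by auto
      then show ?thesis by blast
    next
      case 2
      then have "g z \<in> carrier H" "e = \<phi> \<one>\<^bsub>G\<^esub> \<otimes>\<^bsub>E\<^esub> \<psi> (g z)" using gZ by auto
      then show ?thesis by blast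
    qed
  next
    case (inv e)
    then consider x where "x \<in> X" "e = \<phi> (f x)" | z where "z \<in> Z" "e = \<psi> (g z)"
      unfolding I_def using \<phi>(2) \<psi>(2) by force
    then show ?case
    proof cases
      case 1
      then have "inv\<^bsub>G\<^esub> f x \<in> carrier G" "inv\<^bsub>E\<^esub> e = \<phi> (inv\<^bsub>G\<^esub> f x) \<otimes>\<^bsub>E\<^esub> \<psi> \<one>\<^bsub>H\<^esub>" using fX by auto
      then show ?thesis by blast
    next
      case 2
      then have "inv\<^bsub>H\<^esub> g z \<in> carrier H" "inv\<^bsub>E\<^esub> e = \<phi> \<one>\<^bsub>G\<^esub> \<otimes>\<^bsub>E\<^esub> \<psi> (inv\<^bsub>H\<^esub> g z)" using gZ by auto
      then show ?thesis by blast
    qed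
  next
    case (eng u v)
    then obtain a b c d where ab: "a \<in> carrier G" "b \<in> carrier H" "u = \<phi> a \<otimes>\<^bsub>E\<^esub> \<psi> b"
      and cd: "c \<in> carrier G" "d \<in> carrier H" "v = \<phi> c \<otimes>\<^bsub>E\<^esub> \<psi> d" by blast
    have "u \<otimes>\<^bsub>E\<^esub> v = \<phi> a \<otimes>\<^bsub>E\<^esub> ((\<psi> b \<otimes>\<^bsub>E\<^esub> \<phi> c) \<otimes>\<^bsub>E\<^esub> \<psi> d)" using ab cd by (simp add: E.m_assoc)
    also have "\<psi> b \<otimes>\<^bsub>E\<^esub> \<phi> c = \<phi> c \<otimes>\<^bsub>E\<^esub> \<psi> b" using comm[OF cd(1) ab(2)] ..
    also have "\<phi> a \<otimes>\<^bsub>E\<^esub> ((\<phi> c \<otimes>\<^bsub>E\<^esub> \<psi> b) \<otimes>\<^bsub>E\<^esub> \<psi> d) = \<phi> (a \<otimes>\<^bsub>G\<^esub> c) \<otimes>\<^bsub>E\<^esub> \<psi> (b \<otimes>\<^bsub>H\<^esub> d)"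
      using ab cd by (simp add: E.m_assoc)
    finally show ?case using ab cd by blast
  qed
  let ?p = "case_sum (\<lambda>x. (f x, \<one>\<^bsub>H\<^esub>)) (\<lambda>z. (\<one>\<^bsub>G\<^esub>, g z))"
  have pc: "?p \<in> I \<rightarrow> carrier (G \<times>\<times> H)" using f g by (auto simp: I_def)
  have evl: "word_val (G \<times>\<times> H) (\<lambda>x. (f x, \<one>\<^bsub>H\<^esub>)) w = (word_val G f w, \<one>\<^bsub>H\<^esub>)" if "w \<in> words X" for w
    using that f by (induction w) (auto simp: Cons_in_words inv_DirProd[OF gG gH] Pi_iff)
  have evr: "word_val (G \<times>\<times> H) (\<lambda>z. (\<one>\<^bsub>G\<^esub>, g z)) w = (\<one>\<^bsub>G\<^esub>, word_val H g w)" if "w \<in> words Z" for w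
    using that g by (induction w) (auto simp: Cons_in_words inv_DirProd[OF gG gH] Pi_iff)
  have prel: "word_val (G \<times>\<times> H) ?p r = \<one>\<^bsub>G \<times>\<times> H\<^esub>" if rT: "r \<in> T" for r
  proof -
    have cs: "(?p \<circ> Inl) = (\<lambda>x. (f x, \<one>\<^bsub>H\<^esub>))" "(?p \<circ> Inr) = (\<lambda>z. (\<one>\<^bsub>G\<^esub>, g z))" by (auto simp: fun_eq_iff)
    consider r' where "r' \<in> R" "r = map (apfst Inl) r'" | r' where "r' \<in> S" "r = map (apfst Inr) r'"
      | x z where "x \<in> X" "z \<in> Z" "r = [(Inl x, True), (Inr z, True), (Inl x, False), (Inr z, False)]"
      using rT by (auto simp: T_def)
    then show ?thesis
    proof cases
      case 1
      then have "r' \<in> words X" using presentationD(2)[OF pG] by blast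
      then show ?thesis using 1 evl presentationD(3)[OF pG] by (simp add: word_val_map_apfst cs)
    next
      case 2
      then have "r' \<in> words Z" using presentationD(2)[OF pH] by blast
      then show ?thesis using 2 evr presentationD(3)[OF pH] by (simp add: word_val_map_apfst cs)
    next
      case 3
      then have "f x \<in> carrier G" "g z \<in> carrier H" using f g by auto
      then show ?thesis using 3 by (simp add: inv_DirProd[OF gG gH])
    qed
  qed
  obtain \<pi> where \<pi>: "\<pi> \<in> hom E (G \<times>\<times> H)" "\<And>i. i \<in> I \<Longrightarrow> \<pi> (k i) = ?p i"
    by (rule presentation_hom_ext[OF gE gP pE pc prel]) (assumption | rule that)+
  interpret \<pi>: group_hom E "G \<times>\<times> H" \<pi> by (simp add: group_hom_def group_hom_axioms_def gE gP \<pi>)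
  have inl: "group_hom G (G \<times>\<times> H) (\<lambda>a. (a, \<one>\<^bsub>H\<^esub>))" and inr: "group_hom H (G \<times>\<times> H) (\<lambda>b. (\<one>\<^bsub>G\<^esub>, b))"
    by (auto simp: group_hom_def group_hom_axioms_def gG gH gP intro!: homI)
  have \<pi>\<phi>: "\<pi> (\<phi> a) = (a, \<one>\<^bsub>H\<^esub>)" if "a \<in> carrier G" for a
    by (rule hom_eq_on_generate[OF group_hom_compose[OF \<phi>.group_hom_axioms \<pi>.group_hom_axioms] inl fX _ that[folded genG]])
      (auto simp: \<phi>(2) \<pi>(2) I_def)
  have \<pi>\<psi>: "\<pi> (\<psi> b) = (\<one>\<^bsub>G\<^esub>, b)" if "b \<in> carrier H" for b
    by (rule hom_eq_on_generate[OF group_hom_compose[OF \<psi>.group_hom_axioms \<pi>.group_hom_axioms] inr gZ _ that[folded genH]])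
      (auto simp: \<psi>(2) \<pi>(2) I_def)
  have \<pi>ab: "\<pi> (\<phi> a \<otimes>\<^bsub>E\<^esub> \<psi> b) = (a, b)" if "a \<in> carrier G" "b \<in> carrier H" for a b
    using that by (simp add: \<pi>\<phi> \<pi>\<psi>)
  have "inj_on \<pi> (carrier E)"
  proof (rule inj_onI)
    fix u v assume uv: "u \<in> carrier E" "v \<in> carrier E" "\<pi> u = \<pi> v"
    obtain a b where ab: "a \<in> carrier G" "b \<in> carrier H" "u = \<phi> a \<otimes>\<^bsub>E\<^esub> \<psi> b" using decomp[of u] uv genE by blast
    obtain c d where cd: "c \<in> carrier G" "d \<in> carrier H" "v = \<phi> c \<otimes>\<^bsub>E\<^esub> \<psi> d" using decomp[of v] uv genE by blast
    show "u = v" using uv(3) \<pi>ab[OF ab(1,2)] \<pi>ab[OF cd(1,2)] ab(3) cd(3) by simp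
  qed
  moreover have "\<pi> ` carrier E = carrier (G \<times>\<times> H)"
  proof
    show "\<pi> ` carrier E \<subseteq> carrier (G \<times>\<times> H)" using \<pi>.hom_closed by blast
    show "carrier (G \<times>\<times> H) \<subseteq> \<pi> ` carrier E"
    proof
      fix p assume "p \<in> carrier (G \<times>\<times> H)"
      then obtain a b where ab: "a \<in> carrier G" "b \<in> carrier H" "p = (a, b)" by auto
      then show "p \<in> \<pi> ` carrier E" using \<pi>ab[OF ab(1,2)]
        by (intro image_eqI[of _ _ "\<phi> a \<otimes>\<^bsub>E\<^esub> \<psi> b"]) auto
    qed
  qed
  ultimately have "\<pi> \<in> iso E (G \<times>\<times> H)" using \<pi>(1) by (simp add: iso_def bij_betw_def)
  from presentation_iso[OF gE gP pE this] show ?thesis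
    by (rule presentation_finitely_presented[OF gP, rotated 2]) (use X Z T in \<open>auto simp: I_def\<close>)
qed

lemma (in group) Mod_comm_group:
  assumes N: "subgroup N G" and der: "derived G (carrier G) \<subseteq> N"
  shows "comm_group (G Mod N)"
proof -
  have n: "N \<lhd> G" by (rule normal_if_derived_subset[OF assms])
  note q = normal_Mod_hom[OF n]
  interpret Q: group_hom G "G Mod N" "\<lambda>g. N #> g"
    by (simp add: group_hom_def group_hom_axioms_def q is_group)
  show ?thesis
  proof (rule group.group_comm_groupI[OF q(1)])
    fix a b assume "a \<in> carrier (G Mod N)" "b \<in> carrier (G Mod N)"
    then obtain x y where x: "x \<in> carrier G" "a = N #> x" and y: "y \<in> carrier G" "b = N #> y"
      unfolding q(3)[symmetric] by blast
    have c: "x \<otimes> y \<otimes> inv x \<otimes> inv y \<in> N"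
      using der x y unfolding derived_def by (blast intro: generate.incl)
    have "N #> (x \<otimes> y) = N #> ((x \<otimes> y \<otimes> inv x \<otimes> inv y) \<otimes> (y \<otimes> x))"
      using x y by (simp add: m_assoc)
    also have "\<dots> = (N #> (x \<otimes> y \<otimes> inv x \<otimes> inv y)) #> (y \<otimes> x)"
      using x y subgroup.subset[OF N] by (intro coset_mult_assoc[symmetric]) auto
    also have "N #> (x \<otimes> y \<otimes> inv x \<otimes> inv y) = N"
      using coset_join2[OF _ N c] x y by simp
    finally have e: "N #> (x \<otimes> y) = N #> (y \<otimes> x)" .
    show "a \<otimes>\<^bsub>G Mod N\<^esub> b = b \<otimes>\<^bsub>G Mod N\<^esub> a"
      unfolding x(2) y(2) Q.hom_mult[OF x(1) y(1), symmetric] Q.hom_mult[OF y(1) x(1), symmetric] by (rule e)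
  qed
qed

lemma (in group) finitely_generated_subgroup_iff:
  assumes N: "subgroup N G"
  shows "finitely_generated (G\<lparr>carrier := N\<rparr>) \<longleftrightarrow> (\<exists>S. finite S \<and> S \<subseteq> N \<and> generate G S = N)"
  using subgroup_imp_group[OF N] generate_consistent[OF _ N] unfolding finitely_generated_def by auto

theorem corollary3p13:
  fixes G :: "('a, 'm) monoid_scheme" and N :: "'a set"
  assumes "group G"
    and "finitely_presented G"
    and "subgroup N G"
    and "derived G (carrier G) \<subseteq> N"
  shows "finitely_presented ((G \<times>\<times> G)\<lparr>carrier := fibre_product_neg_id G N\<rparr>)
     \<longleftrightarrow> finitely_generated (G\<lparr>carrier := N\<rparr>)"
proof -
  interpret G: group G by fact
  obtain Z :: "nat set" and f R where Z: "finite Z" and p: "presentation G Z f R"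
    using finitely_presented_presentation[OF assms(2)] by blast
  define X where "X = f ` Z"
  have X: "finite X" "X \<subseteq> carrier G" "generate G X = carrier G"
    using Z presentationD(1)[OF p] G.presentation_generators[OF p] by (auto simp: X_def)
  note fg = G.finitely_generated_subgroup_iff[OF assms(3)]
  show ?thesis
  proof
    assume fp: "finitely_presented ((G \<times>\<times> G)\<lparr>carrier := fibre_product_neg_id G N\<rparr>)"
    have n: "N \<lhd> G" by (rule G.normal_if_derived_subset[OF assms(3,4)])
    note q = normal_Mod_hom[OF n]
    interpret A: abelian_image G "G Mod N" "\<lambda>g. N #>\<^bsub>G\<^esub> g"
      by (intro abelian_image.intro abelian_image_axioms.intro group_hom.intro group_hom_axioms.intro
          G.Mod_comm_group assms q)
    have "A.fibre_set = fibre_product_neg_id G N"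
    proof -
      have "(N #>\<^bsub>G\<^esub> g) \<otimes>\<^bsub>G Mod N\<^esub> (N #>\<^bsub>G\<^esub> h) = \<one>\<^bsub>G Mod N\<^esub> \<longleftrightarrow> g \<otimes>\<^bsub>G\<^esub> h \<in> N"
        if c: "g \<in> carrier G" "h \<in> carrier G" for g h
      proof -
        have "g \<otimes>\<^bsub>G\<^esub> h \<in> N \<longleftrightarrow> g \<otimes>\<^bsub>G\<^esub> h \<in> kernel G (G Mod N) (\<lambda>g. N #>\<^bsub>G\<^esub> g)" unfolding q(4) ..
        also have "\<dots> \<longleftrightarrow> N #>\<^bsub>G\<^esub> (g \<otimes>\<^bsub>G\<^esub> h) = \<one>\<^bsub>G Mod N\<^esub>"
          unfolding kernel_def using c by blast
        finally show ?thesis unfolding A.hom_mult[OF c] ..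
      qed
      then show ?thesis
        using G.fibre_product_neg_id_iff[OF assms(3)] unfolding A.fibre_set_def fibre_product_neg_id_def by blast
    qed
    then have "finitely_presented A.fibre_group" using fp by (simp add: A.fibre_group_def)
    from A.finitely_presented_imp_kernel_fg[OF this X] show "finitely_generated (G\<lparr>carrier := N\<rparr>)"
      unfolding fg q(4) .
  next
    assume "finitely_generated (G\<lparr>carrier := N\<rparr>)"
    then obtain Y where Y: "finite Y" "Y \<subseteq> N" "generate G Y = N" unfolding fg by blast
    have YG: "Y \<subseteq> carrier G" using Y subgroup.subset[OF assms(3)] by blast
    let ?fp = "\<lambda>M. finitely_presented ((G \<times>\<times> G)\<lparr>carrier := fibre_product_neg_id G (generate G M)\<rparr>)"
    \<comment> \<open>Generators are removed one at a time: for empty \<open>B\<close> the subgroup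
      is all of \<open>G\<close>, for \<open>B = X\<close> it is \<open>N\<close>. Every
      intermediate subgroup contains \<open>N\<close> and thus the commutators.\<close>
    have "?fp (Y \<union> (X - B))" if "finite B" "B \<subseteq> X" for B
      using that
    proof (induction rule: finite_induct)
      case empty
      have sub: "Y \<union> X \<subseteq> carrier G" using YG X by blast
      have "generate G (Y \<union> X) = carrier G"
        using G.mono_generate[of X "Y \<union> X"] X(3) G.generate_incl[OF sub] by blast
      moreover have "fibre_product_neg_id G (carrier G) = carrier (G \<times>\<times> G)"
      proof -
        have "(g, h) \<in> fibre_product_neg_id G (carrier G) \<longleftrightarrow> (g, h) \<in> carrier (G \<times>\<times> G)" for g h
          using G.fibre_product_neg_id_iff[OF G.subgroup_self, of g h] by (auto simp: fibre_product_neg_id_def)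
        then show ?thesis by auto
      qed
      moreover have "(G \<times>\<times> G)\<lparr>carrier := carrier (G \<times>\<times> G)\<rparr> = G \<times>\<times> G" by (simp add: DirProd_def)
      ultimately show ?case using finitely_presented_DirProd[OF assms(2,2)] by (simp del: carrier_DirProd)
    next
      case (insert t B)
      have der: "derived G (carrier G) \<subseteq> generate G (Y \<union> (X - insert t B))"
        using assms(4) G.mono_generate[of Y "Y \<union> (X - insert t B)"] Y(3) by blast
      interpret c: cover_data G X "Y \<union> (X - insert t B)" t
        by unfold_locales (use X Y YG insert der in auto)
      have "insert t (Y \<union> (X - insert t B)) = Y \<union> (X - B)" using insert by blast
      then show ?case using c.finitely_presented_fibre_descends insert by (simp add: c.N_def)
    qed
    from this[OF X(1) order_refl]
    show "finitely_presented ((G \<times>\<times> G)\<lparr>carrier := fibre_product_neg_id G N\<rparr>)" using Y(3) by simp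
  qed
qed

end
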